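(* Let $f,g_1,\dots,g_r,h_1,\dots,h_s\in\mathbb R[\mathbf X]$, $S=\mathcal S(\mathbf g,\pm\mathbf h)$, and assume the minimum $f^*$ of $f$ on $S$ is attained. Let $J$ be the polar ideal and $\mathbf h'\subset\mathbb R[\mathbf X]$ a finite set of generators of $J$. If $\mathcal V_{\mathbb R}(J)$ is finite, then the moment relaxation $(\mathcal L_{2d}(\mathbf g,\pm\mathbf h'))_{d\in\mathbb N}$ is exact for $f$: $f^*_{\mathrm{MoM},d}=f^*$ for all large $d$, and for every large $k$ there exists $d(k)$ such that for $d\ge d(k)$, every $\sigma\in\mathcal L^{(1)}_{2d}(\mathbf g,\pm\mathbf h')$ with $\sigma(f)=f^*$ satisfies $\sigma^{[k]}\in\mathcal M^{(1)}(S\cap\mathcal V_{\mathbb R}(J))^{[k]}\subseteq \mathcal M^{(1)}(S)^{[k]}$.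
   Context: $\mathbb R[\mathbf X]=\mathbb R[X_1,\dots,X_n]$, $\mathbb R[\mathbf X]_t$ polynomials of degree $\le t$, $\Sigma^2$ sums of squares, $\Sigma^2_t=\Sigma^2\cap\mathbb R[\mathbf X]_t$. For a finite family $G$, $\mathcal Q_t(G)=\{s_0+\sum_{g\in G}s_gg:s_0\in\Sigma^2_t,s_g\in\Sigma^2,\deg s_g\le t-\deg g\}$, $\mathcal L_t(G)=\{\sigma\in(\mathbb R[\mathbf X]_t)^*:\sigma\ge0\text{ on }\mathcal Q_t(G)\}$, $\mathcal L^{(1)}_t(G)$ those with $\sigma(1)=1$. $(\mathbf g,\pm\mathbf h)$ denotes the family $g_1,\dots,g_r,h_1,-h_1,\dots,h_s,-h_s$; $\mathcal S(G)=\{x\in\mathbb R^n: g(x)\ge0\ \forall g\in G\}$. $f^*_{\mathrm{MoM},d}=\inf\{\sigma(f):\sigma\in\mathcal L^{(1)}_{2d}(\mathbf g,\pm\mathbf h')\}$. $\mathcal V_{\mathbb R}(J)$ is the set of real common zeros of $J$. $\sigma^{[k]}$ restriction to $\mathbb R[\mathbf X]_k$, $B^{[k]}=\{\sigma^{[k]}:\sigma\in B\}$, $\mathcal M^{(1)}(T)$ Borel probability measures supported in $T$ viewed as functionals $f\mapsto\int f d\mu$. Polar ideal: $J=(h_1,\dots,h_s)+\prod_{\{a_1,\dots,a_k\}\subseteq\{1,\dots,r\}}\Big((g_{a_1},\dots,g_{a_k})+M_{s+k+1}\big(\operatorname{Jac}(f,h_1,\dots,h_s,g_{a_1},\dots,g_{a_k})\big)\Big)$,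 the product running over all subsets (including the empty one), where $\operatorname{Jac}(\cdot)$ is the $(s+k+1)\times n$ Jacobian matrix of the listed polynomials and $M_l(\cdot)$ is the ideal generated by its $l\times l$ minors (the zero ideal if $l>n$). *)

theory Defs
  imports "HOL-Probability.Probability" "HOL-Library.Poly_Mapping"
begin

text \<open>Real polynomials in the variables indexed by the finite type 'n
  (so the ambient space is real^'n, i.e. R^n with n = CARD('n)).
  A monomial is an exponent vector 'n =>0 nat, a polynomial is a finitely
  supported map from monomials to real coefficients.\<close>

type_synonym 'n mono = "'n \<Rightarrow>\<^sub>0 nat"
type_synonym 'n rpoly = "('n \<Rightarrow>\<^sub>0 nat) \<Rightarrow>\<^sub>0 real"

definition mdeg :: "'n mono \<Rightarrow> nat" where
  "mdeg \<alpha> = (\<Sum>i\<in>Poly_Mapping.keys \<alpha>. Poly_Mapping.lookup \<alpha> i)"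

definition tdeg :: "'n rpoly \<Rightarrow> nat" where
  "tdeg p = (if p = 0 then 0 else Max (mdeg ` Poly_Mapping.keys p))"

definition monom_eval :: "'n mono \<Rightarrow> real ^ ('n::finite) \<Rightarrow> real" where
  "monom_eval \<alpha> x = (\<Prod>i\<in>UNIV. (x $ i) ^ Poly_Mapping.lookup \<alpha> i)"

definition peval :: "('n::finite) rpoly \<Rightarrow> real ^ 'n \<Rightarrow> real" where
  "peval p x = (\<Sum>\<alpha>\<in>Poly_Mapping.keys p. Poly_Mapping.lookup p \<alpha> * monom_eval \<alpha> x)"

definition pderiv_var :: "'n \<Rightarrow> 'n rpoly \<Rightarrow> 'n rpoly" where
  "pderiv_var i p = (\<Sum>\<alpha>\<in>Poly_Mapping.keys p.
      Poly_Mapping.single (\<alpha> - Poly_Mapping.single i 1) (Poly_Mapping.lookup p \<alpha> * of_nat (Poly_Mapping.lookup \<alpha> i)))"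

definition polys_le :: "nat \<Rightarrow> 'n rpoly set" where
  "polys_le t = {p. tdeg p \<le> t}"

definition sos :: "'n rpoly set" where
  "sos = {p. \<exists>qs. p = sum_list (map (\<lambda>q. q * q) qs)}"

definition sos_le :: "nat \<Rightarrow> 'n rpoly set" where
  "sos_le t = sos \<inter> polys_le t"

text \<open>Truncated quadratic module Q_t(G) of a finite family G (a list, so that
  repetitions such as h, -h are allowed).  The degree condition
  deg s_g <= t - deg g is read as: s_g = 0 or deg s_g + deg g <= t.\<close>
definition qmod_t :: "nat \<Rightarrow> 'n rpoly list \<Rightarrow> 'n rpoly set" where
  "qmod_t t G = {s0 + (\<Sum>i<length G. s i * G ! i) | s0 s.
      s0 \<in> sos_le t \<and>
      (\<forall>i<length G. s i \<in> sos \<and> (s i = 0 \<or> tdeg (s i) + tdeg (G ! i) \<le> t))}"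

text \<open>Linear functionals on R[X]_t, represented by their values on the monomial
  basis of R[X]_t (values on monomials of degree > t are fixed to 0); the
  functional acts on polynomials by the Riesz map.\<close>
definition functionals :: "nat \<Rightarrow> ('n mono \<Rightarrow> real) set" where
  "functionals t = {y. \<forall>\<alpha>. t < mdeg \<alpha> \<longrightarrow> y \<alpha> = 0}"

definition apply_fun :: "('n mono \<Rightarrow> real) \<Rightarrow> 'n rpoly \<Rightarrow> real" where
  "apply_fun y p = (\<Sum>\<alpha>\<in>Poly_Mapping.keys p. Poly_Mapping.lookup p \<alpha> * y \<alpha>)"

definition Lt :: "nat \<Rightarrow> 'n rpoly list \<Rightarrow> ('n mono \<Rightarrow> real) set" where
  "Lt t G = {y \<in> functionals t. \<forall>q\<in>qmod_t t G. 0 \<le> apply_fun y q}"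

definition Lt1 :: "nat \<Rightarrow> 'n rpoly list \<Rightarrow> ('n mono \<Rightarrow> real) set" where
  "Lt1 t G = {y \<in> Lt t G. apply_fun y 1 = 1}"

definition restrict_fun :: "nat \<Rightarrow> ('n mono \<Rightarrow> real) \<Rightarrow> ('n mono \<Rightarrow> real)" where
  "restrict_fun k y = (\<lambda>\<alpha>. if mdeg \<alpha> \<le> k then y \<alpha> else 0)"

definition pm_family :: "'n rpoly list \<Rightarrow> 'n rpoly list \<Rightarrow> 'n rpoly list" where
  "pm_family g h = g @ concat (map (\<lambda>p. [p, - p]) h)"

definition semialg :: "('n::finite) rpoly list \<Rightarrow> (real ^ 'n) set" where
  "semialg G = {x. \<forall>p\<in>set G. 0 \<le> peval p x}"

text \<open>Moment relaxation value f*_{MoM,d} (as an extended real: Inf of the empty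
  set is +infinity, unbounded below gives -infinity).\<close>
definition fmom :: "'n rpoly \<Rightarrow> 'n rpoly list \<Rightarrow> 'n rpoly list \<Rightarrow> nat \<Rightarrow> ereal" where
  "fmom f g h' d = Inf ((\<lambda>y. ereal (apply_fun y f)) ` Lt1 (2 * d) (pm_family g h'))"

definition meas1 :: "(real ^ ('n::finite)) set \<Rightarrow> ('n mono \<Rightarrow> real) set" where
  "meas1 T = {(\<lambda>\<alpha>. integral\<^sup>L \<mu> (monom_eval \<alpha>)) | \<mu>.
      prob_space \<mu> \<and> sets \<mu> = sets borel \<and> (AE x in \<mu>. x \<in> T) \<and>
      (\<forall>\<alpha>. integrable \<mu> (monom_eval \<alpha>))}"

definition pideal :: "'n rpoly set \<Rightarrow> 'n rpoly set" where
  "pideal B = {p. \<exists>F c. finite F \<and> F \<subseteq> B \<and> p = (\<Sum>b\<in>F. c b * b)}"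

definition ideal_sum :: "'n rpoly set \<Rightarrow> 'n rpoly set \<Rightarrow> 'n rpoly set" where
  "ideal_sum I K = pideal (I \<union> K)"

definition ideal_prod :: "'a set \<Rightarrow> ('a \<Rightarrow> 'n rpoly set) \<Rightarrow> 'n rpoly set" where
  "ideal_prod AA I = pideal {(\<Prod>A\<in>AA. p A) | p. \<forall>A\<in>AA. p A \<in> I A}"

text \<open>Ideal generated by the l x l minors, l = length ps, of the Jacobian matrix
  of the list ps (rows = polynomials, columns = variables); it is the zero ideal
  if l exceeds the number of variables.  A minor is given by an injective
  choice c of l columns.\<close>
definition jac_minor :: "'n rpoly list \<Rightarrow> (nat \<Rightarrow> 'n) \<Rightarrow> 'n rpoly" where
  "jac_minor ps c = (\<Sum>\<pi> | \<pi> permutes {..<length ps}.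
      of_int (sign \<pi>) * (\<Prod>i<length ps. pderiv_var (c (\<pi> i)) (ps ! i)))"

definition maximal_minors_ideal :: "'n rpoly list \<Rightarrow> 'n rpoly set" where
  "maximal_minors_ideal ps = pideal {jac_minor ps c | c. inj_on c {..<length ps}}"

definition polar_ideal :: "'n rpoly \<Rightarrow> 'n rpoly list \<Rightarrow> 'n rpoly list \<Rightarrow> 'n rpoly set" where
  "polar_ideal f g h = ideal_sum (pideal (set h))
     (ideal_prod (Pow {..<length g})
        (\<lambda>A. ideal_sum (pideal ((\<lambda>a. g ! a) ` A))
               (maximal_minors_ideal (f # h @ map (\<lambda>a. g ! a) (sorted_list_of_set A)))))"

definition real_variety :: "('n::finite) rpoly set \<Rightarrow> (real ^ 'n) set" where
  "real_variety J = {x. \<forall>p\<in>J. peval p x = 0}"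

end

theory Submission
  imports Defs "HOL-Algebra.Algebraic_Closure_Type" "HOL-Library.Multiset_Order"
begin

text \<open>
  If \<open>x\<close> minimises \<open>f\<close> on \<open>S\<close> and \<open>A\<close> is the set of active inequality constraints, the gradients of
  \<open>f\<close>, \<open>h\<close> and \<open>g\<^sub>a\<close> (\<open>a \<in> A\<close>) are dependent, since otherwise the map with these components would be
  open at \<open>x\<close> and \<open>f\<close> could be decreased inside \<open>S\<close>. Hence \<open>x\<close> lies in the variety \<open>V\<close> of the polar ideal.

  Let \<open>p\<close> vanish on the finite set \<open>V\<close>. By the real Nullstellensatz some \<open>p\<^bsup>2m\<^esup> + s\<close> with \<open>s\<close> a sum of squares
  lies in the ideal, so every feasible functional of large order kills it; positivity and repeated use of
  the Cauchy--Schwarz inequality then show that it kills \<open>p\<close>. Applied to finitely many differences between polynomials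
  and their interpolants on \<open>V\<close>, this makes the truncated functional a nonnegative combination of
  evaluations at points of \<open>V\<close>, and the localising constraints remove the points outside \<open>S\<close>.

  The real Nullstellensatz comes from the Artin--Lang theorem: a prime cone of the polynomial ring makes the
  residue ring an ordered domain, whose fraction field embeds into a real closed field, and
  sign conditions solvable in a real closed field that extends the reals are solvable over the reals. The
  last step eliminates one variable at a time by the Cohen--Hoermander method: for a finite set of univariate polynomials,
  the signs of finitely many polynomial expressions in the coefficients determine the order and sign
  pattern at the roots.
\<close>

text \<open>Finiteness of \<open>V\<close> concerns real zeros only: the polar ideal may fail to be
  radical and may have infinitely many complex zeros, so no finite-dimensional quotient ring is at
  hand. What links vanishing on real points with the relaxation is an identity
  \<open>(p * p) ^ m + s\<close> in the ideal. It has a fixed degree and hence binds every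
  functional of sufficiently high order, with a bound independent of the functional; for given
  \<open>k\<close> only finitely many such identities are needed. Such identities come from real
  points, but the ordered fields attached to prime cones contain infinitesimals in general.
  Completeness and compactness are lost there, so every fact on roots has to follow from the
  intermediate value property of polynomials, and it is compared across two fields. During
  elimination the coefficients are themselves polynomials, so division leaves powers of leading
  coefficients behind, and these may specialise to zero; this dictates the case distinctions and the
  multiset induction.\<close>

hide_const (open) Polynomials.degree Polynomials.lead_coeff up_ring.coeff up_ring.monom
  Coset.order Module.smult Poly_Mapping.degree

unbundle no fps_syntax

section \<open>Real closed fields\<close>

text \<open>For ordered fields this is equivalent to the usual axioms (square roots of positive
  elements, roots of odd degree polynomials), and it is the form in which roots are produced below.
  One direction of the sign change suffices, since the coefficients can be negated.\<close>

class real_closed_field = linordered_field +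
  assumes poly_sum_ivt:
    "a < b \<Longrightarrow> (\<Sum>k\<le>n. c k * a ^ k) < 0 \<Longrightarrow> 0 < (\<Sum>k\<le>n. c k * b ^ k)
      \<Longrightarrow> \<exists>x. a < x \<and> x < b \<and> (\<Sum>k\<le>n. c k * x ^ k) = 0"

lemma rcf_IVT_pos:
  fixes p :: "'a::real_closed_field poly"
  assumes "a < b" "poly p a < 0" "0 < poly p b"
  shows "\<exists>x. a < x \<and> x < b \<and> poly p x = 0"
  using poly_sum_ivt[OF assms(1), of "coeff p" "degree p"] assms(2,3) by (simp add: poly_altdef)

lemma rcf_IVT:
  fixes p :: "'a::real_closed_field poly"
  assumes "a < b" "poly p a * poly p b < 0"
  shows "\<exists>x. a < x \<and> x < b \<and> poly p x = 0"
proof (cases "poly p a < 0")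
  case True
  then show ?thesis using assms rcf_IVT_pos[of a b p] by (auto simp: mult_less_0_iff)
next
  case False
  then show ?thesis using assms rcf_IVT_pos[of a b "-p"] by (auto simp: mult_less_0_iff)
qed

instance real :: real_closed_field
proof
  fix a b :: real and c :: "nat \<Rightarrow> real" and n
  assume *: "a < b" "(\<Sum>k\<le>n. c k * a ^ k) < 0" "0 < (\<Sum>k\<le>n. c k * b ^ k)"
  have "\<exists>x. a \<le> x \<and> x \<le> b \<and> (\<Sum>k\<le>n. c k * x ^ k) = 0"
    using * by (intro IVT') (auto intro!: continuous_intros)
  then obtain x where "a \<le> x" "x \<le> b" "(\<Sum>k\<le>n. c k * x ^ k) = 0" by blast
  with * show "\<exists>x. a < x \<and> x < b \<and> (\<Sum>k\<le>n. c k * x ^ k) = 0"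
    by (metis less_eq_real_def less_irrefl)
qed

text \<open>The analytic proof takes an extremum on the interval, whose existence rests on
  compactness. Instead the multiplicities of two neighbouring roots are split off, and the remaining
  factor of the derivative changes sign between them.\<close>

lemma rcf_Rolle:
  fixes p :: "'a::real_closed_field poly"
  assumes ab: "a < b" and pa: "poly p a = 0" and pb: "poly p b = 0"
  shows "\<exists>c. a < c \<and> c < b \<and> poly (pderiv p) c = 0"
proof (cases "p = 0")
  case True
  then show ?thesis using dense[OF ab] by auto
next
  case False
  define Z where "Z = {x. poly p x = 0 \<and> a < x}"
  have finZ: "finite Z" using poly_roots_finite[OF False] by (auto simp: Z_def)
  have bZ: "b \<in> Z" using ab pb by (auto simp: Z_def)
  define b' where "b' = Min Z"
  have b'Z: "b' \<in> Z" and b'min: "\<And>z. z \<in> Z \<Longrightarrow> b' \<le> z"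
    using finZ bZ unfolding b'_def by (auto intro: Min_in)
  have ab': "a < b'" and pb': "poly p b' = 0" and b'b: "b' \<le> b"
    using b'Z b'min[OF bZ] by (auto simp: Z_def)
  obtain q where q: "p = [:-a,1:] ^ order a p * q" "\<not> [:-a,1:] dvd q"
    using order_decomp[OF False] by blast
  define m where "m = order a p"
  have m: "m > 0" using False pa order_root[of p a] by (auto simp: m_def)
  have q0: "q \<noteq> 0" using q False by auto
  have "poly p b' = (b' - a) ^ order a p * poly q b'" by (subst q(1)) simp
  then have qb': "poly q b' = 0" using pb' ab' by simp
  obtain r where r: "q = [:-b',1:] ^ order b' q * r" "\<not> [:-b',1:] dvd r"
    using order_decomp[OF q0] by blast
  define k where "k = order b' q"
  have k: "k > 0" using q0 qb' order_root[of q b'] by (auto simp: k_def)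
  have ra: "poly r a \<noteq> 0"
    using q(2) r(1) by (metis dvd_mult poly_eq_0_iff_dvd)
  have rb: "poly r b' \<noteq> 0" using r(2) by (simp add: poly_eq_0_iff_dvd)
  define A where "A = [:-a,1:]"
  define B where "B = [:-b',1:]"
  have p_eq: "p = A ^ m * (B ^ k * r)" using q(1) r(1) by (simp add: A_def B_def m_def k_def)
  have nor: "\<And>x. a < x \<Longrightarrow> x < b' \<Longrightarrow> poly r x \<noteq> 0"
  proof
    fix x assume x: "a < x" "x < b'" "poly r x = 0"
    then have "x \<in> Z" by (auto simp: Z_def p_eq)
    with b'min x show False by force
  qed
  \<comment> \<open>\<open>pderiv p\<close> is \<open>A ^ (m - 1) * B ^ (k - 1) * g\<close>. At
    \<open>a\<close> and at \<open>b'\<close> only one summand of \<open>g\<close> survives, and the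
    two values have opposite signs because the rootless factor \<open>r\<close> keeps its sign from
    \<open>a\<close> to \<open>b'\<close>.\<close>
  define g where "g = of_nat m * B * r + of_nat k * A * r + A * B * pderiv r"
  obtain m' k' where mk: "m = Suc m'" "k = Suc k'" using m k by (metis gr0_implies_Suc)
  have sm: "smult (of_nat n) P = of_nat n * P" for n and P :: "'a poly"
    by (simp add: of_nat_poly)
  have dA: "pderiv A = 1" "pderiv B = 1" by (simp_all add: A_def B_def pderiv_pCons)
  have dp: "pderiv p = A ^ m' * B ^ k' * g"
    unfolding p_eq g_def mk pderiv_mult pderiv_power_Suc dA sm
    by (simp add: algebra_simps)
  have ga: "poly g a = of_nat m * (a - b') * poly r a"
    by (simp add: g_def A_def B_def algebra_simps)
  have gb: "poly g b' = of_nat k * (b' - a) * poly r b'"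
    by (simp add: g_def A_def B_def algebra_simps)
  have rr: "poly r a * poly r b' > 0"
    using rcf_IVT[of a b' r] ab' nor ra rb
    by (metis linorder_neqE_linordered_idom mult_eq_0_iff)
  have "poly g a * poly g b' = - (of_nat m * of_nat k * (b' - a)\<^sup>2 * (poly r a * poly r b'))"
    unfolding ga gb by (simp add: power2_eq_square algebra_simps)
  moreover have "of_nat m * of_nat k * (b' - a)\<^sup>2 * (poly r a * poly r b') > 0"
    using m k ab' rr by simp
  ultimately have "poly g a * poly g b' < 0" by simp
  from rcf_IVT[OF ab' this] obtain c where c: "a < c" "c < b'" "poly g c = 0" by blast
  then show ?thesis using dp b'b by (intro exI[of _ c]) auto
qed

lemma rcf_MVT:
  fixes p :: "'a::real_closed_field poly"
  assumes ab: "a < b"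
  shows "\<exists>c. a < c \<and> c < b \<and> poly p b - poly p a = (b - a) * poly (pderiv p) c"
proof -
  define s where "s = (poly p b - poly p a) / (b - a)"
  define q where "q = p - [: poly p a - s * a, s :]"
  have qa: "poly q a = 0" by (simp add: q_def)
  have "s * (b - a) = poly p b - poly p a" using ab by (simp add: s_def)
  then have qb: "poly q b = 0" by (simp add: q_def algebra_simps)
  obtain c where c: "a < c" "c < b" "poly (pderiv q) c = 0" using rcf_Rolle[OF ab qa qb] by blast
  have "poly (pderiv p) c = s" using c(3) by (simp add: q_def pderiv_diff pderiv_pCons)
  then show ?thesis using c ab by (intro exI[of _ c]) (simp add: s_def)
qed

lemma rcf_strict_mono:
  fixes p :: "'a::real_closed_field poly"
  assumes "a < b" "\<And>c. a < c \<Longrightarrow> c < b \<Longrightarrow> 0 < poly (pderiv p) c"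
  shows "poly p a < poly p b"
proof -
  obtain c where "a < c" "c < b" "poly p b - poly p a = (b - a) * poly (pderiv p) c"
    using rcf_MVT[OF assms(1)] by blast
  with assms have "poly p b - poly p a > 0" by simp
  then show ?thesis by simp
qed

text \<open>The induction over the coefficients needs a positive lower bound \<open>c\<close> and
  not just positivity: multiplying by a large \<open>x\<close> then outgrows any constant
  term.\<close>

lemma poly_pos_at_top:
  fixes p :: "'a::linordered_field poly"
  assumes "lead_coeff p > 0"
  shows "\<exists>M c. c > 0 \<and> (\<forall>x\<ge>M. c \<le> poly p x)"
  using assms
proof (induction p)
  case 0
  then show ?case by simp
next
  case (pCons a p)
  show ?case
  proof (cases "p = 0")
    case True
    then show ?thesis using pCons by (intro exI[of _ 0] exI[of _ a]) auto
  next
    case False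
    then have "lead_coeff p > 0" using pCons by simp
    then obtain M c where Mc: "c > 0" "\<And>x. x \<ge> M \<Longrightarrow> c \<le> poly p x" using pCons by blast
    have "1 \<le> poly (pCons a p) x" if x: "x \<ge> max M (max 0 ((1 + \<bar>a\<bar>) / c))" for x
    proof -
      have "1 + \<bar>a\<bar> \<le> x * c" using x Mc(1) by (simp add: field_simps)
      also have "\<dots> \<le> x * poly p x" using x Mc(2)[of x] by (intro mult_left_mono) auto
      finally show ?thesis by (simp add: abs_if split: if_splits)
    qed
    then show ?thesis by (intro exI[of _ "max M (max 0 ((1 + \<bar>a\<bar>) / c))"] exI[of _ 1]) auto
  qed
qed

lemma poly_pos_at_bot:
  fixes p :: "'a::linordered_field poly"
  assumes "(- 1) ^ degree p * lead_coeff p > 0"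
  shows "\<exists>M. \<forall>x\<le>M. 0 < poly p x"
proof -
  define q where "q = pcompose p [:0, -1:]"
  have "lead_coeff q = lead_coeff p * (- 1) ^ degree p"
    unfolding q_def by (subst lead_coeff_comp) auto
  then obtain M c where "c > 0" "\<And>x. x \<ge> M \<Longrightarrow> c \<le> poly q x"
    using poly_pos_at_top[of q] assms by (auto simp: mult.commute)
  then have "0 < poly p x" if "x \<le> - M" for x
    using that by (force simp: q_def poly_pcompose dest: spec[of _ "-x"])
  then show ?thesis by blast
qed

section \<open>Sign patterns of univariate polynomials\<close>

text \<open>The two arguments live in different ordered domains, so values of \<open>sgn\<close>
  cannot be equated; the two equivalences say the same.\<close>

definition same_sign :: "'a::linordered_idom \<Rightarrow> 'b::linordered_idom \<Rightarrow> bool" where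
  "same_sign x y \<longleftrightarrow> (0 < x \<longleftrightarrow> 0 < y) \<and> (x < 0 \<longleftrightarrow> y < 0)"

lemma same_sign_0: "same_sign x y \<Longrightarrow> x = 0 \<longleftrightarrow> y = 0"
  unfolding same_sign_def by (metis linorder_neqE_linordered_idom less_irrefl)

lemma same_sign_sym: "same_sign x y \<Longrightarrow> same_sign y x"
  by (auto simp: same_sign_def)

lemma same_sign_trans: "same_sign x y \<Longrightarrow> same_sign y z \<Longrightarrow> same_sign x z"
  by (auto simp: same_sign_def)

lemma same_sign_uminus: "same_sign (- x) (- y) \<longleftrightarrow> same_sign x y"
  by (auto simp: same_sign_def)

lemma same_sign_mult: "same_sign a b \<Longrightarrow> same_sign x y \<Longrightarrow> same_sign (a * x) (b * y)"
  by (auto simp: same_sign_def zero_less_mult_iff mult_less_0_iff)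

lemma same_sign_power: "same_sign a b \<Longrightarrow> same_sign (a ^ n) (b ^ n)"
  by (induction n) (auto intro: same_sign_mult simp: same_sign_def[of 1 1])

lemma same_sign_mult_cancel:
  assumes "same_sign a b" "a \<noteq> 0" "same_sign (a * x) (b * y)"
  shows "same_sign x y"
  using assms by (auto simp: same_sign_def zero_less_mult_iff mult_less_0_iff not_less)

text \<open>Relates points of two fields by their positions relative to \<open>Z\<close> and to its
  image. The case of \<open>y\<close> in \<open>Z\<close>, which forces
  \<open>y' = \<phi> y\<close>, and the unbounded gaps are included.\<close>

definition same_cut :: "('a::linorder \<Rightarrow> 'b::linorder) \<Rightarrow> 'a set \<Rightarrow> 'a \<Rightarrow> 'b \<Rightarrow> bool" where
  "same_cut \<phi> Z y y' \<longleftrightarrow> (\<forall>z\<in>Z. (z < y \<longleftrightarrow> \<phi> z < y') \<and> (y < z \<longleftrightarrow> y' < \<phi> z))"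

definition strict_mono_at :: "('a::linorder \<Rightarrow> 'b::linorder) \<Rightarrow> 'a set \<Rightarrow> bool" where
  "strict_mono_at \<phi> Z \<longleftrightarrow> (\<forall>z\<in>Z. \<forall>w\<in>Z. z < w \<longrightarrow> \<phi> z < \<phi> w)"

lemma same_cut_mono: "same_cut \<phi> Z y y' \<Longrightarrow> W \<subseteq> Z \<Longrightarrow> same_cut \<phi> W y y'"
  by (auto simp: same_cut_def)

lemma same_cut_self: "strict_mono_at \<phi> Z \<Longrightarrow> z \<in> Z \<Longrightarrow> same_cut \<phi> Z z (\<phi> z)"
  unfolding same_cut_def strict_mono_at_def
  by (metis not_less_iff_gr_or_eq)

lemma same_cut_in: "same_cut \<phi> Z y y' \<Longrightarrow> y \<in> Z \<Longrightarrow> y' = \<phi> y"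
  unfolding same_cut_def by (metis not_less_iff_gr_or_eq)

lemma same_cut_eq_iff: "same_cut \<phi> Z y y' \<Longrightarrow> z \<in> Z \<Longrightarrow> y = z \<longleftrightarrow> y' = \<phi> z"
  unfolding same_cut_def by (metis not_less_iff_gr_or_eq)

lemma finite_sets_separate:
  fixes A B :: "'a::linordered_field set"
  assumes "finite A" "finite B" "\<And>a b. a \<in> A \<Longrightarrow> b \<in> B \<Longrightarrow> a < b"
  shows "\<exists>x. (\<forall>a\<in>A. a < x) \<and> (\<forall>b\<in>B. x < b)"
proof (cases "A = {}")
  case True
  show ?thesis
  proof (cases "B = {}")
    case False
    then have "\<And>b. b \<in> B \<Longrightarrow> Min B - 1 < b"
      using assms(2) by (meson Min_le diff_less_eq le_less_trans less_add_one not_le)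
    with True show ?thesis by blast
  qed (use True in auto)
next
  case A: False
  show ?thesis
  proof (cases "B = {}")
    case True
    have "\<And>a. a \<in> A \<Longrightarrow> a < Max A + 1"
      using assms(1) A by (meson Max_ge le_less_trans less_add_one)
    with True show ?thesis by blast
  next
    case False
    then have "Max A < Min B" using A assms by (auto intro: assms(3) Max_in Min_in)
    from dense[OF this] obtain x where "Max A < x" "x < Min B" by blast
    then show ?thesis using assms A False by (intro exI[of _ x]) auto
  qed
qed

lemma same_cut_exists:
  fixes \<phi> :: "'a::linordered_field \<Rightarrow> 'b::linordered_field"
  assumes "finite Z" "strict_mono_at \<phi> Z"
  shows "\<exists>y'. same_cut \<phi> Z y y'"
proof (cases "y \<in> Z")
  case True
  then show ?thesis using same_cut_self[OF assms(2)] by blast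
next
  case False
  have "\<exists>x. (\<forall>a\<in>\<phi> ` {z\<in>Z. z < y}. a < x) \<and> (\<forall>b\<in>\<phi> ` {z\<in>Z. y < z}. x < b)"
    by (rule finite_sets_separate) (use assms in \<open>auto simp: strict_mono_at_def\<close>)
  then obtain x where x: "\<And>z. z \<in> Z \<Longrightarrow> z < y \<Longrightarrow> \<phi> z < x" "\<And>z. z \<in> Z \<Longrightarrow> y < z \<Longrightarrow> x < \<phi> z"
    by auto
  have "same_cut \<phi> Z y x" unfolding same_cut_def
    using x False by (metis less_asym not_less_iff_gr_or_eq)
  then show ?thesis ..
qed

text \<open>Here \<open>same_cut id Z y u\<close> says that \<open>u\<close> lies in the same gap of \<open>Z\<close> as \<open>y\<close>.\<close>

lemma gap_point_neg:
  fixes P :: "'a::real_closed_field poly" and Q :: "'b::real_closed_field poly"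
  assumes fin: "finite Z" and mono: "strict_mono_at \<phi> Z"
    and deg: "degree P = degree Q" and lead: "same_sign (lead_coeff P) (lead_coeff Q)"
    and zs: "\<And>z. z \<in> Z \<Longrightarrow> same_sign (poly P z) (poly Q (\<phi> z))"
    and incP: "\<And>u. same_cut id Z y u \<Longrightarrow> 0 < poly (pderiv P) u"
    and incQ: "\<And>u. same_cut \<phi> Z y u \<Longrightarrow> 0 < poly (pderiv Q) u"
    and y: "y \<notin> Z" and Py: "poly P y \<le> 0"
  shows "\<exists>u. same_cut \<phi> Z y u \<and> poly Q u < 0"
proof -
  obtain y0 where y0: "same_cut \<phi> Z y y0" using same_cut_exists[OF fin mono] by blast
  define L where "L = {z\<in>Z. z < y}"
  show ?thesis
  proof (cases "L = {}")
    case False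
    \<comment> \<open>\<open>a\<close> is the left end of the gap of \<open>y\<close>. Strict
      increase from \<open>a\<close> to \<open>y\<close> makes \<open>P\<close> strictly negative at
      \<open>a\<close>, and the signs at points of \<open>Z\<close> are transferred, so
      \<open>Q\<close> is negative at the corresponding left end.\<close>
    define a where "a = Max L"
    have finL: "finite L" using fin by (simp add: L_def)
    have aL: "a \<in> L" unfolding a_def by (rule Max_in[OF finL False])
    have amax: "\<And>z. z \<in> L \<Longrightarrow> z \<le> a" unfolding a_def by (rule Max_ge[OF finL])
    have a: "a \<in> Z" "a < y" using aL by (auto simp: L_def)
    have "poly P a < poly P y"
    proof (rule rcf_strict_mono[OF a(2)])
      fix c assume c: "a < c" "c < y"
      have "same_cut id Z y c"
        unfolding same_cut_def id_def
      proof (intro ballI conjI iffI)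
        fix z assume z: "z \<in> Z"
        { assume "z < y" with z amax[of z] c show "z < c" by (auto simp: L_def) }
        { assume "z < c" with c show "z < y" by simp }
        { assume "y < z" with c show "c < z" by simp }
        { assume "c < z" with z amax[of z] c y show "y < z"
            by (metis (mono_tags, lifting) L_def less_asym' linorder_neqE mem_Collect_eq not_le order.strict_trans2) }
      qed
      then show "0 < poly (pderiv P) c" by (rule incP)
    qed
    then have Qa: "poly Q (\<phi> a) < 0" using Py zs[OF a(1)] by (auto simp: same_sign_def)
    have ay0: "\<phi> a < y0" using y0 a by (auto simp: same_cut_def)
    show ?thesis
    proof (cases "poly Q y0 < 0")
      case True
      with y0 show ?thesis by blast
    next
      case F: False
      \<comment> \<open>If \<open>Q\<close> is not yet negative at \<open>y0\<close>, it has a root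
        \<open>r\<close> in the gap, and monotonicity makes it negative to the left of
        \<open>r\<close>.\<close>
      obtain r where r: "\<phi> a < r" "r \<le> y0" "poly Q r = 0"
      proof (cases "poly Q y0 = 0")
        case True
        then show ?thesis using that ay0 by blast
      next
        case False
        then show ?thesis using F Qa that rcf_IVT_pos[OF ay0, of Q] by force
      qed
      have cut: "same_cut \<phi> Z y c" if c: "\<phi> a < c" "c < r" for c
        unfolding same_cut_def
      proof (intro ballI)
        fix z assume z: "z \<in> Z"
        show "(z < y \<longleftrightarrow> \<phi> z < c) \<and> (y < z \<longleftrightarrow> c < \<phi> z)"
        proof (cases "z < y")
          case True
          then have "z \<le> a" using z amax by (auto simp: L_def)
          then have "\<phi> z \<le> \<phi> a" using mono z a by (auto simp: strict_mono_at_def le_less)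
          then show ?thesis using True c by auto
        next
          case F: False
          then have "y < z" using y z by (metis linorder_neqE)
          then have "y0 < \<phi> z" using y0 z by (auto simp: same_cut_def)
          then show ?thesis using \<open>y < z\<close> F c r by auto
        qed
      qed
      obtain m where m: "\<phi> a < m" "m < r" using dense[OF r(1)] by blast
      have "poly Q m < poly Q r"
        by (rule rcf_strict_mono[OF m(2)]) (use m in \<open>auto intro!: incQ cut\<close>)
      then show ?thesis using cut[OF m] r by auto
    qed
  next
    case True
    \<comment> \<open>The gap is unbounded below. Far to the left the signs of \<open>P\<close> and
      \<open>Q\<close> are governed by degree and leading coefficient, which match.\<close>
    have up: "\<And>z. z \<in> Z \<Longrightarrow> y < z" using True y by (auto simp: L_def not_less le_less)
    have upc: "same_cut id Z y c" if "c \<le> y" for c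
      using up that unfolding same_cut_def id_def by (metis less_asym order.strict_trans1 not_le)
    have P0: "P \<noteq> 0" using incP[OF upc[of y]] by auto
    then have nz: "(-1) ^ degree P * lead_coeff P \<noteq> 0" by simp
    have "\<not> 0 < (-1) ^ degree P * lead_coeff P"
    proof
      assume "0 < (-1) ^ degree P * lead_coeff P"
      from poly_pos_at_bot[OF this] obtain M where M: "\<And>x. x \<le> M \<Longrightarrow> 0 < poly P x" by blast
      define x where "x = min M (y - 1)"
      have "x < y" unfolding x_def by (simp add: min_less_iff_disj)
      then have "poly P x < poly P y"
        by (rule rcf_strict_mono) (auto intro!: incP upc)
      with Py M[of x] show False by (simp add: x_def)
    qed
    then have "(-1) ^ degree P * lead_coeff P < 0" using nz by (meson linorder_neqE_linordered_idom)
    moreover have "same_sign ((-1) ^ degree P * lead_coeff P) ((-1) ^ degree Q * lead_coeff Q)"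
      unfolding deg using lead[unfolded deg]
      by (intro same_sign_mult same_sign_power) (auto simp: same_sign_def)
    ultimately have "(-1) ^ degree (-Q) * lead_coeff (-Q) > 0" by (auto simp: same_sign_def)
    from poly_pos_at_bot[OF this] obtain M where M: "\<And>x. x \<le> M \<Longrightarrow> poly Q x < 0" by auto
    have "same_cut \<phi> Z y (min M y0)"
      unfolding same_cut_def
    proof (intro ballI)
      fix z assume z: "z \<in> Z"
      have "y0 < \<phi> z" using y0 z up[OF z] by (auto simp: same_cut_def)
      then show "(z < y \<longleftrightarrow> \<phi> z < min M y0) \<and> (y < z \<longleftrightarrow> min M y0 < \<phi> z)"
        using up[OF z] by (auto simp: min_less_iff_disj)
    qed
    with M show ?thesis by (intro exI[of _ "min M y0"]) auto
  qed
qed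

text \<open>Reflecting the line and negating the polynomial keeps the sign of the derivative,
  reverses the order of \<open>Z\<close> and turns positive values into negative ones, so
  \<open>gap_point_neg\<close> applies to the transformed data.\<close>

lemma gap_point_pos:
  fixes P :: "'a::real_closed_field poly" and Q :: "'b::real_closed_field poly"
  assumes fin: "finite Z" and mono: "strict_mono_at \<phi> Z"
    and deg: "degree P = degree Q" and lead: "same_sign (lead_coeff P) (lead_coeff Q)"
    and zs: "\<And>z. z \<in> Z \<Longrightarrow> same_sign (poly P z) (poly Q (\<phi> z))"
    and incP: "\<And>u. same_cut id Z y u \<Longrightarrow> 0 < poly (pderiv P) u"
    and incQ: "\<And>u. same_cut \<phi> Z y u \<Longrightarrow> 0 < poly (pderiv Q) u"
    and y: "y \<notin> Z" and Py: "poly P y \<ge> 0"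
  shows "\<exists>u. same_cut \<phi> Z y u \<and> poly Q u > 0"
proof -
  define P' where "P' = - pcompose P [:0, -1:]"
  define Q' where "Q' = - pcompose Q [:0, -1:]"
  define Z' where "Z' = uminus ` Z"
  define \<psi> where "\<psi> = (\<lambda>z. - \<phi> (- z))"
  have ev: "poly P' x = - poly P (- x)" "poly Q' x' = - poly Q (- x')"
    "poly (pderiv P') x = poly (pderiv P) (- x)" "poly (pderiv Q') x' = poly (pderiv Q) (- x')" for x x'
    by (simp_all add: P'_def Q'_def poly_pcompose pderiv_pcompose pderiv_minus pderiv_pCons)
  have cut: "same_cut \<psi> Z' (-y) u \<Longrightarrow> same_cut \<phi> Z y (-u)" for u
    by (auto simp: same_cut_def \<psi>_def Z'_def less_minus_iff[of u] minus_less_iff[of u])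
  have cut': "same_cut id Z' (-y) u \<Longrightarrow> same_cut id Z y (-u)" for u
    by (auto simp: same_cut_def Z'_def less_minus_iff[of u] minus_less_iff[of u])
  have "\<exists>u. same_cut \<psi> Z' (-y) u \<and> poly Q' u < 0"
  proof (rule gap_point_neg)
    show "finite Z'" using fin by (simp add: Z'_def)
    show "strict_mono_at \<psi> Z'" using mono by (auto simp: strict_mono_at_def \<psi>_def Z'_def)
    show dd: "degree P' = degree Q'" using deg by (simp add: P'_def Q'_def degree_pcompose)
    have "lead_coeff P' = - (lead_coeff P * (-1) ^ degree P)"
         "lead_coeff Q' = - (lead_coeff Q * (-1) ^ degree Q)"
      by (simp_all only: P'_def Q'_def lead_coeff_minus) (simp_all add: lead_coeff_comp)
    then show "same_sign (lead_coeff P') (lead_coeff Q')"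
      using lead by (simp only: same_sign_uminus deg)
        (intro same_sign_mult same_sign_power, auto simp: same_sign_def)
    show "same_sign (poly P' z) (poly Q' (\<psi> z))" if "z \<in> Z'" for z
      using that zs by (auto simp: ev Z'_def \<psi>_def same_sign_uminus)
    show "0 < poly (pderiv P') u" if "same_cut id Z' (-y) u" for u
      using incP cut'[OF that] by (simp add: ev)
    show "0 < poly (pderiv Q') u" if "same_cut \<psi> Z' (-y) u" for u
      using incQ cut[OF that] by (simp add: ev)
    show "- y \<notin> Z'" using y by (auto simp: Z'_def)
    show "poly P' (-y) \<le> 0" using Py by (simp add: ev)
  qed
  then obtain u where "same_cut \<phi> Z y (-u)" "poly Q (-u) > 0" using cut by (auto simp: ev)
  then show ?thesis by blast
qed

lemma gap_convex:
  assumes "same_cut \<phi> Z y u" "same_cut \<phi> Z y v" "u \<le> c" "c \<le> v"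
  shows "same_cut \<phi> Z y c"
  using assms unfolding same_cut_def by (meson le_less_trans less_le_trans)

text \<open>The hypothesis \<open>der\<close> compares all pairs of points of the two gaps, so both
  derivatives have one constant sign there; negating both polynomials if necessary makes it
  positive. A root at \<open>y\<close> is transferred because \<open>Q\<close> takes a strictly
  negative and a strictly positive value in its gap. For this purpose the two preceding lemmas turn
  weak inequalities into strict ones.\<close>

lemma gap_sign:
  fixes P :: "'a::real_closed_field poly" and Q :: "'b::real_closed_field poly"
  assumes fin: "finite Z" and mono: "strict_mono_at \<phi> Z"
    and deg: "degree P = degree Q" and lead: "same_sign (lead_coeff P) (lead_coeff Q)"
    and zs: "\<And>z. z \<in> Z \<Longrightarrow> same_sign (poly P z) (poly Q (\<phi> z))"
    and der: "\<And>u u'. same_cut id Z y u \<Longrightarrow> same_cut \<phi> Z y u' \<Longrightarrow>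
                same_sign (poly (pderiv P) u) (poly (pderiv Q) u')"
    and nz: "poly (pderiv P) y \<noteq> 0"
    and y: "y \<notin> Z"
  shows "\<exists>u. same_cut \<phi> Z y u \<and> same_sign (poly P y) (poly Q u)"
proof -
  have pos: "\<exists>u. same_cut \<phi> Z y u \<and> same_sign (poly P y) (poly Q u)"
    if deg: "degree P = degree Q" and lead: "same_sign (lead_coeff P) (lead_coeff Q)"
    and zs: "\<And>z. z \<in> Z \<Longrightarrow> same_sign (poly P z) (poly Q (\<phi> z))"
    and der: "\<And>u u'. same_cut id Z y u \<Longrightarrow> same_cut \<phi> Z y u' \<Longrightarrow>
                same_sign (poly (pderiv P) u) (poly (pderiv Q) u')"
    and nz: "poly (pderiv P) y > 0" for P :: "'a poly" and Q :: "'b poly"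
  proof -
    obtain y0 where y0: "same_cut \<phi> Z y y0" using same_cut_exists[OF fin mono] by blast
    have yy: "same_cut id Z y y" by (simp add: same_cut_def)
    have Q: "0 < poly (pderiv Q) u" if "same_cut \<phi> Z y u" for u
      using der[OF yy that] nz by (simp add: same_sign_def)
    have P: "0 < poly (pderiv P) u" if "same_cut id Z y u" for u
      using der[OF that y0] Q[OF y0] by (simp add: same_sign_def)
    have lo: "poly P y \<le> 0 \<Longrightarrow> \<exists>u. same_cut \<phi> Z y u \<and> poly Q u < 0"
      using gap_point_neg[OF fin mono deg lead zs P Q y] by blast
    have hi: "poly P y \<ge> 0 \<Longrightarrow> \<exists>u. same_cut \<phi> Z y u \<and> poly Q u > 0"
      using gap_point_pos[OF fin mono deg lead zs P Q y] by blast
    consider "poly P y < 0" | "poly P y > 0" | "poly P y = 0" by force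
    then show ?thesis
    proof cases
      case 1
      then show ?thesis using lo by (auto simp: same_sign_def)
    next
      case 2
      then show ?thesis using hi by (auto simp: same_sign_def)
    next
      case 3
      obtain u v where u: "same_cut \<phi> Z y u" "poly Q u < 0" and v: "same_cut \<phi> Z y v" "poly Q v > 0"
        using lo hi 3 by force
      have "u \<noteq> v" using u v by auto
      then obtain c where c: "same_cut \<phi> Z y c" "poly Q c = 0"
      proof (cases "u < v")
        case True
        from rcf_IVT_pos[OF True u(2) v(2)] obtain c where "u < c" "c < v" "poly Q c = 0" by blast
        then show ?thesis using that[of c] gap_convex[OF u(1) v(1), of c] by simp
      next
        case False
        then have "v < u" using \<open>u \<noteq> v\<close> by simp
        from rcf_IVT[OF this, of Q] obtain c where "v < c" "c < u" "poly Q c = 0"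
          using u v by (auto simp: mult_less_0_iff)
        then show ?thesis using that[of c] gap_convex[OF v(1) u(1), of c] by simp
      qed
      then show ?thesis using 3 by (auto simp: same_sign_def)
    qed
  qed
  show ?thesis
  proof (cases "poly (pderiv P) y > 0")
    case True
    show ?thesis by (rule pos[OF deg lead zs der True])
  next
    case False
    have "\<exists>u. same_cut \<phi> Z y u \<and> same_sign (poly (-P) y) (poly (-Q) u)"
      by (rule pos) (use deg lead zs der nz False in \<open>auto simp: same_sign_uminus pderiv_minus\<close>)
    then show ?thesis by (simp add: same_sign_uminus)
  qed
qed

section \<open>Comparison of sign diagrams\<close>

definition zeros :: "'a::idom poly set \<Rightarrow> 'a set" where
  "zeros A = {y. \<exists>P\<in>A. P \<noteq> 0 \<and> poly P y = 0}"

lemma finite_zeros: "finite A \<Longrightarrow> finite (zeros A)"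
proof -
  assume "finite A"
  have "zeros A = (\<Union>P\<in>A - {0}. {y. poly P y = 0})" by (auto simp: zeros_def)
  then show ?thesis using \<open>finite A\<close> poly_roots_finite by auto
qed

lemma zeros_mono: "A \<subseteq> B \<Longrightarrow> zeros A \<subseteq> zeros B"
  by (auto simp: zeros_def)

definition leads_agree :: "('a::linordered_idom poly \<times> 'b::linordered_idom poly) set \<Rightarrow> bool" where
  "leads_agree S \<longleftrightarrow> (\<forall>(P,Q)\<in>S. degree P = degree Q \<and> same_sign (lead_coeff P) (lead_coeff Q))"

lemma leads_agree_0: "leads_agree S \<Longrightarrow> (P,Q) \<in> S \<Longrightarrow> P = 0 \<longleftrightarrow> Q = 0"
  unfolding leads_agree_def by (metis (mono_tags, lifting) case_prodD leading_coeff_0_iff same_sign_0)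

text \<open>Says that two families have the same Cohen--Hoermander sign diagram. Instead of a table
  with columns for roots and gaps, a single clause over all pairs of points in the same cut covers
  both, and the roots need no numbering.\<close>

definition matching ::
  "('a::linordered_field poly \<times> 'b::linordered_field poly) set \<Rightarrow> ('a \<Rightarrow> 'b) \<Rightarrow> bool" where
  "matching S \<phi> \<longleftrightarrow> bij_betw \<phi> (zeros (fst ` S)) (zeros (snd ` S)) \<and>
     strict_mono_at \<phi> (zeros (fst ` S)) \<and>
     (\<forall>y y'. same_cut \<phi> (zeros (fst ` S)) y y' \<longrightarrow>
        (\<forall>(P,Q)\<in>S. same_sign (poly P y) (poly Q y')))"

lemma strict_mono_at_inj: "strict_mono_at \<phi> Z \<Longrightarrow> inj_on \<phi> Z"
  unfolding strict_mono_at_def inj_on_def by (metis less_irrefl linorder_neqE)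

lemma strict_mono_at_less_iff:
  "strict_mono_at \<phi> Z \<Longrightarrow> z \<in> Z \<Longrightarrow> w \<in> Z \<Longrightarrow> \<phi> z < \<phi> w \<longleftrightarrow> z < w"
  unfolding strict_mono_at_def by (metis less_asym linorder_neqE)

lemma strict_mono_at_inv:
  assumes "strict_mono_at \<phi> Z" shows "strict_mono_at (inv_into Z \<phi>) (\<phi> ` Z)"
  using assms strict_mono_at_inj[OF assms] by (auto simp: strict_mono_at_def strict_mono_at_less_iff)

lemma same_cut_inv:
  assumes "strict_mono_at \<phi> Z"
  shows "same_cut (inv_into Z \<phi>) (\<phi> ` Z) y' y \<longleftrightarrow> same_cut \<phi> Z y y'"
  using strict_mono_at_inj[OF assms] by (auto simp: same_cut_def)

lemma no_root_same_sign:
  fixes P :: "'a::real_closed_field poly"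
  assumes "\<And>c. min u v \<le> c \<Longrightarrow> c \<le> max u v \<Longrightarrow> poly P c \<noteq> 0"
  shows "same_sign (poly P u) (poly P v)"
proof -
  have *: "same_sign (poly P u) (poly P v)"
    if uv: "u < v" and r: "\<And>c. u \<le> c \<Longrightarrow> c \<le> v \<Longrightarrow> poly P c \<noteq> 0" for u v
  proof -
    have "\<not> poly P u * poly P v < 0" using rcf_IVT[OF uv, of P] r by force
    moreover have "poly P u \<noteq> 0" "poly P v \<noteq> 0" using r uv by auto
    ultimately show ?thesis by (auto simp: same_sign_def mult_less_0_iff not_less le_less)
  qed
  consider "u < v" | "v < u" | "u = v" by force
  then show ?thesis
  proof cases
    case 1
    then show ?thesis using *[of u v] assms by auto
  next
    case 2
    then show ?thesis using *[of v u] assms by (auto intro: same_sign_sym)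
  qed (auto simp: same_sign_def)
qed

lemma same_cut_le:
  "same_cut \<phi> Z y y' \<Longrightarrow> z \<in> Z \<Longrightarrow> (z \<le> y \<longleftrightarrow> \<phi> z \<le> y') \<and> (y \<le> z \<longleftrightarrow> y' \<le> \<phi> z)"
  unfolding same_cut_def by (metis not_le)

text \<open>Removing polynomials merges gaps. The sign at \<open>y'\<close> is reached through a
  point \<open>y2\<close> in the finer gap of \<open>y\<close>: both \<open>y2\<close> and
  \<open>y'\<close> lie in one coarse gap, so no root of the remaining \<open>Q\<close> separates
  them.\<close>

lemma matching_subset:
  fixes S :: "('a::real_closed_field poly \<times> 'b::real_closed_field poly) set"
  assumes fin: "finite S" and la: "leads_agree S" and m: "matching S \<phi>" and sub: "S0 \<subseteq> S"
  shows "matching S0 \<phi>"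
proof -
  define Z where "Z = zeros (fst ` S)"
  define Z0 where "Z0 = zeros (fst ` S0)"
  have ZZ: "Z0 \<subseteq> Z" unfolding Z_def Z0_def by (rule zeros_mono) (use sub in auto)
  have bij: "bij_betw \<phi> Z (zeros (snd ` S))" and mono: "strict_mono_at \<phi> Z"
    and sg: "\<And>y y' P Q. same_cut \<phi> Z y y' \<Longrightarrow> (P,Q) \<in> S \<Longrightarrow> same_sign (poly P y) (poly Q y')"
    using m unfolding matching_def Z_def by blast+
  have finZ: "finite Z" unfolding Z_def using fin by (intro finite_zeros) auto
  have mono0: "strict_mono_at \<phi> Z0" using mono ZZ by (auto simp: strict_mono_at_def)
  have root: "poly P z = 0 \<longleftrightarrow> poly Q (\<phi> z) = 0" if "z \<in> Z" "(P,Q) \<in> S" for z P Q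
    by (rule same_sign_0) (rule sg[OF same_cut_self[OF mono that(1)] that(2)])
  have im: "\<phi> ` Z0 = zeros (snd ` S0)"
  proof
    show "\<phi> ` Z0 \<subseteq> zeros (snd ` S0)"
    proof
      fix w assume "w \<in> \<phi> ` Z0"
      then obtain z P Q where z: "w = \<phi> z" "(P,Q) \<in> S0" "P \<noteq> 0" "poly P z = 0" "z \<in> Z0"
        by (force simp: Z0_def zeros_def)
      then have "poly Q w = 0" using root[of z P Q] sub ZZ by auto
      moreover have "Q \<noteq> 0" using leads_agree_0[OF la] z sub by blast
      ultimately show "w \<in> zeros (snd ` S0)" using z(2) by (force simp: zeros_def)
    qed
    show "zeros (snd ` S0) \<subseteq> \<phi> ` Z0"
    proof
      fix w assume "w \<in> zeros (snd ` S0)"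
      then obtain P Q where w: "(P,Q) \<in> S0" "Q \<noteq> 0" "poly Q w = 0" by (force simp: zeros_def)
      then have "w \<in> zeros (snd ` S)" using sub by (force simp: zeros_def)
      then obtain z where z: "z \<in> Z" "w = \<phi> z" using bij by (auto simp: bij_betw_def)
      have "poly P z = 0" using root[of z P Q] w z sub by auto
      moreover have "P \<noteq> 0" using leads_agree_0[OF la] w sub by blast
      ultimately have "z \<in> Z0" using w(1) by (force simp: Z0_def zeros_def)
      with z show "w \<in> \<phi> ` Z0" by blast
    qed
  qed
  have "same_sign (poly P y) (poly Q y')" if cut: "same_cut \<phi> Z0 y y'" and PQ: "(P,Q) \<in> S0" for y y' P Q
  proof (cases "y \<in> Z0")
    case True
    then have "y' = \<phi> y" using same_cut_in[OF cut] by simp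
    then show ?thesis using sg[OF same_cut_self[OF mono]] True ZZ PQ sub by blast
  next
    case False
    obtain y2 where y2: "same_cut \<phi> Z y y2" using same_cut_exists[OF finZ mono] by blast
    have 1: "same_sign (poly P y) (poly Q y2)" using sg[OF y2] PQ sub by blast
    have c2: "same_cut \<phi> Z0 y y2" using same_cut_mono[OF y2 ZZ] .
    have "same_sign (poly Q y2) (poly Q y')"
    proof (cases "Q = 0")
      case True
      then show ?thesis by (simp add: same_sign_def)
    next
      case Q0: False
      show ?thesis
      proof (rule no_root_same_sign)
        fix c assume c: "min y2 y' \<le> c" "c \<le> max y2 y'"
        have "same_cut \<phi> Z0 y (min y2 y')" "same_cut \<phi> Z0 y (max y2 y')"
          using c2 cut by (auto simp: min_def max_def)
        then have cc: "same_cut \<phi> Z0 y c" using c by (rule gap_convex)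
        show "poly Q c \<noteq> 0"
        proof
          assume "poly Q c = 0"
          then have "c \<in> \<phi> ` Z0" unfolding im using PQ Q0 by (force simp: zeros_def)
          then show False using same_cut_eq_iff[OF cc] False by auto
        qed
      qed
    qed
    with 1 show ?thesis by (rule same_sign_trans)
  qed
  then show ?thesis using im mono0 strict_mono_at_inj[OF mono0]
    unfolding matching_def bij_betw_def Z0_def by blast
qed

lemma same_cut_id_trans:
  "same_cut \<phi> Z y y' \<Longrightarrow> same_cut id Z y u \<Longrightarrow> same_cut \<phi> Z u y'"
  by (auto simp: same_cut_def)

lemma gap_root_order:
  fixes P :: "'a::real_closed_field poly"
  assumes "\<And>c. u < c \<Longrightarrow> c < v \<Longrightarrow> same_sign (poly (pderiv P) c) s" "u < v"
  shows "same_sign (poly P v - poly P u) s"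
proof -
  obtain c where "u < c" "c < v" "poly P v - poly P u = (v - u) * poly (pderiv P) c"
    using rcf_MVT[OF assms(2)] by blast
  then show ?thesis using assms(1)[of c] assms(2)
    by (auto simp: same_sign_def zero_less_mult_iff mult_less_0_iff)
qed

text \<open>As \<open>pderiv P\<close> belongs to \<open>S\<close>, the new \<open>P\<close> is
  strictly monotone on each gap and has at most one root there. Whether it has one depends only on
  signs at the ends of the gap and on leading coefficients, which agree for \<open>Q\<close>; so new
  roots correspond to new roots.\<close>

lemma matching_insert:
  fixes S :: "('a::real_closed_field poly \<times> 'b::real_closed_field poly) set"
  assumes fin: "finite S" and la: "leads_agree (insert (P,Q) S)" and m: "matching S \<phi>"
    and d: "(pderiv P, pderiv Q) \<in> S" and degP: "degree P > 0"
    and zs: "\<And>z. z \<in> zeros (fst ` S) \<Longrightarrow> same_sign (poly P z) (poly Q (\<phi> z))"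
  shows "\<exists>\<psi>. matching (insert (P,Q) S) \<psi>"
proof -
  define Z where "Z = zeros (fst ` S)"
  define Z' where "Z' = zeros (snd ` S)"
  have bij: "bij_betw \<phi> Z Z'" and mono: "strict_mono_at \<phi> Z"
    and sg: "\<And>y y' P Q. same_cut \<phi> Z y y' \<Longrightarrow> (P,Q) \<in> S \<Longrightarrow> same_sign (poly P y) (poly Q y')"
    using m unfolding matching_def Z_def Z'_def by blast+
  have im: "\<phi> ` Z = Z'" using bij by (simp add: bij_betw_def)
  have finZ: "finite Z" "finite Z'" unfolding Z_def Z'_def using fin by (intro finite_zeros; auto)+
  have deg: "degree P = degree Q" and lead: "same_sign (lead_coeff P) (lead_coeff Q)"
    using la by (auto simp: leads_agree_def)
  have P0: "P \<noteq> 0" "Q \<noteq> 0" using degP deg by auto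
  have dP0: "pderiv P \<noteq> 0" "pderiv Q \<noteq> 0" using degP deg by (auto simp: pderiv_eq_0_iff)
  have dZ: "poly (pderiv P) y \<noteq> 0" if "y \<notin> Z" for y
    using that d dP0 by (force simp: Z_def zeros_def)
  have dZ': "poly (pderiv Q) y \<noteq> 0" if "y \<notin> Z'" for y
    using that d dP0 by (force simp: Z'_def zeros_def)
  have notin: "y' \<notin> Z'" if "same_cut \<phi> Z y y'" "y \<notin> Z" for y y'
    using that same_cut_eq_iff[OF that(1)] im by blast
  have E: "\<exists>u. same_cut \<phi> Z y u \<and> same_sign (poly P y) (poly Q u)" if y: "y \<notin> Z" for y
  proof (rule gap_sign[OF finZ(1) mono deg lead])
    show "same_sign (poly P z) (poly Q (\<phi> z))" if "z \<in> Z" for z using zs that by (simp add: Z_def)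
    show "same_sign (poly (pderiv P) u) (poly (pderiv Q) u')"
      if "same_cut id Z y u" "same_cut \<phi> Z y u'" for u u'
      using sg[OF same_cut_id_trans[OF that(2,1)] d] .
  qed (use y dZ in auto)
  \<comment> \<open>\<open>E\<close> leads from roots of \<open>P\<close> to roots of
    \<open>Q\<close>. The converse is the same lemma with the two fields exchanged, along the
    inverse of \<phi>.\<close>
  define \<iota> where "\<iota> = inv_into Z \<phi>"
  have \<iota>mono: "strict_mono_at \<iota> Z'" using strict_mono_at_inv[OF mono] by (simp add: \<iota>_def im)
  have \<iota>cut: "same_cut \<iota> Z' y' y \<longleftrightarrow> same_cut \<phi> Z y y'" for y y'
    using same_cut_inv[OF mono] by (simp add: \<iota>_def im)
  have E': "\<exists>u. same_cut \<phi> Z u y \<and> same_sign (poly P u) (poly Q y)" if y: "y \<notin> Z'" for y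
  proof -
    have "\<exists>u. same_cut \<iota> Z' y u \<and> same_sign (poly Q y) (poly P u)"
    proof (rule gap_sign[OF finZ(2) \<iota>mono])
      show "degree Q = degree P" using deg by simp
      show "same_sign (lead_coeff Q) (lead_coeff P)" using lead by (rule same_sign_sym)
      show "same_sign (poly Q z) (poly P (\<iota> z))" if "z \<in> Z'" for z
      proof (rule same_sign_sym)
        have "\<iota> z \<in> Z" "\<phi> (\<iota> z) = z" using that im unfolding \<iota>_def
          by (metis inv_into_into, metis f_inv_into_f)
        then show "same_sign (poly P (\<iota> z)) (poly Q z)" using zs[of "\<iota> z"] by (simp add: Z_def)
      qed
      show "same_sign (poly (pderiv Q) u) (poly (pderiv P) u')"
        if "same_cut id Z' y u" "same_cut \<iota> Z' y u'" for u u'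
        using sg[OF _ d, of u' u] same_cut_id_trans[OF that(2,1)] by (auto simp: \<iota>cut intro: same_sign_sym)
    qed (use y dZ' in auto)
    then show ?thesis unfolding \<iota>cut by (blast intro: same_sign_sym)
  qed
  have ordP: "same_sign (poly P v - poly P u) (poly (pderiv Q) w)"
    if "same_cut \<phi> Z u w" "same_cut \<phi> Z v w" "u < v" for u v w
  proof (rule gap_root_order[OF _ that(3)])
    fix c assume c: "u < c" "c < v"
    have "same_cut \<phi> Z c w" using that c unfolding same_cut_def
      by (meson less_trans)
    then show "same_sign (poly (pderiv P) c) (poly (pderiv Q) w)" using sg d by blast
  qed
  have ordQ: "same_sign (poly Q v - poly Q u) (poly (pderiv P) w)"
    if "same_cut \<phi> Z w u" "same_cut \<phi> Z w v" "u < v" for u v w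
  proof (rule gap_root_order[OF _ that(3)])
    fix c assume c: "u < c" "c < v"
    have "same_cut \<phi> Z w c" using that c unfolding same_cut_def
      by (meson less_trans)
    then show "same_sign (poly (pderiv Q) c) (poly (pderiv P) w)" using sg d by (blast intro: same_sign_sym)
  qed
  have uniqQ: "u = v" if "same_cut \<phi> Z w u" "same_cut \<phi> Z w v" "w \<notin> Z" "poly Q u = poly Q v" for u v w
    using ordQ[of w u v] ordQ[of w v u] that dZ[of w] same_sign_0
    by (metis linorder_neqE_linordered_idom right_minus_eq)
  have uniqP: "u = v" if "same_cut \<phi> Z u w" "same_cut \<phi> Z v w" "w \<notin> Z'" "poly P u = poly P v" for u v w
    using ordP[of u w v] ordP[of v w u] that dZ'[of w] same_sign_0
    by (metis linorder_neqE_linordered_idom right_minus_eq)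
  \<comment> \<open>Outside \<open>Z\<close> the value matters only at roots of \<open>P\<close>;
    there \<open>uniqQ\<close> makes the chosen point the only root of \<open>Q\<close> in the
    gap.\<close>
  define \<psi> where "\<psi> = (\<lambda>z. if z \<in> Z then \<phi> z else SOME y'. same_cut \<phi> Z z y' \<and> poly Q y' = 0)"
  have \<psi>Z: "\<psi> z = \<phi> z" if "z \<in> Z" for z using that by (simp add: \<psi>_def)
  have \<psi>new: "same_cut \<phi> Z z (\<psi> z) \<and> poly Q (\<psi> z) = 0" if "z \<notin> Z" "poly P z = 0" for z
  proof -
    have "\<exists>y'. same_cut \<phi> Z z y' \<and> poly Q y' = 0" using E[OF that(1)] that(2) same_sign_0 by metis
    from someI_ex[OF this] show ?thesis using that by (simp add: \<psi>_def)
  qed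
  define W where "W = zeros (fst ` insert (P,Q) S)"
  have W: "W = Z \<union> {z. poly P z = 0}" using P0 by (auto simp: W_def Z_def zeros_def)
  have W': "zeros (snd ` insert (P,Q) S) = Z' \<union> {z. poly Q z = 0}" using P0 by (auto simp: Z'_def zeros_def)
  have \<psi>cut: "same_cut \<phi> Z z (\<psi> z)" if "z \<in> W" for z
  proof (cases "z \<in> Z")
    case True
    then show ?thesis using \<psi>Z same_cut_self[OF mono] by simp
  next
    case False
    then show ?thesis using \<psi>new that by (simp add: W)
  qed
  have \<psi>mono: "strict_mono_at \<psi> W"
    unfolding strict_mono_at_def
  proof (intro ballI impI)
    fix z w assume zw: "z \<in> W" "w \<in> W" "z < w"
    have cz: "same_cut \<phi> Z z (\<psi> z)" and cw: "same_cut \<phi> Z w (\<psi> w)" using \<psi>cut zw by auto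
    \<comment> \<open>Either a point of \<open>Z\<close> separates \<open>z\<close> and
      \<open>w\<close>, and its image separates their images, or both lie in one gap, where the
      monotone \<open>P\<close> cannot have two roots.\<close>
    show "\<psi> z < \<psi> w"
    proof (cases "\<exists>t\<in>Z. z \<le> t \<and> t \<le> w")
      case True
      then obtain t where t: "t \<in> Z" "z \<le> t" "t \<le> w" by blast
      have "\<psi> z \<le> \<phi> t" "\<phi> t \<le> \<psi> w"
        using same_cut_le[OF cz t(1)] same_cut_le[OF cw t(1)] t by auto
      moreover have "\<psi> z \<noteq> \<phi> t \<or> \<phi> t \<noteq> \<psi> w"
        using same_cut_eq_iff[OF cz t(1)] same_cut_eq_iff[OF cw t(1)] zw(3) by auto
      ultimately show ?thesis by auto
    next
      case False
      then have n: "z \<notin> Z" "w \<notin> Z" using zw(3) by auto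
      then have "poly P z = 0" "poly P w = 0" using zw by (auto simp: W)
      have "same_cut \<phi> Z w (\<psi> z)" unfolding same_cut_def
      proof
        fix t assume t: "t \<in> Z"
        have "\<not> (z \<le> t \<and> t \<le> w)" using False t by blast
        then have "t < z \<longleftrightarrow> t < w" "z < t \<longleftrightarrow> w < t" using zw(3) by auto
        then show "(t < w \<longleftrightarrow> \<phi> t < \<psi> z) \<and> (w < t \<longleftrightarrow> \<psi> z < \<phi> t)"
          using cz t by (auto simp: same_cut_def)
      qed
      from uniqP[OF cz this] show ?thesis
        using notin[OF cz n(1)] \<open>poly P z = 0\<close> \<open>poly P w = 0\<close> zw(3) by auto
    qed
  qed
  have \<psi>im: "\<psi> ` W = Z' \<union> {z. poly Q z = 0}"
  proof
    show "\<psi> ` W \<subseteq> Z' \<union> {z. poly Q z = 0}"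
    proof
      fix x assume "x \<in> \<psi> ` W"
      then obtain z where "x = \<psi> z" "z \<in> W" by blast
      then show "x \<in> Z' \<union> {z. poly Q z = 0}" using \<psi>new[of z] \<psi>Z[of z] im by (cases "z \<in> Z") (auto simp: W)
    qed
    show "Z' \<union> {z. poly Q z = 0} \<subseteq> \<psi> ` W"
    proof
      fix w assume w: "w \<in> Z' \<union> {z. poly Q z = 0}"
      show "w \<in> \<psi> ` W"
      proof (cases "w \<in> Z'")
        case True
        then obtain z where z: "z \<in> Z" "w = \<phi> z" using im by blast
        then have "w = \<psi> z" "z \<in> W" using \<psi>Z[OF z(1)] by (simp_all add: W)
        then show ?thesis by blast
      next
        case False
        then have Qw: "poly Q w = 0" using w by blast
        obtain u where u: "same_cut \<phi> Z u w" "same_sign (poly P u) (poly Q w)" using E'[OF False] by blast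
        have Pu: "poly P u = 0" using same_sign_0[OF u(2)] Qw by simp
        have uZ: "u \<notin> Z" using same_cut_in[OF u(1)] False im by blast
        have "\<psi> u = w" using uniqQ[OF _ u(1) uZ, of "\<psi> u"] \<psi>new[OF uZ Pu] Qw by auto
        then show ?thesis using Pu by (auto simp: W)
      qed
    qed
  qed
  have sgP: "same_sign (poly P y) (poly Q y')" if cut: "same_cut \<psi> W y y'" for y y'
  proof (cases "y \<in> W")
    case True
    then have y': "y' = \<psi> y" using same_cut_in[OF cut] by simp
    show ?thesis
    proof (cases "y \<in> Z")
      case True
      then show ?thesis using zs y' \<psi>Z by (simp add: Z_def)
    next
      case False
      then have "poly P y = 0" using True by (simp add: W)
      then show ?thesis using \<psi>new[OF False] y' by (simp add: same_sign_def)
    qed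
  next
    case False
    then have yZ: "y \<notin> Z" and Py: "poly P y \<noteq> 0" by (auto simp: W)
    have cutZ: "same_cut \<phi> Z y y'" using cut \<psi>Z unfolding same_cut_def W by (metis UnI1)
    \<comment> \<open>If the gap contains a root \<open>r\<close> of \<open>P\<close>, the sign at
      \<open>y\<close> is determined by the side of \<open>r\<close> and the sign of the derivative.
      Otherwise neither polynomial vanishes in the gap, and one sample point from \<open>E\<close>
      fixes the sign.\<close>
    show ?thesis
    proof (cases "\<exists>r. poly P r = 0 \<and> same_cut \<phi> Z r y'")
      case True
      then obtain r where r: "poly P r = 0" "same_cut \<phi> Z r y'" by blast
      have rZ: "r \<notin> Z" using same_cut_in[OF r(2)] notin[OF cutZ yZ] im by blast
      have rW: "r \<in> W" using r by (simp add: W)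
      have c: "same_cut \<phi> Z r (\<psi> r)" "poly Q (\<psi> r) = 0" using \<psi>new[OF rZ r(1)] by auto
      have sd: "same_sign (poly (pderiv P) r) (poly (pderiv Q) y')" using sg[OF r(2) d] .
      have yr: "(y < r \<longleftrightarrow> y' < \<psi> r) \<and> (r < y \<longleftrightarrow> \<psi> r < y')" using cut rW by (auto simp: same_cut_def)
      have "y \<noteq> r" using Py r by auto
      then consider "y < r" | "r < y" by force
      then show ?thesis
      proof cases
        case 1
        have "same_sign (- poly P y) (poly (pderiv Q) y')" using ordP[OF cutZ r(2) 1] r(1) by simp
        moreover have "same_sign (- poly Q y') (poly (pderiv P) r)" using ordQ[OF r(2) c(1)] yr 1 c(2) by simp
        ultimately have "same_sign (- poly P y) (- poly Q y')" using sd by (meson same_sign_sym same_sign_trans)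
        then show ?thesis by (simp add: same_sign_uminus)
      next
        case 2
        have "same_sign (poly P y) (poly (pderiv Q) y')" using ordP[OF r(2) cutZ 2] r(1) by simp
        moreover have "same_sign (poly Q y') (poly (pderiv P) r)" using ordQ[OF c(1) r(2)] yr 2 c(2) by simp
        ultimately show ?thesis using sd by (meson same_sign_sym same_sign_trans)
      qed
    next
      case no: False
      obtain u where u: "same_cut \<phi> Z y u" "same_sign (poly P y) (poly Q u)" using E[OF yZ] by blast
      have "same_sign (poly Q u) (poly Q y')"
      proof (rule no_root_same_sign)
        fix c assume c: "min u y' \<le> c" "c \<le> max u y'"
        have "same_cut \<phi> Z y (min u y')" "same_cut \<phi> Z y (max u y')"
          using u(1) cutZ by (auto simp: min_def max_def)
        then have cc: "same_cut \<phi> Z y c" using c by (rule gap_convex)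
        show "poly Q c \<noteq> 0"
        proof
          assume "poly Q c = 0"
          then obtain r where r: "same_cut \<phi> Z r c" "poly P r = 0"
            using E'[OF notin[OF cc yZ]] same_sign_0 by metis
          then have "same_cut \<phi> Z r y'" using cc cutZ by (auto simp: same_cut_def)
          then show False using no r by blast
        qed
      qed
      with u(2) show ?thesis by (rule same_sign_trans)
    qed
  qed
  have sgS: "same_sign (poly A y) (poly B y')" if "same_cut \<psi> W y y'" "(A,B) \<in> S" for y y' A B
  proof -
    have "same_cut \<phi> Z y y'" using that(1) \<psi>Z unfolding same_cut_def W by (metis UnI1)
    then show ?thesis using sg that(2) by blast
  qed
  have "matching (insert (P,Q) S) \<psi>"
    unfolding matching_def W_def[symmetric] W'
    using \<psi>mono \<psi>im strict_mono_at_inj[OF \<psi>mono] sgP sgS unfolding bij_betw_def by blast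
  then show ?thesis by blast
qed

section \<open>Elimination of one variable\<close>

text \<open>Models the specialisation of coefficients: later the ring is a polynomial ring, and a
  homomorphism into a field assigns values to the variables not yet eliminated.\<close>

definition unital_hom :: "('r::comm_ring_1 \<Rightarrow> 'a::comm_ring_1) \<Rightarrow> bool" where
  "unital_hom e \<longleftrightarrow> e 1 = 1 \<and> (\<forall>x y. e (x + y) = e x + e y) \<and> (\<forall>x y. e (x * y) = e x * e y)"

context
  fixes e :: "'r::comm_ring_1 \<Rightarrow> 'a::comm_ring_1"
  assumes e: "unital_hom e"
begin

lemma hom_1: "e 1 = 1" and hom_add: "e (x + y) = e x + e y" and hom_mult: "e (x * y) = e x * e y"
  using e by (auto simp: unital_hom_def)

lemma hom_0: "e 0 = 0"
  using hom_add[of 0 0] by simp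

lemma hom_uminus: "e (- x) = - e x"
  using hom_add[of x "- x"] hom_0 by (simp add: eq_neg_iff_add_eq_0 add.commute)

lemma hom_diff: "e (x - y) = e x - e y"
  using hom_add[of x "- y"] by (simp add: hom_uminus)

lemma hom_sum: "e (sum f A) = (\<Sum>i\<in>A. e (f i))"
  by (induction A rule: infinite_finite_induct) (auto simp: hom_0 hom_add)

lemma hom_power: "e (x ^ n) = e x ^ n"
  by (induction n) (auto simp: hom_1 hom_mult)

lemma hom_of_nat: "e (of_nat n) = of_nat n"
  by (induction n) (auto simp: hom_0 hom_1 hom_add)

lemma hom_coeff: "coeff (map_poly e p) n = e (coeff p n)"
  by (simp add: coeff_map_poly hom_0)

lemma hom_poly_add: "map_poly e (p + q) = map_poly e p + map_poly e q"
  by (rule poly_eqI) (simp add: hom_coeff hom_add)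

lemma hom_poly_mult: "map_poly e (p * q) = map_poly e p * map_poly e q"
  by (rule poly_eqI) (simp add: hom_coeff coeff_mult hom_sum hom_mult)

lemma hom_poly_smult: "map_poly e (smult c p) = smult (e c) (map_poly e p)"
  by (rule poly_eqI) (simp add: hom_coeff hom_mult)

lemma hom_poly_monom: "map_poly e (monom c n) = monom (e c) n"
  by (rule poly_eqI) (simp add: hom_coeff coeff_monom hom_0)

lemma hom_poly_diff: "map_poly e (p - q) = map_poly e p - map_poly e q"
  by (rule poly_eqI) (simp add: hom_coeff hom_diff)

end

text \<open>\<^const>\<open>pderiv\<close> is only available over rings without zero divisors.\<close>

definition formal_deriv :: "'r::comm_ring_1 poly \<Rightarrow> 'r poly" where
  "formal_deriv p = Poly (map (\<lambda>i. of_nat (Suc i) * coeff p (Suc i)) [0..<degree p])"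

lemma coeff_formal_deriv: "coeff (formal_deriv p) n = of_nat (Suc n) * coeff p (Suc n)"
  by (auto simp: formal_deriv_def coeff_Poly_eq nth_default_def coeff_eq_0)

lemma degree_formal_deriv_le: "degree (formal_deriv p) \<le> degree p - 1"
  by (rule degree_le) (auto simp: coeff_formal_deriv coeff_eq_0)

lemma hom_formal_deriv:
  fixes e :: "'r::comm_ring_1 \<Rightarrow> 'a::idom"
  shows "unital_hom e \<Longrightarrow> map_poly e (formal_deriv p) = pderiv (map_poly e p)"
  by (rule poly_eqI)
    (simp add: hom_coeff coeff_formal_deriv coeff_pderiv hom_mult hom_add hom_1 hom_of_nat)

text \<open>The degree shifted by one, so that zero ranks strictly below the nonzero constants;
  passing from a nonzero constant to its reductum, which is zero, is then a descent.\<close>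

definition poly_rank :: "'r::zero poly \<Rightarrow> nat" where
  "poly_rank p = (if p = 0 then 0 else Suc (degree p))"

definition reductum :: "'r::comm_ring_1 poly \<Rightarrow> 'r poly" where
  "reductum p = p - monom (lead_coeff p) (degree p)"

lemma poly_rank_reductum: "p \<noteq> 0 \<Longrightarrow> poly_rank (reductum p) < poly_rank p"
proof (cases "reductum p = 0")
  case False
  assume "p \<noteq> 0"
  have "degree (reductum p) \<le> degree p"
    unfolding reductum_def by (intro degree_diff_le degree_monom_le order_refl)
  moreover have "coeff (reductum p) (degree p) = 0" by (simp add: reductum_def)
  then have "degree (reductum p) \<noteq> degree p" using False by (metis leading_coeff_0_iff)
  ultimately show ?thesis using \<open>p \<noteq> 0\<close> False by (simp add: poly_rank_def)
qed (simp add: poly_rank_def)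

lemma hom_reductum:
  "unital_hom e \<Longrightarrow> e (lead_coeff p) = 0 \<Longrightarrow> map_poly e (reductum p) = map_poly e p"
  by (simp add: reductum_def hom_poly_diff hom_poly_monom)

definition pseudo_rem :: "'r::comm_ring_1 poly \<Rightarrow> 'r poly \<Rightarrow> 'r poly" where
  "pseudo_rem p f = snd (pseudo_divmod p f)"

text \<open>At a root of \<open>f\<close> the sign of \<open>p\<close> can be read off from the
  remainder, up to a power of the leading coefficient of \<open>f\<close>, whose sign is among the
  data.\<close>

lemma pseudo_rem:
  assumes "f \<noteq> 0"
  shows "\<exists>k q. smult (lead_coeff f ^ k) p = f * q + pseudo_rem p f"
    and "poly_rank (pseudo_rem p f) < poly_rank f"
proof -
  obtain q r where "pseudo_divmod p f = (q, r)" by (metis surj_pair)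
  from pseudo_divmod[OF assms this] this assms
  show "\<exists>k q. smult (lead_coeff f ^ k) p = f * q + pseudo_rem p f"
    and "poly_rank (pseudo_rem p f) < poly_rank f"
    by (auto simp: pseudo_rem_def poly_rank_def)
qed

text \<open>Termination measure of the elimination: a step trades one polynomial for finitely many
  of smaller rank, which descends in the multiset order even when the family grows.\<close>

definition rank_mset :: "'r::zero poly set \<Rightarrow> nat multiset" where
  "rank_mset G = image_mset poly_rank (mset_set G)"

lemma rank_mset_less:
  assumes "finite G" "p \<in> G" "finite K" "\<And>k. k \<in> K \<Longrightarrow> poly_rank k < poly_rank p"
  shows "rank_mset ((G - {p}) \<union> K) < rank_mset G"
proof -
  have "(G - {p}) \<union> K = (G - {p}) \<union> (K - (G - {p}))" by blast
  then have 1: "mset_set ((G - {p}) \<union> K) = mset_set (G - {p}) + mset_set (K - (G - {p}))"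
    using assms by (metis Diff_disjoint finite_Diff mset_set_Union)
  have 2: "mset_set G = mset_set (G - {p}) + {#p#}"
    using assms by (simp add: mset_set.remove)
  show ?thesis
    unfolding rank_mset_def 1 2 image_mset_union less_multiset_def
    by (rule one_step_implies_multp) (use assms in auto)
qed

definition hom_pairs :: "('r::zero \<Rightarrow> 'a::zero) \<Rightarrow> ('r \<Rightarrow> 'b::zero) \<Rightarrow> 'r poly set \<Rightarrow> ('a poly \<times> 'b poly) set" where
  "hom_pairs e1 e2 G = (\<lambda>p. (map_poly e1 p, map_poly e2 p)) ` G"

definition signs_agree :: "('r \<Rightarrow> 'a::linordered_idom) \<Rightarrow> ('r \<Rightarrow> 'b::linordered_idom) \<Rightarrow> 'r set \<Rightarrow> bool" where
  "signs_agree e1 e2 F \<longleftrightarrow> (\<forall>c\<in>F. same_sign (e1 c) (e2 c))"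

definition coeff_set :: "'r::zero poly set \<Rightarrow> 'r set" where
  "coeff_set G = (\<Union>p\<in>G. set (coeffs p))"

lemma degree_eq_if_coeffs_vanish_alike:
  assumes "\<And>n. coeff P n = 0 \<longleftrightarrow> coeff Q n = 0"
  shows "degree P = degree Q"
proof (rule antisym)
  show "degree P \<le> degree Q" by (rule degree_le) (use assms coeff_eq_0 in blast)
  show "degree Q \<le> degree P" by (rule degree_le) (use assms coeff_eq_0 in blast)
qed

lemma leads_agree_pairs:
  assumes e: "unital_hom e1" "unital_hom e2" and s: "signs_agree e1 e2 (coeff_set G)"
  shows "leads_agree (hom_pairs e1 e2 G)"
  unfolding leads_agree_def hom_pairs_def
proof clarsimp
  fix p assume p: "p \<in> G"
  have c: "same_sign (coeff (map_poly e1 p) n) (coeff (map_poly e2 p) n)" for n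
  proof (cases "n \<le> degree p \<and> p \<noteq> 0")
    case True
    then have "coeff p n \<in> coeff_set G" using p coeff_in_coeffs by (auto simp: coeff_set_def)
    then show ?thesis using s e by (simp add: hom_coeff signs_agree_def)
  next
    case False
    then have "coeff p n = 0" using coeff_eq_0 by (metis coeff_0 not_le)
    then show ?thesis using e by (simp add: hom_coeff hom_0 same_sign_def)
  qed
  have "degree (map_poly e1 p) = degree (map_poly e2 p)"
    by (rule degree_eq_if_coeffs_vanish_alike) (rule same_sign_0[OF c])
  then show "degree (map_poly e1 p) = degree (map_poly e2 p) \<and>
     same_sign (lead_coeff (map_poly e1 p)) (lead_coeff (map_poly e2 p))"
    using c[of "degree (map_poly e1 p)"] by simp
qed

lemma leads_agree_subset: "leads_agree S \<Longrightarrow> T \<subseteq> S \<Longrightarrow> leads_agree T"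
  unfolding leads_agree_def by blast

lemma zeros_pairs_iff:
  "z \<in> zeros (fst ` hom_pairs e1 e2 G) \<longleftrightarrow> (\<exists>f\<in>G. map_poly e1 f \<noteq> 0 \<and> poly (map_poly e1 f) z = 0)"
  by (auto simp: zeros_def hom_pairs_def)

text \<open>The finite set \<open>F\<close> is fixed before the two homomorphisms and plays the role
  of the quantifier-free condition. Which families arise in the recursion depends on the leading
  coefficients that specialise to zero, so \<open>F\<close> collects the conditions of all branches,
  including the coefficients on which the branching is decided.\<close>

theorem matching_exists:
  fixes G :: "'r::comm_ring_1 poly set"
  assumes "finite G"
  shows "\<exists>F. finite F \<and> (\<forall>(e1 :: 'r \<Rightarrow> 'a::real_closed_field) (e2 :: 'r \<Rightarrow> 'b::real_closed_field).
     unital_hom e1 \<longrightarrow> unital_hom e2 \<longrightarrow> signs_agree e1 e2 F \<longrightarrow> (\<exists>\<phi>. matching (hom_pairs e1 e2 G) \<phi>))"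
    (is "\<exists>F. ?good G F")
  using assms
proof (induction G rule: measure_induct_rule[where f = rank_mset])
  case (less G)
  note fin = \<open>finite G\<close>
  have finC: "finite (coeff_set A)" if "finite A" for A :: "'r poly set"
    using that by (simp add: coeff_set_def)
  show ?case
  proof (cases "\<forall>f\<in>G. degree f = 0")
    case True
    have "?good G (coeff_set G)"
    proof (intro conjI allI impI)
      fix e1 :: "'r \<Rightarrow> 'a" and e2 :: "'r \<Rightarrow> 'b"
      assume e: "unital_hom e1" "unital_hom e2" and s: "signs_agree e1 e2 (coeff_set G)"
      have const: "\<exists>c d. map_poly e1 f = [:c:] \<and> map_poly e2 f = [:d:] \<and> same_sign c d" if f: "f \<in> G" for f
      proof -
        have la: "(map_poly e1 f, map_poly e2 f) \<in> hom_pairs e1 e2 G" using f by (auto simp: hom_pairs_def)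
        have d: "degree (map_poly e1 f) = 0" "degree (map_poly e2 f) = 0"
          using True f by (metis le_zero_eq map_poly_degree_leq)+
        then show ?thesis using leads_agree_pairs[OF e s] la unfolding leads_agree_def
          by (metis (no_types, lifting) case_prodD degree_eq_zeroE lead_coeff_pCons(2))
      qed
      have "zeros (fst ` hom_pairs e1 e2 G) = {}" "zeros (snd ` hom_pairs e1 e2 G) = {}"
        using const by (force simp: zeros_def hom_pairs_def)+
      moreover have "same_sign (poly P y) (poly Q y')" if "(P,Q) \<in> hom_pairs e1 e2 G" for P Q y y'
        using that const by (fastforce simp: hom_pairs_def)
      ultimately have "matching (hom_pairs e1 e2 G) (\<lambda>_. 0)"
        unfolding matching_def by (simp add: strict_mono_at_def bij_betw_def split_beta)
      then show "\<exists>\<phi>. matching (hom_pairs e1 e2 G) \<phi>" by blast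
    qed (use finC fin in auto)
    then show ?thesis by blast
  next
    case False
    then obtain f0 where f0: "f0 \<in> G" "degree f0 > 0" by blast
    define N where "N = Max (degree ` G)"
    have "N \<in> degree ` G" unfolding N_def using fin f0 by (intro Max_in) auto
    then obtain p where p: "p \<in> G" "degree p = N" by blast
    have Nmax: "degree f \<le> N" if "f \<in> G" for f unfolding N_def using fin that by (intro Max_ge) auto
    have N0: "N > 0" using f0 Nmax by force
    have p0: "p \<noteq> 0" using p N0 by auto
    \<comment> \<open>\<open>p\<close> has maximal degree \<open>N\<close>. It is traded for its
      derivative, which gives monotonicity, and for its remainders modulo the other members and the
      derivative, which give its signs at their roots. Maximality of \<open>N\<close> keeps all
      remainders below \<open>p\<close> in rank.\<close>
    define G0 where "G0 = insert (formal_deriv p) (G - {p})"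
    define R where "R = pseudo_rem p ` (G0 - {0})"
    define H where "H = G0 \<union> R"
    have finG0: "finite G0" using fin by (simp add: G0_def)
    have finR: "finite R" using finG0 by (simp add: R_def)
    have rp: "poly_rank p = Suc N" using p p0 by (simp add: poly_rank_def)
    have dp: "degree (formal_deriv p) \<le> N - 1" using p degree_formal_deriv_le[of p] by simp
    have dG0: "degree f \<le> N" if "f \<in> G0" for f
      using that Nmax dp by (auto simp: G0_def)
    have rR: "poly_rank r < poly_rank p" if r: "r \<in> R" for r
    proof -
      obtain f where f: "f \<in> G0" "f \<noteq> 0" "r = pseudo_rem p f" using r unfolding R_def by blast
      have "poly_rank r < poly_rank f" using pseudo_rem(2)[OF f(2)] f(3) by simp
      also have "poly_rank f \<le> poly_rank p" using dG0[OF f(1)] rp f(2) by (simp add: poly_rank_def)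
      finally show ?thesis .
    qed
    have "poly_rank (formal_deriv p) < poly_rank p" using dp N0 rp by (auto simp: poly_rank_def)
    then have Hless: "rank_mset H < rank_mset G"
      using rank_mset_less[OF fin p(1), of "insert (formal_deriv p) R"] finR rR
      by (auto simp: H_def G0_def)
    have finH: "finite H" using finG0 finR by (simp add: H_def)
    obtain FH where FH: "?good H FH" using less.IH[OF Hless finH] by blast
    \<comment> \<open>The second kind of recursive call: when the leading coefficient of
      \<open>f\<close> is sent to zero, \<open>f\<close> has the same image as its reductum, and the
      family with \<open>f\<close> truncated is smaller.\<close>
    have "\<exists>F. ?good ((G - {f}) \<union> {reductum f}) F" if "f \<in> G - {0}" for f
    proof (rule less.IH)
      show "rank_mset ((G - {f}) \<union> {reductum f}) < rank_mset G"
        by (rule rank_mset_less) (use that fin poly_rank_reductum in auto)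
    qed (use fin in auto)
    then obtain FT where FT: "\<And>f. f \<in> G - {0} \<Longrightarrow> ?good ((G - {f}) \<union> {reductum f}) (FT f)" by metis
    define F where "F = coeff_set (insert p H) \<union> coeff_set G \<union> FH \<union> (\<Union>f\<in>G - {0}. FT f)"
    have "?good G F"
    proof (intro conjI allI impI)
      show "finite F" using finC fin finH FH FT by (auto simp: F_def)
    next
      fix e1 :: "'r \<Rightarrow> 'a" and e2 :: "'r \<Rightarrow> 'b"
      assume e: "unital_hom e1" "unital_hom e2" and s: "signs_agree e1 e2 F"
      have sub: "signs_agree e1 e2 F'" if "F' \<subseteq> F" for F' using s that by (auto simp: signs_agree_def)
      have sl: "same_sign (e1 (lead_coeff f)) (e2 (lead_coeff f))" if "f \<in> G \<union> H" for f
      proof (cases "f = 0")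
        case True
        then show ?thesis using e by (simp add: hom_0 same_sign_def)
      next
        case False
        then have "lead_coeff f \<in> F" using that coeff_in_coeffs[of f "degree f"]
          by (auto simp: F_def coeff_set_def)
        then show ?thesis using s by (simp add: signs_agree_def)
      qed
      show "\<exists>\<phi>. matching (hom_pairs e1 e2 G) \<phi>"
      proof (cases "\<exists>f\<in>G - {0}. e1 (lead_coeff f) = 0")
        case True
        then obtain f where f: "f \<in> G - {0}" "e1 (lead_coeff f) = 0" by blast
        have f2: "e2 (lead_coeff f) = 0" using sl[of f] f same_sign_0 by blast
        have "\<exists>\<phi>. matching (hom_pairs e1 e2 ((G - {f}) \<union> {reductum f})) \<phi>"
          using FT[OF f(1)] e sub[of "FT f"] f(1) by (auto simp: F_def)
        moreover have "hom_pairs e1 e2 ((G - {f}) \<union> {reductum f}) = hom_pairs e1 e2 G"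
          using f f2 e by (auto simp: hom_pairs_def hom_reductum insert_absorb image_iff)
        ultimately show ?thesis by simp
      next
        case lnz: False
        \<comment> \<open>An ordered field has characteristic zero, so \<open>N\<close> times the
          leading coefficient of \<open>p\<close> stays nonzero and the derivative keeps its degree
          \<open>N - 1\<close> under \<open>e1\<close>.\<close>
        have lc: "lead_coeff (formal_deriv p) = of_nat N * lead_coeff p \<and> e1 (lead_coeff (formal_deriv p)) \<noteq> 0"
        proof -
          have c: "coeff (formal_deriv p) (N - 1) = of_nat N * lead_coeff p"
            using N0 p(2) by (cases N) (auto simp: coeff_formal_deriv)
          have "e1 (coeff (formal_deriv p) (N - 1)) \<noteq> 0"
            unfolding c using e lnz p p0 N0 by (auto simp: hom_mult hom_of_nat)
          moreover from this have "coeff (formal_deriv p) (N - 1) \<noteq> 0" using e by (auto simp: hom_0)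
          then have "degree (formal_deriv p) = N - 1" using dp le_degree by fastforce
          ultimately show ?thesis using c by simp
        qed
        have lnz0: "e1 (lead_coeff f) \<noteq> 0" if "f \<in> G0 - {0}" for f
          using that lc lnz by (auto simp: G0_def)
        have "\<exists>\<phi>. matching (hom_pairs e1 e2 H) \<phi>"
          using FH e sub[of FH] by (auto simp: F_def)
        then obtain \<phi> where mH: "matching (hom_pairs e1 e2 H) \<phi>" by blast
        have laH: "leads_agree (hom_pairs e1 e2 (insert p H))"
          by (rule leads_agree_pairs[OF e sub]) (auto simp: F_def)
        then have laH': "leads_agree (hom_pairs e1 e2 H)"
          by (rule leads_agree_subset) (auto simp: hom_pairs_def)
        have fpH: "finite (hom_pairs e1 e2 H)" "finite (hom_pairs e1 e2 G0)"
          using finH finG0 by (auto simp: hom_pairs_def)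
        have m0: "matching (hom_pairs e1 e2 G0) \<phi>"
          by (rule matching_subset[OF fpH(1) laH' mH]) (auto simp: hom_pairs_def H_def)
        have "\<exists>\<psi>. matching (insert (map_poly e1 p, map_poly e2 p) (hom_pairs e1 e2 G0)) \<psi>"
        proof (rule matching_insert[OF fpH(2) _ m0])
          show "leads_agree (insert (map_poly e1 p, map_poly e2 p) (hom_pairs e1 e2 G0))"
            by (rule leads_agree_subset[OF laH]) (auto simp: hom_pairs_def H_def)
          show "(pderiv (map_poly e1 p), pderiv (map_poly e2 p)) \<in> hom_pairs e1 e2 G0"
            using e by (auto simp: hom_pairs_def G0_def hom_formal_deriv)
          have "e1 (lead_coeff p) \<noteq> 0" using lnz p p0 by blast
          then show "degree (map_poly e1 p) > 0" using N0 p(2) by (simp add: map_poly_degree_eq)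
        next
          fix z assume "z \<in> zeros (fst ` hom_pairs e1 e2 G0)"
          then obtain f where f: "f \<in> G0" "map_poly e1 f \<noteq> 0" "poly (map_poly e1 f) z = 0"
            by (auto simp: zeros_pairs_iff)
          have f0: "f \<noteq> 0" using f(2) by auto
          have zH: "z \<in> zeros (fst ` hom_pairs e1 e2 H)" using f by (auto simp: zeros_pairs_iff H_def)
          have sg: "same_sign (poly (map_poly e1 q) z) (poly (map_poly e2 q) (\<phi> z))" if "q \<in> H" for q
          proof -
            have "same_cut \<phi> (zeros (fst ` hom_pairs e1 e2 H)) z (\<phi> z)"
              using mH zH by (intro same_cut_self) (auto simp: matching_def)
            then show ?thesis using mH that unfolding matching_def hom_pairs_def by blast
          qed
          have f2: "poly (map_poly e2 f) (\<phi> z) = 0"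
            using sg[of f] f same_sign_0 by (auto simp: H_def)
          \<comment> \<open>At the root \<open>z\<close> of \<open>f\<close> the multiple of
            \<open>f\<close> drops out of the division identity. Thus \<open>p\<close> and its
            remainder agree up to the nonzero factor coming from \<open>lead_coeff f ^ k\<close>,
            and the remainder belongs to \<open>H\<close>, where signs are already matched.\<close>
          obtain k q where kq: "smult (lead_coeff f ^ k) p = f * q + pseudo_rem p f"
            using pseudo_rem(1)[OF f0] by blast
          have ev: "e (lead_coeff f) ^ k * poly (map_poly e p) x =
             poly (map_poly e f) x * poly (map_poly e q) x + poly (map_poly e (pseudo_rem p f)) x"
            if "unital_hom e" for e :: "'r \<Rightarrow> 'c::comm_ring_1" and x
            using arg_cong[OF kq, of "\<lambda>p. poly (map_poly e p) x"] that
            by (simp add: hom_poly_smult hom_poly_mult hom_poly_add hom_power)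
          have 1: "e1 (lead_coeff f) ^ k * poly (map_poly e1 p) z = poly (map_poly e1 (pseudo_rem p f)) z"
            using ev[OF e(1), of z] f by simp
          have 2: "e2 (lead_coeff f) ^ k * poly (map_poly e2 p) (\<phi> z) = poly (map_poly e2 (pseudo_rem p f)) (\<phi> z)"
            using ev[OF e(2), of "\<phi> z"] f2 by simp
          show "same_sign (poly (map_poly e1 p) z) (poly (map_poly e2 p) (\<phi> z))"
          proof (rule same_sign_mult_cancel)
            show "same_sign (e1 (lead_coeff f) ^ k) (e2 (lead_coeff f) ^ k)"
              using sl[of f] f(1) by (intro same_sign_power) (auto simp: H_def)
            show "e1 (lead_coeff f) ^ k \<noteq> 0" using lnz0 f f0 by auto
            show "same_sign (e1 (lead_coeff f) ^ k * poly (map_poly e1 p) z)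
                    (e2 (lead_coeff f) ^ k * poly (map_poly e2 p) (\<phi> z))"
              unfolding 1 2 by (rule sg) (use f f0 in \<open>auto simp: H_def R_def\<close>)
          qed
        qed
        then obtain \<psi> where m1: "matching (insert (map_poly e1 p, map_poly e2 p) (hom_pairs e1 e2 G0)) \<psi>" by blast
        \<comment> \<open>The derivative was auxiliary; removing it leaves the original
          family.\<close>
        have "matching (hom_pairs e1 e2 G) \<psi>"
        proof (rule matching_subset[OF _ _ m1])
          show "finite (insert (map_poly e1 p, map_poly e2 p) (hom_pairs e1 e2 G0))" using fpH by simp
          show "leads_agree (insert (map_poly e1 p, map_poly e2 p) (hom_pairs e1 e2 G0))"
            by (rule leads_agree_subset[OF laH]) (auto simp: hom_pairs_def H_def)
          show "hom_pairs e1 e2 G \<subseteq> insert (map_poly e1 p, map_poly e2 p) (hom_pairs e1 e2 G0)"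
            by (auto simp: hom_pairs_def G0_def)
        qed
        then show ?thesis by blast
      qed
    qed
    then show ?thesis by blast
  qed
qed

corollary real_closed_transfer_step:
  fixes G :: "'r::comm_ring_1 poly set"
  assumes "finite G"
  shows "\<exists>F. finite F \<and> (\<forall>(e1 :: 'r \<Rightarrow> 'a::real_closed_field) (e2 :: 'r \<Rightarrow> 'b::real_closed_field).
     unital_hom e1 \<longrightarrow> unital_hom e2 \<longrightarrow> signs_agree e1 e2 F \<longrightarrow>
       (\<forall>y. \<exists>y'. \<forall>p\<in>G. same_sign (poly (map_poly e1 p) y) (poly (map_poly e2 p) y')))"
proof -
  obtain F where F: "finite F" "\<And>(e1 :: 'r \<Rightarrow> 'a) (e2 :: 'r \<Rightarrow> 'b).
     unital_hom e1 \<Longrightarrow> unital_hom e2 \<Longrightarrow> signs_agree e1 e2 F \<Longrightarrow> (\<exists>\<phi>. matching (hom_pairs e1 e2 G) \<phi>)"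
    using matching_exists[OF assms] by metis
  have "\<exists>y'. \<forall>p\<in>G. same_sign (poly (map_poly e1 p) y) (poly (map_poly e2 p) y')"
    if e: "unital_hom e1" "unital_hom e2" "signs_agree e1 e2 F"
    for e1 :: "'r \<Rightarrow> 'a" and e2 :: "'r \<Rightarrow> 'b" and y
  proof -
    obtain \<phi> where m: "matching (hom_pairs e1 e2 G) \<phi>" using F(2)[OF e] by blast
    define Z where "Z = zeros (fst ` hom_pairs e1 e2 G)"
    have "finite Z" unfolding Z_def hom_pairs_def using assms by (intro finite_zeros) auto
    moreover have "strict_mono_at \<phi> Z" using m by (auto simp: matching_def Z_def)
    ultimately obtain y' where "same_cut \<phi> Z y y'" using same_cut_exists by blast
    then have "\<forall>p\<in>G. same_sign (poly (map_poly e1 p) y) (poly (map_poly e2 p) y')"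
      using m unfolding matching_def Z_def hom_pairs_def by blast
    then show ?thesis by blast
  qed
  then show ?thesis using F(1) by blast
qed

section \<open>Real closure of an ordered field\<close>

definition cone_span :: "'k::field set \<Rightarrow> 'k set" where
  "cone_span T = {a - b | a b. a \<in> T \<and> b \<in> T}"

text \<open>A preordering together with the subfield \<open>T - T\<close> that it orders, encoded by
  one set. Enlarging \<open>T\<close> may decide more signs or enlarge the field, so a single
  application of Zorn's lemma handles both.\<close>

definition field_cone :: "'k::field set \<Rightarrow> bool" where
  "field_cone T \<longleftrightarrow> 0 \<in> T \<and> 1 \<in> T \<and> (\<forall>x\<in>T. \<forall>y\<in>T. x + y \<in> T) \<and> (\<forall>x\<in>T. \<forall>y\<in>T. x * y \<in> T) \<and>
     (\<forall>x\<in>T. - x \<in> T \<longrightarrow> x = 0) \<and> (\<forall>x\<in>cone_span T. inverse x \<in> cone_span T) \<and>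
     (\<forall>x\<in>cone_span T. x * x \<in> T)"

lemma cone_spanI: "a \<in> T \<Longrightarrow> b \<in> T \<Longrightarrow> a - b \<in> cone_span T"
  by (auto simp: cone_span_def)

context
  fixes T :: "'k::field set"
  assumes T: "field_cone T"
begin

lemma fc_0: "0 \<in> T" and fc_1: "1 \<in> T"
  and fc_add: "x \<in> T \<Longrightarrow> y \<in> T \<Longrightarrow> x + y \<in> T"
  and fc_mult: "x \<in> T \<Longrightarrow> y \<in> T \<Longrightarrow> x * y \<in> T"
  and fc_antisym: "x \<in> T \<Longrightarrow> - x \<in> T \<Longrightarrow> x = 0"
  and fc_span_inverse: "x \<in> cone_span T \<Longrightarrow> inverse x \<in> cone_span T"
  and fc_square: "x \<in> cone_span T \<Longrightarrow> x * x \<in> T"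
  using T by (simp_all add: field_cone_def)

lemma fc_subset_span: "T \<subseteq> cone_span T"
  using cone_spanI[OF _ fc_0] by auto

lemma fc_span_add: "x \<in> cone_span T \<Longrightarrow> y \<in> cone_span T \<Longrightarrow> x + y \<in> cone_span T"
proof -
  assume "x \<in> cone_span T" "y \<in> cone_span T"
  then obtain a b c d where *: "x = a - b" "y = c - d" "a \<in> T" "b \<in> T" "c \<in> T" "d \<in> T"
    by (auto simp: cone_span_def)
  have "x + y = (a + c) - (b + d)" using * by simp
  then show ?thesis using * cone_spanI fc_add by metis
qed

lemma fc_span_uminus: "x \<in> cone_span T \<Longrightarrow> - x \<in> cone_span T"
proof -
  assume "x \<in> cone_span T"
  then obtain a b where *: "x = a - b" "a \<in> T" "b \<in> T"
    by (auto simp: cone_span_def)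
  then have "- x = b - a" by simp
  then show ?thesis using * cone_spanI by metis
qed

lemma fc_span_mult: "x \<in> cone_span T \<Longrightarrow> y \<in> cone_span T \<Longrightarrow> x * y \<in> cone_span T"
proof -
  assume "x \<in> cone_span T" "y \<in> cone_span T"
  then obtain a b c d where *: "x = a - b" "y = c - d" "a \<in> T" "b \<in> T" "c \<in> T" "d \<in> T"
    by (auto simp: cone_span_def)
  have "x * y = (a * c + b * d) - (a * d + b * c)" unfolding *(1,2) by (simp add: algebra_simps)
  then show ?thesis using * cone_spanI fc_add fc_mult by metis
qed

lemma fc_inverse: "x \<in> T \<Longrightarrow> inverse x \<in> T"
proof (cases "x = 0")
  case False
  assume "x \<in> T"
  then have "inverse x * inverse x \<in> T" using fc_subset_span fc_span_inverse fc_square by blast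
  then have "x * (inverse x * inverse x) \<in> T" by (rule fc_mult[OF \<open>x \<in> T\<close>])
  moreover have "x * (inverse x * inverse x) = inverse x" using False by simp
  ultimately show ?thesis by simp
qed simp

text \<open>If \<open>y\<close> and \<open>- y\<close> both have the form \<open>a + x * b\<close>,
  adding the two representations writes \<open>- x\<close> as a quotient of elements of
  \<open>T\<close>, unless both coefficients of \<open>x\<close> vanish. The spanned field stays the
  same.\<close>

lemma fc_adjoin:
  assumes x: "x \<in> cone_span T" "- x \<notin> T"
  shows "field_cone {a + x * b | a b. a \<in> T \<and> b \<in> T}" (is "field_cone ?T")
proof -
  have sub: "T \<subseteq> ?T" using fc_0 by force
  have TI: "y \<in> ?T" if "y = a + x * b" "a \<in> T" "b \<in> T" for y a b using that by blast
  have xx: "x * x \<in> T" by (rule fc_square[OF x(1)])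
  have sub2: "?T \<subseteq> cone_span T"
    using x fc_subset_span by (auto intro!: fc_span_add fc_span_mult)
  have span: "cone_span ?T = cone_span T"
  proof
    show "cone_span ?T \<subseteq> cone_span T"
    proof
      fix y assume "y \<in> cone_span ?T"
      then obtain a b where "y = a + - b" "a \<in> ?T" "b \<in> ?T" unfolding cone_span_def by auto
      then show "y \<in> cone_span T" using sub2 fc_span_add fc_span_uminus by blast
    qed
    show "cone_span T \<subseteq> cone_span ?T" using sub unfolding cone_span_def by blast
  qed
  show ?thesis unfolding field_cone_def span
  proof (intro conjI ballI impI)
    show "0 \<in> ?T" "1 \<in> ?T" by (rule subsetD[OF sub fc_0], rule subsetD[OF sub fc_1])
    show "y + z \<in> ?T" if yz: "y \<in> ?T" "z \<in> ?T" for y z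
    proof -
      obtain a b c d where *: "y = a + x * b" "z = c + x * d" "a \<in> T" "b \<in> T" "c \<in> T" "d \<in> T"
        using yz by blast
      have "y + z = (a + c) + x * (b + d)" unfolding *(1,2) by (simp add: algebra_simps)
      then show ?thesis by (rule TI) (use * in \<open>auto intro: fc_add\<close>)
    qed
    show "y * z \<in> ?T" if yz: "y \<in> ?T" "z \<in> ?T" for y z
    proof -
      obtain a b c d where *: "y = a + x * b" "z = c + x * d" "a \<in> T" "b \<in> T" "c \<in> T" "d \<in> T"
        using yz by blast
      have "y * z = (a * c + (x * x) * (b * d)) + x * (a * d + b * c)" unfolding *(1,2) by (simp add: algebra_simps)
      then show ?thesis by (rule TI) (use * xx in \<open>auto intro!: fc_add intro: fc_mult\<close>)
    qed
    show "y = 0" if yz: "y \<in> ?T" "- y \<in> ?T" for y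
    proof -
      obtain a b c d where *: "y = a + x * b" "- y = c + x * d" "a \<in> T" "b \<in> T" "c \<in> T" "d \<in> T"
        using yz by blast
      have "y + - y = (a + c) + x * (b + d)" unfolding *(2) by (subst *(1)) (simp add: algebra_simps)
      then have s: "(a + c) + x * (b + d) = 0" by simp
      show ?thesis
      proof (cases "b + d = 0")
        case True
        then have "- b = d" "- a = c" using s by (auto simp: eq_neg_iff_add_eq_0 neg_eq_iff_add_eq_0)
        then have "a = 0" "b = 0" using * fc_antisym by auto
        then show ?thesis using * by simp
      next
        case False
        have "x * (b + d) = - (a + c)" using s by (simp only: add_eq_0_iff)
        then have "(- x) * (b + d) = a + c" by (simp only: mult_minus_left minus_minus)
        then have "- x = (a + c) * inverse (b + d)" using False by (metis divide_inverse eq_divide_imp)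
        moreover have "(a + c) * inverse (b + d) \<in> T" using * by (intro fc_mult fc_add fc_inverse)
        ultimately show ?thesis using x by simp
      qed
    qed
  next
    fix y assume y: "y \<in> cone_span T"
    show "inverse y \<in> cone_span T" by (rule fc_span_inverse[OF y])
    show "y * y \<in> ?T" using sub fc_square[OF y] by (rule subsetD)
  qed
qed

end

lemma field_cone_base:
  "field_cone (to_ac ` {x :: 'a::linordered_field. 0 \<le> x})" (is "field_cone ?T")
  and cone_span_base: "cone_span (to_ac ` {x :: 'a::linordered_field. 0 \<le> x}) = range to_ac"
proof -
  show span: "cone_span ?T = range to_ac"
  proof
    show "cone_span ?T \<subseteq> range to_ac" by (auto simp: cone_span_def simp flip: to_ac_diff)
    show "range to_ac \<subseteq> cone_span ?T"
    proof
      fix y assume "y \<in> range (to_ac :: 'a \<Rightarrow> _)"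
      then obtain x :: 'a where x: "y = to_ac x" by blast
      have "y = to_ac (max x 0) - to_ac (max (- x) 0)"
        unfolding x to_ac_diff[symmetric] by (simp add: max_def)
      then show "y \<in> cone_span ?T" by (auto intro!: cone_spanI)
    qed
  qed
  show "field_cone ?T" unfolding field_cone_def span
    by (auto simp flip: to_ac_add to_ac_mult to_ac_minus to_ac_inverse to_ac_0 to_ac_1)
qed

lemma field_cone_Union_chain:
  assumes "C \<noteq> {}" "subset.chain {T. field_cone T \<and> B \<subseteq> T} C"
  shows "field_cone (\<Union>C)"
proof -
  have fc: "field_cone T" if "T \<in> C" for T using assms(2) that by (auto simp: subset.chain_def)
  have dir: "\<exists>T\<in>C. x \<in> T \<and> y \<in> T" if "x \<in> \<Union>C" "y \<in> \<Union>C" for x y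
    using that assms(2) unfolding subset.chain_def by blast
  have span: "\<exists>T\<in>C. x \<in> cone_span T" if "x \<in> cone_span (\<Union>C)" for x
    using that dir unfolding cone_span_def by blast
  have span': "cone_span T \<subseteq> cone_span (\<Union>C)" if "T \<in> C" for T
    using that unfolding cone_span_def by blast
  obtain T0 where T0: "T0 \<in> C" using assms(1) by blast
  show ?thesis unfolding field_cone_def
  proof (intro conjI ballI impI)
    show "0 \<in> \<Union>C" "1 \<in> \<Union>C" using T0 fc fc_0 fc_1 by blast+
    show "x + y \<in> \<Union>C" if "x \<in> \<Union>C" "y \<in> \<Union>C" for x y
      using dir[OF that] fc fc_add by blast
    show "x * y \<in> \<Union>C" if "x \<in> \<Union>C" "y \<in> \<Union>C" for x y
      using dir[OF that] fc fc_mult by blast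
    show "x = 0" if "x \<in> \<Union>C" "- x \<in> \<Union>C" for x
      using dir[OF that] fc fc_antisym by blast
    show "inverse x \<in> cone_span (\<Union>C)" if "x \<in> cone_span (\<Union>C)" for x
      using span[OF that] span' fc fc_span_inverse by blast
    show "x * x \<in> \<Union>C" if "x \<in> cone_span (\<Union>C)" for x
      using span[OF that] fc fc_square by blast
  qed
qed

text \<open>Working inside the algebraic closure places all algebraic extensions in one type, as
  subfields. Maximality against cones on the same subfield makes the order total; maximality against
  cones on larger subfields will supply the roots.\<close>

definition max_cone :: "'a::linordered_field alg_closure set" where
  "max_cone = (SOME M. field_cone M \<and> to_ac ` {x. 0 \<le> x} \<subseteq> M \<and>
     (\<forall>N. field_cone N \<longrightarrow> M \<subseteq> N \<longrightarrow> N = M))"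

lemma max_cone:
  "field_cone (max_cone :: 'a::linordered_field alg_closure set)"
  "to_ac ` {x :: 'a. 0 \<le> x} \<subseteq> max_cone"
  "\<And>N. field_cone N \<Longrightarrow> max_cone \<subseteq> N \<Longrightarrow> N = (max_cone :: 'a alg_closure set)"
proof -
  let ?B = "to_ac ` {x :: 'a. 0 \<le> x}"
  let ?A = "{T. field_cone T \<and> ?B \<subseteq> T}"
  have "\<exists>M\<in>?A. \<forall>N\<in>?A. M \<subseteq> N \<longrightarrow> N = M"
  proof (rule subset_Zorn_nonempty)
    show "?A \<noteq> {}" using field_cone_base by blast
    fix C assume C: "C \<noteq> {}" "subset.chain ?A C"
    have "?B \<subseteq> \<Union>C" using C unfolding subset.chain_def by blast
    then show "\<Union>C \<in> ?A" using field_cone_Union_chain[OF C] by blast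
  qed
  then obtain M where M: "M \<in> ?A" "\<forall>N\<in>?A. M \<subseteq> N \<longrightarrow> N = M" by (rule bexE)
  have "\<forall>N. field_cone N \<longrightarrow> M \<subseteq> N \<longrightarrow> N = M"
  proof (intro allI impI)
    fix N assume N: "field_cone N" "M \<subseteq> N"
    then have "N \<in> ?A" using M(1) order_trans[of ?B M N] by simp
    with N M(2) show "N = M" by simp
  qed
  then have "field_cone M \<and> ?B \<subseteq> M \<and> (\<forall>N. field_cone N \<longrightarrow> M \<subseteq> N \<longrightarrow> N = M)"
    using M(1) by simp
  from someI[of "\<lambda>M. field_cone M \<and> ?B \<subseteq> M \<and> (\<forall>N. field_cone N \<longrightarrow> M \<subseteq> N \<longrightarrow> N = M)", OF this, folded max_cone_def]
  show "field_cone (max_cone :: 'a alg_closure set)" "?B \<subseteq> max_cone"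
    "\<And>N. field_cone N \<Longrightarrow> max_cone \<subseteq> N \<Longrightarrow> N = (max_cone :: 'a alg_closure set)"
    by simp_all
qed

lemma max_cone_total:
  assumes "x \<in> cone_span max_cone" shows "x \<in> max_cone \<or> - x \<in> max_cone"
proof (rule ccontr)
  assume "\<not> ?thesis"
  then have x: "x \<notin> max_cone" "- x \<notin> max_cone" by auto
  let ?T = "{a + x * b | a b. a \<in> max_cone \<and> b \<in> max_cone}"
  note 01 = fc_0[OF max_cone(1)] fc_1[OF max_cone(1)]
  have "field_cone ?T" by (rule fc_adjoin[OF max_cone(1) assms x(2)])
  moreover have "max_cone \<subseteq> ?T"
  proof
    fix a assume "a \<in> (max_cone :: 'a alg_closure set)"
    moreover have "a = a + x * 0" by simp
    ultimately show "a \<in> ?T" using 01 by blast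
  qed
  ultimately have "?T = max_cone" by (rule max_cone(3))
  moreover have "x = 0 + x * 1" by simp
  then have "x \<in> ?T" using 01 by blast
  ultimately show False using x by simp
qed

typedef (overloaded) ('a::linordered_field) real_closure = "cone_span (max_cone :: 'a alg_closure set)"
  using fc_subset_span[OF max_cone(1)] fc_0[OF max_cone(1)] by blast

setup_lifting type_definition_real_closure

instantiation real_closure :: (linordered_field) linordered_field
begin

lift_definition zero_real_closure :: "'a real_closure" is 0
  using fc_subset_span[OF max_cone(1)] fc_0[OF max_cone(1)] by blast
lift_definition one_real_closure :: "'a real_closure" is 1
  using fc_subset_span[OF max_cone(1)] fc_1[OF max_cone(1)] by blast
lift_definition plus_real_closure :: "'a real_closure \<Rightarrow> 'a real_closure \<Rightarrow> 'a real_closure" is "(+)"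
  by (rule fc_span_add[OF max_cone(1)])
lift_definition uminus_real_closure :: "'a real_closure \<Rightarrow> 'a real_closure" is "uminus"
  by (rule fc_span_uminus[OF max_cone(1)])
lift_definition minus_real_closure :: "'a real_closure \<Rightarrow> 'a real_closure \<Rightarrow> 'a real_closure" is "(-)"
  using fc_span_add[OF max_cone(1)] fc_span_uminus[OF max_cone(1)]
  by (metis (no_types, lifting) diff_conv_add_uminus)
lift_definition times_real_closure :: "'a real_closure \<Rightarrow> 'a real_closure \<Rightarrow> 'a real_closure" is "(*)"
  by (rule fc_span_mult[OF max_cone(1)])
lift_definition inverse_real_closure :: "'a real_closure \<Rightarrow> 'a real_closure" is "inverse"
  by (rule fc_span_inverse[OF max_cone(1)])
definition divide_real_closure :: "'a real_closure \<Rightarrow> 'a real_closure \<Rightarrow> 'a real_closure" where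
  "divide_real_closure x y = x * inverse y"
lift_definition less_eq_real_closure :: "'a real_closure \<Rightarrow> 'a real_closure \<Rightarrow> bool" is
  "\<lambda>x y. y - x \<in> max_cone" .
definition less_real_closure :: "'a real_closure \<Rightarrow> 'a real_closure \<Rightarrow> bool" where
  "less_real_closure x y \<longleftrightarrow> x \<le> y \<and> x \<noteq> y"
definition abs_real_closure :: "'a real_closure \<Rightarrow> 'a real_closure" where
  "abs_real_closure x = (if x < 0 then - x else x)"
definition sgn_real_closure :: "'a real_closure \<Rightarrow> 'a real_closure" where
  "sgn_real_closure x = (if x = 0 then 0 else if 0 < x then 1 else - 1)"

instance
proof
  note M = max_cone(1)
  have anti: "x = y" if "x \<le> y" "y \<le> x" for x y :: "'a real_closure"
    using that
  proof transfer
    fix x y :: "'a alg_closure" assume "y - x \<in> max_cone" "x - y \<in> max_cone"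
    then have "y - x = 0" by (intro fc_antisym[OF M]) auto
    then show "x = y" by simp
  qed
  have mono: "0 \<le> a * b" if "0 \<le> a" "0 \<le> b" for a b :: "'a real_closure"
    using that by transfer (simp add: fc_mult[OF M])
  have diff: "x \<le> y \<longleftrightarrow> 0 \<le> y - x" for x y :: "'a real_closure"
    by transfer simp
  fix x y z :: "'a real_closure"
  show "x + y + z = x + (y + z)" "x + y = y + x" "0 + x = x" "- x + x = 0" "x - y = x + - y"
    "x * y * z = x * (y * z)" "x * y = y * x" "1 * x = x" "(x + y) * z = x * z + y * z"
    "x + y - x = y" "x - y - z = x - (y + z)" "0 * x = 0" "x * 0 = 0"
    "(0 :: 'a real_closure) \<noteq> 1" "inverse (0 :: 'a real_closure) = 0"
    by (transfer, simp add: algebra_simps)+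
  show "x div y = x * inverse y" by (rule divide_real_closure_def)
  show "x \<noteq> 0 \<Longrightarrow> inverse x * x = 1" by transfer simp
  show "x \<le> x" by transfer (simp add: fc_0[OF M])
  show "x \<le> y \<Longrightarrow> y \<le> z \<Longrightarrow> x \<le> z"
  proof transfer
    fix x y z :: "'a alg_closure" assume "y - x \<in> max_cone" "z - y \<in> max_cone"
    then have "(y - x) + (z - y) \<in> max_cone" by (rule fc_add[OF M])
    then show "z - x \<in> max_cone" by simp
  qed
  show "x \<le> y \<Longrightarrow> y \<le> x \<Longrightarrow> x = y" by (rule anti)
  show "x < y \<longleftrightarrow> x \<le> y \<and> \<not> y \<le> x" using anti by (auto simp: less_real_closure_def)
  show "x \<le> y \<or> y \<le> x"
  proof transfer
    fix x y :: "'a alg_closure" assume "x \<in> cone_span max_cone" "y \<in> cone_span max_cone"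
    then have "y + - x \<in> cone_span max_cone" by (intro fc_span_add[OF M] fc_span_uminus[OF M])
    from max_cone_total[OF this] show "y - x \<in> max_cone \<or> x - y \<in> max_cone" by simp
  qed
  show "x \<le> y \<Longrightarrow> z + x \<le> z + y" by transfer simp
  show "\<bar>x\<bar> = (if x < 0 then - x else x)" by (rule abs_real_closure_def)
  show "sgn x = (if x = 0 then 0 else if 0 < x then 1 else - 1)" by (rule sgn_real_closure_def)
  show "x < y \<Longrightarrow> 0 < z \<Longrightarrow> z * x < z * y"
  proof -
    assume "x < y" "0 < z"
    then have *: "x \<le> y" "x \<noteq> y" "0 \<le> z" "z \<noteq> 0" by (auto simp: less_real_closure_def)
    have "0 \<le> z * (y - x)" using * diff mono by blast
    moreover have "z * (y - x) = z * y - z * x" by transfer (simp add: algebra_simps)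
    moreover have "z * x \<noteq> z * y" using *(2,4) by transfer simp
    ultimately show "z * x < z * y" using diff by (simp add: less_real_closure_def)
  qed
qed

end

lift_definition to_rc :: "'a::linordered_field \<Rightarrow> 'a real_closure" is to_ac
proof -
  fix x :: 'a
  have "to_ac x \<in> range to_ac" by simp
  then have "to_ac x \<in> cone_span (to_ac ` {x. 0 \<le> x})" by (simp only: cone_span_base)
  then show "to_ac x \<in> cone_span max_cone" using max_cone(2) unfolding cone_span_def by blast
qed

lemma to_rc_hom: "to_rc 1 = 1" "to_rc (x + y) = to_rc x + to_rc y" "to_rc (x * y) = to_rc x * to_rc y"
  by (transfer, simp)+

lemma to_rc_nonneg: "0 \<le> x \<Longrightarrow> 0 \<le> to_rc x"
  by transfer (use max_cone(2) in auto)

lemma to_rc_inj: "to_rc x = to_rc y \<longleftrightarrow> x = y"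
  by transfer simp

section \<open>Weighted sums of squares and roots in the maximal ordered subfield\<close>

text \<open>A nonnegative constant is not yet known to be a square, hence the weights: they put all
  nonnegative constants into the set, as is needed to extend a given order.\<close>

inductive_set weighted_sos :: "'k::linordered_field poly set" where
  zero: "0 \<in> weighted_sos"
| add: "0 \<le> c \<Longrightarrow> s \<in> weighted_sos \<Longrightarrow> smult c (q * q) + s \<in> weighted_sos"

lemma weighted_sos_add: "s \<in> weighted_sos \<Longrightarrow> t \<in> weighted_sos \<Longrightarrow> s + t \<in> weighted_sos"
  by (induction rule: weighted_sos.induct) (auto simp: add.assoc intro: weighted_sos.intros)

lemma weighted_sos_smult: "0 \<le> c \<Longrightarrow> smult c (q * q) \<in> weighted_sos"
  using weighted_sos.add[OF _ weighted_sos.zero] by force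

lemma weighted_sos_square: "q * q \<in> weighted_sos"
  using weighted_sos_smult[of 1 q] by simp

lemma weighted_sos_mult: "s \<in> weighted_sos \<Longrightarrow> t \<in> weighted_sos \<Longrightarrow> s * t \<in> weighted_sos"
proof (induction rule: weighted_sos.induct)
  case (add c s q)
  have "smult c (q * q) * t \<in> weighted_sos" using \<open>t \<in> weighted_sos\<close>
  proof (induction rule: weighted_sos.induct)
    case (add d t r)
    have "smult c (q * q) * (smult d (r * r) + t) = smult (c * d) ((q * r) * (q * r)) + smult c (q * q) * t"
      by (simp add: algebra_simps)
    then show ?case using add \<open>0 \<le> c\<close> by (metis weighted_sos.add mult_nonneg_nonneg)
  qed (simp add: weighted_sos.zero)
  then show ?case using add by (simp only: distrib_right) (auto intro: weighted_sos_add)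
qed (simp add: weighted_sos.zero)

lemma weighted_sos_nonneg: "s \<in> weighted_sos \<Longrightarrow> 0 \<le> poly s x"
  by (induction rule: weighted_sos.induct) auto

lemma weighted_sos_reduce:
  assumes "s \<in> weighted_sos" "degree p > 0"
  shows "\<exists>s' t. s' \<in> weighted_sos \<and> s = s' + p * t \<and> degree s' \<le> 2 * (degree p - 1)"
  using assms(1)
proof (induction rule: weighted_sos.induct)
  case zero
  then show ?case by (intro exI[of _ 0]) (simp add: weighted_sos.zero)
next
  case (add c s q)
  then obtain s' t where *: "s' \<in> weighted_sos" "s = s' + p * t" "degree s' \<le> 2 * (degree p - 1)" by blast
  define r where "r = q mod p"
  have q: "q = p * (q div p) + r" by (simp add: r_def)
  have dr: "degree r \<le> degree p - 1"
    using degree_mod_less[of p q] assms(2) unfolding r_def by force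
  have "smult c (q * q) + s = (smult c (r * r) + s') + p * (smult c (p * (q div p)\<^sup>2 + 2 * r * (q div p)) + t)"
    unfolding *(2) by (subst (1 2) q) (simp add: algebra_simps power2_eq_square smult_add_right)
  moreover have "degree (smult c (r * r) + s') \<le> 2 * (degree p - 1)"
    using * dr degree_mult_le[of r r] by (intro degree_add_le order_trans[OF degree_smult_le]) auto
  ultimately show ?case using * add(1) weighted_sos.add by metis
qed

text \<open>Descent: once \<open>s\<close> is reduced modulo \<open>p\<close>, the cofactor has
  smaller degree than \<open>p\<close>. The right-hand side is positive everywhere, so the cofactor
  has the same sign as \<open>p\<close> at each point; it changes sign as well and satisfies an
  identity of the same form with the factors exchanged.\<close>

lemma sign_change_no_certificate:
  fixes p :: "'k::linordered_field poly"
  assumes "poly p a < 0" "0 < poly p b" "s \<in> weighted_sos" "p * r = 1 + s"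
  shows False
  using assms
proof (induction "degree p" arbitrary: p r s rule: less_induct)
  case less
  have dp: "degree p > 0"
  proof (rule ccontr)
    assume "\<not> degree p > 0"
    then obtain c where "p = [:c:]" using degree_eq_zeroE by blast
    then show False using less.prems by simp
  qed
  obtain s' t where s': "s' \<in> weighted_sos" "s = s' + p * t" "degree s' \<le> 2 * (degree p - 1)"
    using weighted_sos_reduce[OF less.prems(3) dp] by blast
  define r' where "r' = r - t"
  have id: "p * r' = 1 + s'" using less.prems(4) s'(2) by (simp add: r'_def algebra_simps)
  have pos: "poly p x * poly r' x > 0" for x
  proof -
    have "poly p x * poly r' x = 1 + poly s' x" using arg_cong[OF id, of "\<lambda>p. poly p x"] by simp
    then show ?thesis using weighted_sos_nonneg[OF s'(1), of x] by simp
  qed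
  have r0: "r' \<noteq> 0" using pos[of a] by auto
  have "p \<noteq> 0" using dp by auto
  then have "degree p + degree r' = degree (1 + s')" using id r0 degree_mult_eq[of p r'] by simp
  also have "\<dots> \<le> 2 * (degree p - 1)" using s'(3) by (intro degree_add_le) auto
  finally have "degree r' < degree p" using dp by simp
  moreover have "poly r' a < 0" "0 < poly r' b"
    using pos[of a] pos[of b] less.prems by (auto simp: zero_less_mult_iff)
  moreover have "r' * p = 1 + s'" using id by (simp add: mult.commute)
  ultimately show False using less.hyps s'(1) by blast
qed

text \<open>A nonzero element of least degree in the ideal generated by \<open>p\<close> and
  \<open>q\<close> divides both; by irreducibility it is a constant or an associate of
  \<open>p\<close>.\<close>

lemma Bezout_dichotomy:
  fixes p :: "'k::field poly"
  assumes irr: "\<And>d e. p = d * e \<Longrightarrow> degree d = 0 \<or> degree e = 0" and p0: "p \<noteq> 0"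
  shows "p dvd q \<or> (\<exists>u v. u * q + v * p = 1)"
proof -
  define I where "I = {u * q + v * p | u v. True}"
  have pI: "p \<in> I" unfolding I_def by (rule CollectI, rule exI[of _ 0], rule exI[of _ 1]) simp
  have qI: "q \<in> I" unfolding I_def by (rule CollectI, rule exI[of _ 1], rule exI[of _ 0]) simp
  have "\<exists>d. d \<in> I \<and> d \<noteq> 0 \<and> (\<forall>x. x \<in> I \<and> x \<noteq> 0 \<longrightarrow> degree d \<le> degree x)"
    using ex_has_least_nat[of "\<lambda>x. x \<in> I \<and> x \<noteq> 0" p degree] pI p0 by blast
  then obtain d where d: "d \<in> I" "d \<noteq> 0" "\<And>x. x \<in> I \<Longrightarrow> x \<noteq> 0 \<Longrightarrow> degree d \<le> degree x" by blast
  have dvd: "d dvd x" if x: "x \<in> I" for x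
  proof (rule ccontr)
    assume n: "\<not> d dvd x"
    then have nz: "x mod d \<noteq> 0" by (simp add: dvd_eq_mod_eq_0)
    obtain u v u' v' where uv: "d = u * q + v * p" "x = u' * q + v' * p" using d(1) x by (auto simp: I_def)
    define k where "k = x div d"
    have "x mod d = x - k * d" by (simp add: minus_div_mult_eq_mod k_def)
    also have "\<dots> = (u' - k * u) * q + (v' - k * v) * p"
      unfolding uv by (simp add: algebra_simps)
    finally have "x mod d \<in> I" unfolding I_def by blast
    with nz d(3) have "degree d \<le> degree (x mod d)" by blast
    moreover have "degree (x mod d) < degree d" using degree_mod_less[OF d(2), of x] nz by blast
    ultimately show False by simp
  qed
  obtain e where e: "p = d * e" using dvd[OF pI] by (auto elim: dvdE)
  obtain e' where e': "q = d * e'" using dvd[OF qI] by (auto elim: dvdE)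
  from irr[OF e] show ?thesis
  proof
    assume "degree d = 0"
    then obtain c where c: "d = [:c:]" using degree_eq_zeroE by blast
    obtain u v where uv: "d = u * q + v * p" using d(1) by (auto simp: I_def)
    have "smult (inverse c) u * q + smult (inverse c) v * p = smult (inverse c) d"
      unfolding uv by (simp add: smult_add_right)
    also have "\<dots> = 1" using c d(2) by simp
    finally show ?thesis by blast
  next
    assume "degree e = 0"
    then obtain c where c: "e = [:c:]" using degree_eq_zeroE by blast
    then have "c \<noteq> 0" using e p0 by auto
    then have "d = p * [:inverse c:]" using e c by simp
    then have "q = p * ([:inverse c:] * e')" using e' by (simp only: mult.assoc)
    then have "p dvd q" by (rule dvdI)
    then show ?thesis by blast
  qed
qed

definition of_rc :: "'a::linordered_field real_closure \<Rightarrow> 'a alg_closure" where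
  "of_rc = Rep_real_closure"

lemma of_rc_hom: "unital_hom of_rc"
  by (simp add: unital_hom_def of_rc_def one_real_closure.rep_eq plus_real_closure.rep_eq
      times_real_closure.rep_eq)

lemma of_rc_inj: "of_rc x = of_rc y \<longleftrightarrow> x = y"
  by (simp add: of_rc_def Rep_real_closure_inject)

lemma range_of_rc: "range (of_rc :: 'a::linordered_field real_closure \<Rightarrow> _) = cone_span max_cone"
  unfolding of_rc_def by (rule type_definition.Rep_range[OF type_definition_real_closure])

lemma of_rc_nonneg: "0 \<le> x \<longleftrightarrow> of_rc x \<in> max_cone"
  by (simp add: of_rc_def less_eq_real_closure.rep_eq zero_real_closure.rep_eq)

text \<open>A rootless sign-changing polynomial of least degree is irreducible. On the field
  obtained by adjoining a root \<open>w\<close> from the algebraic closure, the values of weighted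
  sums of squares form a cone containing \<open>max_cone\<close>; by maximality \<open>w\<close> is
  not new.\<close>

lemma real_closure_root_exists:
  fixes p :: "'a::linordered_field real_closure poly"
  assumes "poly p a < 0" "0 < poly p b"
  shows "\<exists>x. poly p x = 0"
proof (rule ccontr)
  assume nr: "\<not> ?thesis"
  define bad where "bad = (\<lambda>p :: 'a real_closure poly. (\<exists>a b. poly p a < 0 \<and> 0 < poly p b) \<and> \<not> (\<exists>x. poly p x = 0))"
  have "bad p" using assms nr by (auto simp: bad_def)
  then have "\<exists>p. bad p \<and> (\<forall>q. bad q \<longrightarrow> degree p \<le> degree q)" using ex_has_least_nat[of bad p degree] by blast
  then obtain P where P: "bad P" "\<And>q. bad q \<Longrightarrow> degree P \<le> degree q" by blast
  obtain a b where ab: "poly P a < 0" "0 < poly P b" and nr: "\<And>x. poly P x \<noteq> 0" using P(1) by (auto simp: bad_def)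
  have dP: "degree P > 0"
  proof (rule ccontr)
    assume "\<not> degree P > 0"
    then obtain c where "P = [:c:]" using degree_eq_zeroE by blast
    then show False using ab by simp
  qed
  have P0: "P \<noteq> 0" using dP by auto
  have irr: "degree d = 0 \<or> degree e = 0" if de: "P = d * e" for d e
  proof -
    have d0: "d \<noteq> 0" "e \<noteq> 0" using P0 de by auto
    have nrd: "poly d x \<noteq> 0" "poly e x \<noteq> 0" for x using nr[of x] de by auto
    have "poly d a * poly e a < 0" "0 < poly d b * poly e b" using ab de by auto
    then consider "poly d a < 0" "0 < poly d b" | "poly d b < 0" "0 < poly d a"
       | "poly e a < 0" "0 < poly e b" | "poly e b < 0" "0 < poly e a"
      by (auto simp: mult_less_0_iff zero_less_mult_iff)
    then have "bad d \<or> bad e" using nrd unfolding bad_def by cases blast+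
    then have "degree P \<le> degree d \<or> degree P \<le> degree e" using P(2) by blast
    then show ?thesis using de d0 by (auto simp: degree_mult_eq)
  qed
  note hom = of_rc_hom[where 'a='a]
  have "degree (map_poly of_rc P) > 0"
    using dP of_rc_inj[of _ "0 :: 'a real_closure"] P0 by (subst degree_map_poly) (auto simp: hom_0[OF hom])
  then obtain w where w: "poly (map_poly of_rc P) w = 0"
    using alg_closed_imp_poly_has_root by blast
  \<comment> \<open>Evaluation at \<open>w\<close>. Its range is the whole field generated by
    \<open>w\<close>, with inverses supplied by \<open>Bezout_dichotomy\<close>.\<close>
  define ev where "ev = (\<lambda>q. poly (map_poly of_rc q) w)"
  have ev: "ev (q + r) = ev q + ev r" "ev (q * r) = ev q * ev r" "ev (q - r) = ev q - ev r"
    "ev [:c:] = of_rc c" "ev (smult c q) = of_rc c * ev q" "ev P = 0" for q r c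
    using w by (auto simp: ev_def hom_poly_add[OF hom] hom_poly_mult[OF hom] hom_poly_diff[OF hom]
        hom_poly_smult[OF hom] map_poly_pCons hom_0[OF hom])
  have ev1: "ev 1 = 1" using ev(4)[of 1] hom_1[OF hom] by (simp add: one_pCons)
  have ev0: "ev 0 = 0" using ev(4)[of 0] hom_0[OF hom] by simp
  have unit: "\<exists>u v. u * q + v * P = 1" if "ev q \<noteq> 0" for q
  proof -
    have "\<not> P dvd q" using that by (auto simp: ev elim!: dvdE)
    then show ?thesis using Bezout_dichotomy[of P q] irr P0 by blast
  qed
  define T where "T = ev ` weighted_sos"
  have span: "cone_span T = range ev"
  proof
    show "cone_span T \<subseteq> range ev" by (auto simp: cone_span_def T_def simp flip: ev)
    show "range ev \<subseteq> cone_span T"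
    proof
      fix x assume "x \<in> range ev"
      then obtain q where q: "x = ev q" by blast
      \<comment> \<open>Every \<open>q\<close> is the difference of the squares of
        \<open>(q + 1) / 2\<close> and \<open>(q - 1) / 2\<close>, so the cone of weighted squares
        spans the extension field.\<close>
      define h where "h = smult (1/2) (q + 1)"
      define k where "k = smult (1/2) (q - 1)"
      have "h = k + 1" unfolding h_def k_def
        by (rule poly_eqI) (simp add: field_simps)
      moreover have "h + k = q" unfolding h_def k_def
        by (rule poly_eqI) (simp add: field_simps)
      ultimately have "q = h * h - k * k" by (simp add: algebra_simps)
      then have "ev q = ev (h * h) - ev (k * k)" by (simp only: ev)
      then show "x \<in> cone_span T"
        unfolding q cone_span_def T_def using weighted_sos_square by blast
    qed
  qed
  have cone: "field_cone T" unfolding field_cone_def span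
  proof (intro conjI ballI impI)
    show "0 \<in> T" unfolding T_def by (rule image_eqI[of _ _ 0]) (simp_all add: ev0 weighted_sos.zero)
    show "1 \<in> T" unfolding T_def using weighted_sos_square[of 1] by (intro image_eqI[of _ _ 1]) (simp_all add: ev1)
    show "x + y \<in> T" if xy: "x \<in> T" "y \<in> T" for x y
    proof -
      obtain s t where *: "x = ev s" "y = ev t" "s \<in> weighted_sos" "t \<in> weighted_sos"
        using xy unfolding T_def by blast
      then have "x + y = ev (s + t)" by (simp add: ev)
      with * weighted_sos_add show ?thesis unfolding T_def by blast
    qed
    show "x * y \<in> T" if xy: "x \<in> T" "y \<in> T" for x y
    proof -
      obtain s t where *: "x = ev s" "y = ev t" "s \<in> weighted_sos" "t \<in> weighted_sos"
        using xy unfolding T_def by blast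
      then have "x * y = ev (s * t)" by (simp add: ev)
      with * weighted_sos_mult show ?thesis unfolding T_def by blast
    qed
    show "x * x \<in> T" if x: "x \<in> range ev" for x
    proof -
      obtain s where "x = ev s" using x by blast
      then have "x * x = ev (s * s)" by (simp add: ev)
      with weighted_sos_square show ?thesis unfolding T_def by blast
    qed
    show "inverse x \<in> range ev" if x: "x \<in> range ev" for x
    proof (cases "x = 0")
      case True
      then show ?thesis using ev0 by (metis inverse_zero rangeI)
    next
      case False
      obtain q where q: "x = ev q" using x by blast
      obtain u v where "u * q + v * P = 1" using unit[of q] False q by blast
      from arg_cong[OF this, of ev] have "ev u * x = 1" by (simp add: ev ev1 q)
      then have "inverse x = ev u" by (metis inverse_unique mult.commute)
      then show ?thesis by simp
    qed
    show "x = 0" if x: "x \<in> T" "- x \<in> T" for x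
    proof (rule ccontr)
      assume "x \<noteq> 0"
      obtain s t where st: "x = ev s" "- x = ev t" "s \<in> weighted_sos" "t \<in> weighted_sos"
        using x by (auto simp: T_def)
      obtain u v where "u * s + v * P = 1" using unit[of s] \<open>x \<noteq> 0\<close> st by blast
      from arg_cong[OF this, of ev] have u: "ev u * x = 1" by (simp add: ev ev1 st(1))
      \<comment> \<open>Here \<open>s\<close>, \<open>t\<close> and \<open>u\<close> evaluate at
        \<open>w\<close> to \<open>x\<close>, \<open>- x\<close> and the inverse of
        \<open>x\<close>, so \<open>z\<close> evaluates to \<open>- 1\<close>. Hence
        \<open>P\<close> divides \<open>1 + z\<close>, which is excluded for a polynomial that
        changes sign.\<close>
      define z where "z = t * s * (u * u)"
      have z: "z \<in> weighted_sos" unfolding z_def using st weighted_sos_mult weighted_sos_square by blast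
      have "ev (1 + z) = 1 + (- x) * x * (ev u * ev u)"
        by (simp only: ev ev1 z_def flip: st(1,2))
      also have "\<dots> = 1 - (ev u * x) * (ev u * x)" by (simp add: algebra_simps)
      finally have "ev (1 + z) = 0" using u by simp
      have "P dvd 1 + z"
      proof (rule ccontr)
        assume "\<not> P dvd 1 + z"
        then obtain u' v' where "u' * (1 + z) + v' * P = 1" using Bezout_dichotomy[of P "1 + z"] irr P0 by blast
        from arg_cong[OF this, of ev] show False using \<open>ev (1 + z) = 0\<close> by (simp only: ev ev1) simp
      qed
      then obtain r where "P * r = 1 + z" by (metis dvdE)
      from sign_change_no_certificate[OF ab z this] show False .
    qed
  qed
  have "max_cone \<subseteq> T"
  proof
    fix x :: "'a alg_closure" assume x: "x \<in> max_cone"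
    then have "x \<in> range of_rc" unfolding range_of_rc using fc_subset_span[OF max_cone(1)] by blast
    then obtain c where c: "x = of_rc c" by blast
    have "c \<ge> 0" using x c of_rc_nonneg by blast
    then have "smult c (1 * 1) \<in> weighted_sos" by (rule weighted_sos_smult)
    moreover have "ev (smult c (1 * 1)) = x" by (simp add: ev ev1 c)
    ultimately show "x \<in> T" unfolding T_def by blast
  qed
  from max_cone(3)[OF cone this] have "T = max_cone" .
  then have "range of_rc = range ev" unfolding range_of_rc using span by simp
  moreover have "ev [:0, 1:] = w" by (simp add: ev_def map_poly_pCons hom_0[OF hom] hom_1[OF hom])
  ultimately have "w \<in> range of_rc" by (metis rangeI)
  then obtain k where k: "w = of_rc k" by blast
  have "of_rc (poly P k) = poly (map_poly of_rc P) (of_rc k)"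
    by (induction P) (simp_all add: map_poly_pCons hom_0[OF hom] hom_add[OF hom] hom_mult[OF hom])
  then have "poly P k = 0" using w k hom_0[OF hom] of_rc_inj by metis
  with nr show False by blast
qed

instance real_closure :: (linordered_field) real_closed_field
proof
  \<comment> \<open>The root found so far may lie outside the interval. Dividing by its linear
    factor then preserves the sign change, because \<open>a - r\<close> and \<open>b - r\<close>
    have equal signs, and lowers the degree.\<close>
  have root: "\<exists>x. a < x \<and> x < b \<and> poly p x = 0"
    if "a < b" "poly p a * poly p b < 0" for a b and p :: "'a real_closure poly"
    using that
  proof (induction "degree p" arbitrary: p rule: less_induct)
    case less
    have "\<exists>r. poly p r = 0" using real_closure_root_exists[of p a b] real_closure_root_exists[of p b a] less.prems
      by (auto simp: mult_less_0_iff)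
    then obtain r where r: "poly p r = 0" by blast
    show ?case
    proof (cases "a < r \<and> r < b")
      case True
      then show ?thesis using r by blast
    next
      case False
      obtain q where q: "p = [:-r, 1:] * q" using r unfolding poly_eq_0_iff_dvd by (auto elim: dvdE)
      have ne: "poly p a \<noteq> 0" "poly p b \<noteq> 0" using less.prems by auto
      then have "r \<noteq> a" "r \<noteq> b" using r by auto
      then have "(a < r \<and> b < r) \<or> (r < a \<and> r < b)" using False less.prems(1)
        by (metis less_trans linorder_neqE)
      then have "(a - r) * (b - r) > 0" by (auto simp: zero_less_mult_iff)
      moreover have "poly p a * poly p b = ((a - r) * (b - r)) * (poly q a * poly q b)"
        by (simp add: q algebra_simps)
      ultimately have "poly q a * poly q b < 0" using less.prems(2)
        by (metis mult_less_0_iff not_less_iff_gr_or_eq)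
      moreover have "degree q < degree p"
      proof -
        have "q \<noteq> 0" using ne q by auto
        then show ?thesis unfolding q by (subst degree_mult_eq) auto
      qed
      ultimately obtain x where "a < x" "x < b" "poly q x = 0" using less.hyps less.prems(1) by blast
      then show ?thesis using q by auto
    qed
  qed
  fix a b :: "'a real_closure" and n and c :: "nat \<Rightarrow> 'a real_closure"
  assume *: "a < b" "(\<Sum>k\<le>n. c k * a ^ k) < 0" "0 < (\<Sum>k\<le>n. c k * b ^ k)"
  define p where "p = (\<Sum>k\<le>n. monom (c k) k)"
  have p: "poly p x = (\<Sum>k\<le>n. c k * x ^ k)" for x by (simp add: p_def poly_sum poly_monom)
  show "\<exists>x. a < x \<and> x < b \<and> (\<Sum>k\<le>n. c k * x ^ k) = 0"
    using root[OF *(1), of p] * by (auto simp: p mult_less_0_iff)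
qed

section \<open>Prime cones and the Artin--Lang theorem\<close>

lemma keys_of_sum_singles:
  "p = (\<Sum>\<alpha>\<in>Poly_Mapping.keys p. Poly_Mapping.single \<alpha> (Poly_Mapping.lookup p \<alpha>))"
  by (rule poly_mapping_eqI)
    (auto simp: lookup_sum lookup_single when_def sum.delta' in_keys_iff)

lemma poly_mapping_add_induct [case_names single add]:
  fixes p :: "'a \<Rightarrow>\<^sub>0 'b::comm_monoid_add"
  assumes "\<And>\<alpha> c. P (Poly_Mapping.single \<alpha> c)" "\<And>p q. P p \<Longrightarrow> P q \<Longrightarrow> P (p + q)"
  shows "P p"
proof -
  have "P (\<Sum>\<alpha>\<in>A. Poly_Mapping.single \<alpha> (f \<alpha>))" if "finite A" for A and f :: "'a \<Rightarrow> 'b"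
    using that
  proof (induction A)
    case empty
    then show ?case using assms(1)[of undefined 0] by simp
  qed (auto intro: assms)
  from this[of "Poly_Mapping.keys p" "Poly_Mapping.lookup p"] show ?thesis
    using keys_of_sum_singles[of p] by simp
qed

definition lin_ext :: "('a \<Rightarrow> 'b::comm_monoid_add \<Rightarrow> 'c::comm_monoid_add) \<Rightarrow> ('a \<Rightarrow>\<^sub>0 'b) \<Rightarrow> 'c" where
  "lin_ext \<phi> p = (\<Sum>\<alpha>\<in>Poly_Mapping.keys p. \<phi> \<alpha> (Poly_Mapping.lookup p \<alpha>))"

context
  fixes \<phi> :: "'a \<Rightarrow> 'b::comm_monoid_add \<Rightarrow> 'c::comm_monoid_add"
  assumes \<phi>0: "\<And>\<alpha>. \<phi> \<alpha> 0 = 0" and \<phi>add: "\<And>\<alpha> x y. \<phi> \<alpha> (x + y) = \<phi> \<alpha> x + \<phi> \<alpha> y"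
begin

lemma lin_ext_superset:
  "finite S \<Longrightarrow> Poly_Mapping.keys p \<subseteq> S \<Longrightarrow> lin_ext \<phi> p = (\<Sum>\<alpha>\<in>S. \<phi> \<alpha> (Poly_Mapping.lookup p \<alpha>))"
  unfolding lin_ext_def by (rule sum.mono_neutral_left) (auto simp: in_keys_iff \<phi>0)

lemma lin_ext_add: "lin_ext \<phi> (p + q) = lin_ext \<phi> p + lin_ext \<phi> q"
proof -
  let ?S = "Poly_Mapping.keys p \<union> Poly_Mapping.keys q"
  have "Poly_Mapping.keys (p + q) \<subseteq> ?S" by (rule Poly_Mapping.keys_add)
  then show ?thesis
    by (simp add: lin_ext_superset[of ?S] lookup_add \<phi>add sum.distrib)
qed

lemma lin_ext_single: "lin_ext \<phi> (Poly_Mapping.single \<alpha> c) = \<phi> \<alpha> c"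
  by (cases "c = 0") (auto simp: lin_ext_def \<phi>0)

end

lemma additive_mult:
  fixes L :: "('a::monoid_add \<Rightarrow>\<^sub>0 'b::semiring_0) \<Rightarrow> 'c::semiring_0"
  assumes "\<And>p q. L (p + q) = L p + L q"
    and "\<And>\<alpha> \<beta> a b. L (Poly_Mapping.single (\<alpha> + \<beta>) (a * b)) = L (Poly_Mapping.single \<alpha> a) * L (Poly_Mapping.single \<beta> b)"
  shows "L (p * q) = L p * L q"
proof (induction p rule: poly_mapping_add_induct)
  case (single \<alpha> c)
  show ?case by (induction q rule: poly_mapping_add_induct) (simp_all add: mult_single assms distrib_left)
qed (simp add: assms distrib_right)

lemma apply_fun_eq: "apply_fun y p = lin_ext (\<lambda>\<alpha> c. c * y \<alpha>) p"
  by (simp add: apply_fun_def lin_ext_def)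

lemma apply_fun_add: "apply_fun y (p + q) = apply_fun y p + apply_fun y q"
  unfolding apply_fun_eq by (rule lin_ext_add) (auto simp: distrib_right)

lemma apply_fun_single: "apply_fun y (Poly_Mapping.single \<alpha> c) = c * y \<alpha>"
  unfolding apply_fun_eq by (rule lin_ext_single) (auto simp: distrib_right)

lemma apply_fun_0: "apply_fun y 0 = 0"
  by (simp add: apply_fun_def)

lemma apply_fun_uminus: "apply_fun y (- p) = - apply_fun y p"
  using apply_fun_add[of y p "- p"] apply_fun_0 by (metis add.right_inverse add_eq_0_iff)

lemma apply_fun_diff: "apply_fun y (p - q) = apply_fun y p - apply_fun y q"
  using apply_fun_add[of y p "- q"] by (simp add: apply_fun_uminus)

lemma apply_fun_sum: "apply_fun y (sum f A) = (\<Sum>i\<in>A. apply_fun y (f i))"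
  by (induction A rule: infinite_finite_induct) (auto simp: apply_fun_0 apply_fun_add)

lemma peval_eq: "peval p x = apply_fun (\<lambda>\<alpha>. monom_eval \<alpha> x) p"
  by (simp add: peval_def apply_fun_def)

lemma monom_eval_add: "monom_eval (\<alpha> + \<beta>) x = monom_eval \<alpha> x * monom_eval \<beta> x"
  by (simp add: monom_eval_def lookup_add power_add prod.distrib)

lemma monom_eval_0: "monom_eval 0 x = 1"
  by (simp add: monom_eval_def)

lemma peval_single: "peval (Poly_Mapping.single \<alpha> c) x = c * monom_eval \<alpha> x"
  by (simp add: peval_eq apply_fun_single)

lemma peval_add: "peval (p + q) x = peval p x + peval q x"
  by (simp add: peval_eq apply_fun_add)

lemma peval_mult: "peval (p * q) x = peval p x * peval q x"
  by (rule additive_mult[of "\<lambda>p. peval p x"]) (simp_all add: peval_add peval_single monom_eval_add)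

lemma peval_1: "peval 1 x = 1"
  using peval_single[of 0 1 x] by (simp add: monom_eval_0)

lemma peval_hom: "unital_hom (\<lambda>p. peval p x)"
  by (simp add: unital_hom_def peval_add peval_mult peval_1)

lemmas peval_0 = hom_0[OF peval_hom] and peval_uminus = hom_uminus[OF peval_hom]
  and peval_diff = hom_diff[OF peval_hom] and peval_sum = hom_sum[OF peval_hom]

section \<open>Prime cones and the ordered residue ring\<close>

text \<open>A point of the real spectrum. The elements \<open>x\<close> with \<open>x\<close> and
  \<open>- x\<close> in \<open>P\<close> form a prime ideal, the support, and the residue ring
  modulo the support is an ordered domain.\<close>

definition prime_cone :: "'r::comm_ring_1 set \<Rightarrow> bool" where
  "prime_cone P \<longleftrightarrow> (\<forall>x\<in>P. \<forall>y\<in>P. x + y \<in> P) \<and> (\<forall>x\<in>P. \<forall>y\<in>P. x * y \<in> P) \<and>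
    (\<forall>x. x \<in> P \<or> - x \<in> P) \<and> - 1 \<notin> P \<and>
    (\<forall>x y. x * y \<in> P \<longrightarrow> - (x * y) \<in> P \<longrightarrow> (x \<in> P \<and> - x \<in> P) \<or> (y \<in> P \<and> - y \<in> P))"

context
  fixes P :: "'r::comm_ring_1 set"
  assumes P: "prime_cone P"
begin

lemma pc_add: "x \<in> P \<Longrightarrow> y \<in> P \<Longrightarrow> x + y \<in> P"
  using P unfolding prime_cone_def by (elim conjE) simp

lemma pc_mult: "x \<in> P \<Longrightarrow> y \<in> P \<Longrightarrow> x * y \<in> P"
  using P unfolding prime_cone_def by (elim conjE) simp

lemma pc_total: "x \<in> P \<or> - x \<in> P"
  using P unfolding prime_cone_def by (elim conjE) blast

lemma pc_proper: "- 1 \<notin> P"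
  using P unfolding prime_cone_def by (elim conjE)

lemma pc_prime: "x * y \<in> P \<Longrightarrow> - (x * y) \<in> P \<Longrightarrow> (x \<in> P \<and> - x \<in> P) \<or> (y \<in> P \<and> - y \<in> P)"
  using P unfolding prime_cone_def by (elim conjE) simp

lemma pc_square: "x * x \<in> P"
  using pc_total[of x] pc_mult[of x x] pc_mult[of "- x" "- x"] by auto

lemma pc_0: "0 \<in> P"
  using pc_square[of 0] by simp

lemma pc_support_mult: "x \<in> P \<Longrightarrow> - x \<in> P \<Longrightarrow> x * y \<in> P"
  using pc_total[of y] pc_mult[of x y] pc_mult[of "- x" "- y"] by auto

end

text \<open>The Artin--Lang property: as far as finitely many polynomials can tell, membership in
  \<open>P\<close> is nonnegativity at an actual real point.\<close>

definition sign_realizable :: "('n::finite) rpoly set \<Rightarrow> bool" where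
  "sign_realizable P \<longleftrightarrow> (\<forall>F. finite F \<longrightarrow> (\<exists>x. \<forall>f\<in>F. f \<in> P \<longleftrightarrow> 0 \<le> peval f x))"

text \<open>A cone that refutes the Artin--Lang property if any prime cone does. Being a constant,
  it can be used in a type definition.\<close>

definition critical_cone :: "('n::finite) rpoly set" where
  "critical_cone = (SOME P. prime_cone P \<and> ((\<exists>Q :: 'n rpoly set. prime_cone Q \<and> \<not> sign_realizable Q) \<longrightarrow> \<not> sign_realizable P))"

lemma prime_cone_point: "prime_cone {p. 0 \<le> peval p x}"
  unfolding prime_cone_def by (auto simp: peval_add peval_mult peval_uminus peval_1)

lemma critical_cone:
  "prime_cone (critical_cone :: ('n::finite) rpoly set)"
  "sign_realizable (critical_cone :: 'n rpoly set) \<Longrightarrow> prime_cone (Q :: 'n rpoly set) \<Longrightarrow> sign_realizable Q"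
proof -
  have "\<exists>P :: 'n rpoly set. prime_cone P \<and> ((\<exists>Q :: 'n rpoly set. prime_cone Q \<and> \<not> sign_realizable Q) \<longrightarrow> \<not> sign_realizable P)"
    using prime_cone_point by blast
  from someI_ex[OF this, folded critical_cone_def]
  show "prime_cone (critical_cone :: 'n rpoly set)"
    "sign_realizable (critical_cone :: 'n rpoly set) \<Longrightarrow> prime_cone (Q :: 'n rpoly set) \<Longrightarrow> sign_realizable Q"
    by blast+
qed

text \<open>Congruence modulo the support of the cone.\<close>

definition crit_equiv :: "('n::finite) rpoly \<Rightarrow> 'n rpoly \<Rightarrow> bool" where
  "crit_equiv p q \<longleftrightarrow> p - q \<in> critical_cone \<and> q - p \<in> critical_cone"

lemma crit_equiv_trans: "crit_equiv p q \<Longrightarrow> crit_equiv q r \<Longrightarrow> crit_equiv p r"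
  unfolding crit_equiv_def
  using pc_add[OF critical_cone(1), of "p - q" "q - r"] pc_add[OF critical_cone(1), of "r - q" "q - p"] by simp

quotient_type (overloaded) 'n residue = "('n::finite) rpoly" / crit_equiv
  morphisms residue_rep residue_class
proof (rule equivpI)
  show "reflp crit_equiv" by (auto simp: reflp_def crit_equiv_def pc_0[OF critical_cone(1)])
  show "symp crit_equiv" by (auto simp: symp_def crit_equiv_def)
  show "transp crit_equiv" by (auto simp: transp_def intro: crit_equiv_trans)
qed

instantiation residue :: (finite) linordered_idom
begin

lift_definition zero_residue :: "'a residue" is 0 .
lift_definition one_residue :: "'a residue" is 1 .
lift_definition plus_residue :: "'a residue \<Rightarrow> 'a residue \<Rightarrow> 'a residue" is "(+)"
proof -
  fix p q r s :: "'a rpoly" assume "crit_equiv p q" "crit_equiv r s"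
  then have "(p - q) + (r - s) \<in> critical_cone" "(q - p) + (s - r) \<in> critical_cone"
    unfolding crit_equiv_def by (auto intro: pc_add[OF critical_cone(1)])
  then show "crit_equiv (p + r) (q + s)" by (simp add: crit_equiv_def algebra_simps)
qed
lift_definition uminus_residue :: "'a residue \<Rightarrow> 'a residue" is "uminus"
  by (auto simp: crit_equiv_def)
definition minus_residue :: "'a residue \<Rightarrow> 'a residue \<Rightarrow> 'a residue" where
  "minus_residue x y = x + - y"
lift_definition times_residue :: "'a residue \<Rightarrow> 'a residue \<Rightarrow> 'a residue" is "(*)"
proof -
  fix p q r s :: "'a rpoly" assume *: "crit_equiv p q" "crit_equiv r s"
  note M = critical_cone(1)
  have a: "(p - q) * r \<in> critical_cone" "(q - p) * r \<in> critical_cone"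
    using * pc_support_mult[OF M, of "p - q" r] pc_support_mult[OF M, of "q - p" r]
    by (auto simp: crit_equiv_def)
  have b: "(r - s) * q \<in> critical_cone" "(s - r) * q \<in> critical_cone"
    using * pc_support_mult[OF M, of "r - s" q] pc_support_mult[OF M, of "s - r" q]
    by (auto simp: crit_equiv_def)
  have "(p - q) * r + (r - s) * q \<in> critical_cone" "(q - p) * r + (s - r) * q \<in> critical_cone"
    using a b pc_add[OF M] by blast+
  then show "crit_equiv (p * r) (q * s)" by (simp add: crit_equiv_def algebra_simps)
qed
lift_definition less_eq_residue :: "'a residue \<Rightarrow> 'a residue \<Rightarrow> bool" is
  "\<lambda>p q. q - p \<in> critical_cone"
proof -
  fix p q r s :: "'a rpoly" assume *: "crit_equiv p q" "crit_equiv r s"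
  have "r - p = (s - q) + (r - s) + (q - p)" "s - q = (r - p) + (s - r) + (p - q)" by simp_all
  then show "(r - p \<in> critical_cone) = (s - q \<in> critical_cone)"
    using * unfolding crit_equiv_def by (metis pc_add[OF critical_cone(1)])
qed
definition less_residue :: "'a residue \<Rightarrow> 'a residue \<Rightarrow> bool" where
  "less_residue x y \<longleftrightarrow> x \<le> y \<and> x \<noteq> y"
definition abs_residue :: "'a residue \<Rightarrow> 'a residue" where
  "abs_residue x = (if x < 0 then - x else x)"
definition sgn_residue :: "'a residue \<Rightarrow> 'a residue" where
  "sgn_residue x = (if x = 0 then 0 else if 0 < x then 1 else - 1)"

instance
proof
  note M = critical_cone(1)
  have z: "crit_equiv p p" for p :: "'a rpoly" by (simp add: crit_equiv_def pc_0[OF M])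
  have anti: "x = y" if "x \<le> y" "y \<le> x" for x y :: "'a residue"
    using that by transfer (simp add: crit_equiv_def)
  have mono: "0 \<le> a * b" if "0 \<le> a" "0 \<le> b" for a b :: "'a residue"
    using that by transfer (simp add: pc_mult[OF M])
  have diff: "x \<le> y \<longleftrightarrow> 0 \<le> y + - x" for x y :: "'a residue"
    by transfer simp
  have nzd: "x = 0 \<or> y = 0" if "x * y = 0" for x y :: "'a residue"
    using that by transfer (simp add: crit_equiv_def pc_prime[OF M])
  fix x y z :: "'a residue"
  show "x + y + z = x + (y + z)" "x + y = y + x" "0 + x = x" "- x + x = 0"
    "x * y * z = x * (y * z)" "x * y = y * x" "1 * x = x" "(x + y) * z = x * z + y * z"
    by (transfer, simp add: algebra_simps z)+
  show "x - y = x + - y" by (simp add: minus_residue_def)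
  show "x + y - x = y" "x - y - z = x - (y + z)" unfolding minus_residue_def
    by (transfer, simp add: algebra_simps z)+
  show "0 * x = 0" "x * 0 = 0" by (transfer, simp add: z)+
  show "(0 :: 'a residue) \<noteq> 1" by transfer (use pc_proper[OF M] in \<open>auto simp: crit_equiv_def\<close>)
  show "x \<le> x" by transfer (simp add: pc_0[OF M])
  show "x \<le> y \<Longrightarrow> y \<le> z \<Longrightarrow> x \<le> z"
  proof transfer
    fix x y z :: "'a rpoly" assume "y - x \<in> critical_cone" "z - y \<in> critical_cone"
    then have "(y - x) + (z - y) \<in> critical_cone" by (rule pc_add[OF M])
    then show "z - x \<in> critical_cone" by simp
  qed
  show "x \<le> y \<Longrightarrow> y \<le> x \<Longrightarrow> x = y" by (rule anti)
  show "x < y \<longleftrightarrow> x \<le> y \<and> \<not> y \<le> x" using anti by (auto simp: less_residue_def)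
  show "x \<le> y \<or> y \<le> x"
  proof transfer
    fix x y :: "'a rpoly"
    show "y - x \<in> critical_cone \<or> x - y \<in> critical_cone" using pc_total[OF M, of "y - x"] by simp
  qed
  show "x \<le> y \<Longrightarrow> z + x \<le> z + y" by transfer simp
  show "\<bar>x\<bar> = (if x < 0 then - x else x)" by (rule abs_residue_def)
  show "sgn x = (if x = 0 then 0 else if 0 < x then 1 else - 1)" by (rule sgn_residue_def)
  show "x < y \<Longrightarrow> 0 < z \<Longrightarrow> z * x < z * y"
  proof -
    assume "x < y" "0 < z"
    then have *: "x \<le> y" "x \<noteq> y" "0 \<le> z" "z \<noteq> 0" by (auto simp: less_residue_def)
    have "0 \<le> z * (y + - x)" using * diff mono by blast
    moreover have e: "z * (y + - x) = z * y + - (z * x)" by transfer (simp add: algebra_simps z)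
    moreover have "z * x \<noteq> z * y"
    proof
      assume "z * x = z * y"
      then have "z * (y + - x) = 0" unfolding e by transfer (simp add: crit_equiv_def)
      then have "y + - x = 0" using nzd *(4) by blast
      then have "x = y" by transfer (simp add: crit_equiv_def)
      with *(2) show False by simp
    qed
    ultimately show "z * x < z * y" using diff by (simp add: less_residue_def)
  qed
qed

end

section \<open>Eliminating the variables one by one\<close>

text \<open>The variable \<open>v\<close> becomes the main one and is erased from the coefficients.
  These remain in the same polynomial ring, because the index type of the variables is
  fixed.\<close>

definition split_var :: "'n \<Rightarrow> 'n rpoly \<Rightarrow> 'n rpoly poly" where
  "split_var v = lin_ext (\<lambda>\<alpha> c. monom (Poly_Mapping.single (Poly_Mapping.update v 0 \<alpha>) c) (Poly_Mapping.lookup \<alpha> v))"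

lemma poly_split_var:
  fixes p :: "'a rpoly"
  assumes e: "unital_hom e"
  shows "poly (map_poly e (split_var v p)) y =
    (\<Sum>\<alpha>\<in>Poly_Mapping.keys p. e (Poly_Mapping.single (Poly_Mapping.update v 0 \<alpha>) (Poly_Mapping.lookup p \<alpha>)) * y ^ Poly_Mapping.lookup \<alpha> v)"
proof -
  have "poly (map_poly e (\<Sum>\<alpha>\<in>A. f \<alpha>)) y = (\<Sum>\<alpha>\<in>A. poly (map_poly e (f \<alpha>)) y)" for A and f :: "'a mono \<Rightarrow> _"
    by (induction A rule: infinite_finite_induct) (auto simp: hom_poly_add[OF e])
  then show ?thesis
    by (simp add: split_var_def lin_ext_def hom_poly_monom[OF e] poly_monom)
qed

lemma mono_split_var:
  "\<alpha> = Poly_Mapping.update v 0 \<alpha> + Poly_Mapping.single v (Poly_Mapping.lookup \<alpha> v)"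
  for \<alpha> :: "'n mono"
  by (rule poly_mapping_eqI) (auto simp: lookup_add lookup_update lookup_single when_def)

definition pvar :: "'n \<Rightarrow> 'n rpoly" where
  "pvar v = Poly_Mapping.single (Poly_Mapping.single v 1) 1"

lemma pvar_power: "pvar v ^ k = Poly_Mapping.single (Poly_Mapping.single v k) 1"
  by (induction k) (simp_all add: pvar_def mult_single flip: single_add)

lemma single_split_var:
  "Poly_Mapping.single \<alpha> c = Poly_Mapping.single (Poly_Mapping.update v 0 \<alpha>) c * pvar v ^ Poly_Mapping.lookup \<alpha> v"
  by (subst mono_split_var[of \<alpha> v]) (simp add: pvar_power mult_single)

lemma hom_sum_monomials:
  "unital_hom e \<Longrightarrow> e p = (\<Sum>\<alpha>\<in>Poly_Mapping.keys p. e (Poly_Mapping.single \<alpha> (Poly_Mapping.lookup p \<alpha>)))"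
  for p :: "'n rpoly"
  by (subst keys_of_sum_singles[of p]) (rule hom_sum)

text \<open>The substitution of zero for all variables outside \<open>A\<close>. Nothing is known
  about the variables in the test set produced by an elimination step; composing with this
  projection turns it into a set of polynomials in \<open>A\<close>, to which the induction
  hypothesis applies.\<close>

definition keep_vars :: "'n set \<Rightarrow> 'n rpoly \<Rightarrow> 'n rpoly" where
  "keep_vars A = lin_ext (\<lambda>\<alpha> c. if Poly_Mapping.keys \<alpha> \<subseteq> A then Poly_Mapping.single \<alpha> c else 0)"

lemma keep_vars_add: "keep_vars A (p + q) = keep_vars A p + keep_vars A q"
  unfolding keep_vars_def by (rule lin_ext_add) (auto simp: single_add)

lemma keep_vars_single:
  "keep_vars A (Poly_Mapping.single \<alpha> c) = (if Poly_Mapping.keys \<alpha> \<subseteq> A then Poly_Mapping.single \<alpha> c else 0)"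
  unfolding keep_vars_def by (rule lin_ext_single) (auto simp: single_add)

lemma keys_add_mono: "Poly_Mapping.keys (\<alpha> + \<beta>) = Poly_Mapping.keys \<alpha> \<union> Poly_Mapping.keys \<beta>"
  for \<alpha> \<beta> :: "'n mono"
  by (auto simp: in_keys_iff lookup_add)

lemma keep_vars_hom: "unital_hom (keep_vars A)"
proof -
  have "keep_vars A 1 = 1" using keep_vars_single[of A 0 1] by simp
  moreover have "keep_vars A (p * q) = keep_vars A p * keep_vars A q" for p q
    by (rule additive_mult) (auto simp: keep_vars_add keep_vars_single keys_add_mono mult_single)
  ultimately show ?thesis by (simp add: unital_hom_def keep_vars_add)
qed

lemma keys_keep_vars: "\<alpha> \<in> Poly_Mapping.keys (keep_vars A p) \<Longrightarrow> Poly_Mapping.keys \<alpha> \<subseteq> A"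
proof (induction p arbitrary: \<alpha> rule: poly_mapping_add_induct)
  case (single \<beta> c)
  then show ?case by (auto simp: keep_vars_single split: if_splits)
next
  case (add p q)
  then show ?case using Poly_Mapping.keys_add[of "keep_vars A p" "keep_vars A q"] by (auto simp: keep_vars_add)
qed

lemma unital_hom_comp: "unital_hom e \<Longrightarrow> unital_hom s \<Longrightarrow> unital_hom (\<lambda>x. e (s x))"
  by (simp add: unital_hom_def)

text \<open>Positive reals are invertible squares, and ring homomorphisms preserve both properties;
  so signs of real constants are respected automatically.\<close>

lemma hom_const_same_sign:
  fixes e :: "('n::finite) rpoly \<Rightarrow> 'k::real_closed_field"
  assumes e: "unital_hom e"
  shows "same_sign (e (Poly_Mapping.single 0 c)) c"
proof -
  have pos: "e (Poly_Mapping.single 0 c) > 0" if "c > 0" for c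
  proof -
    have "Poly_Mapping.single 0 c = Poly_Mapping.single 0 (sqrt c) * Poly_Mapping.single (0::'n mono) (sqrt c)"
      using that by (simp add: mult_single)
    then have "e (Poly_Mapping.single 0 c) \<ge> 0" by (simp add: hom_mult[OF e])
    moreover have "Poly_Mapping.single 0 c * Poly_Mapping.single (0::'n mono) (1 / c) = 1"
      using that by (simp add: mult_single)
    then have "e (Poly_Mapping.single 0 c) * e (Poly_Mapping.single 0 (1 / c)) = 1"
      by (metis hom_1[OF e] hom_mult[OF e])
    then have "e (Poly_Mapping.single 0 c) \<noteq> 0" by auto
    ultimately show ?thesis by simp
  qed
  have neg: "e (Poly_Mapping.single 0 c) = - e (Poly_Mapping.single 0 (- c))"
    by (simp add: single_uminus hom_uminus[OF e])
  consider "c > 0" | "c < 0" | "c = 0" by linarith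
  then show ?thesis
  proof cases
    case 1
    then show ?thesis using pos[of c] by (simp add: same_sign_def)
  next
    case 2
    then show ?thesis using pos[of "- c"] neg by (simp add: same_sign_def)
  next
    case 3
    then show ?thesis using hom_0[OF e] by (simp add: same_sign_def)
  qed
qed

lemma real_point_with_signs_aux:
  fixes e :: "('n::finite) rpoly \<Rightarrow> 'k::real_closed_field"
  assumes e: "unital_hom e" and "finite A"
  shows "finite F \<Longrightarrow> (\<And>f \<alpha>. f \<in> F \<Longrightarrow> \<alpha> \<in> Poly_Mapping.keys f \<Longrightarrow> Poly_Mapping.keys \<alpha> \<subseteq> A)
    \<Longrightarrow> \<exists>x. \<forall>f\<in>F. same_sign (e f) (peval f x)"
  using assms(2)
proof (induction A arbitrary: F)
  case empty
  have "same_sign (e f) (peval f 0)" if "f \<in> F" for f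
  proof -
    have "Poly_Mapping.keys f \<subseteq> {0}" using empty(2)[OF that] by auto
    then have "f = Poly_Mapping.single 0 (Poly_Mapping.lookup f 0)"
      by (intro poly_mapping_eqI) (auto simp: lookup_single when_def in_keys_iff subset_iff)
    then obtain c where "f = Poly_Mapping.single 0 c" by blast
    then show ?thesis using hom_const_same_sign[OF e] by (simp add: peval_single monom_eval_0)
  qed
  then show ?case by blast
next
  case (insert v A)
  obtain F' where F': "finite F'" "\<And>(e1 :: 'n rpoly \<Rightarrow> 'k) (e2 :: 'n rpoly \<Rightarrow> real).
     unital_hom e1 \<Longrightarrow> unital_hom e2 \<Longrightarrow> signs_agree e1 e2 F' \<Longrightarrow>
       (\<forall>y. \<exists>y'. \<forall>p\<in>split_var v ` F. same_sign (poly (map_poly e1 p) y) (poly (map_poly e2 p) y'))"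
    using real_closed_transfer_step[of "split_var v ` F"] insert.prems(1) by blast
  have "\<exists>x. \<forall>f\<in>keep_vars A ` F'. same_sign (e f) (peval f x)"
    by (rule insert.IH) (use F'(1) keys_keep_vars in auto)
  then obtain x where x: "\<And>f. f \<in> F' \<Longrightarrow> same_sign (e (keep_vars A f)) (peval (keep_vars A f) x)" by blast
  \<comment> \<open>The projection leaves the coefficients of each \<open>split_var v f\<close>
    unchanged, so both composed homomorphisms still see the true coefficients. The position of
    \<open>e (pvar v)\<close> is copied to a real number \<open>y'\<close>, the new coordinate
    \<open>v\<close>.\<close>
  let ?e1 = "\<lambda>p. e (keep_vars A p)" and ?e2 = "\<lambda>p. peval (keep_vars A p) x"
  have h: "unital_hom ?e1" "unital_hom ?e2"
    by (rule unital_hom_comp[OF e keep_vars_hom], rule unital_hom_comp[OF peval_hom keep_vars_hom])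
  have "signs_agree ?e1 ?e2 F'" using x by (simp add: signs_agree_def)
  from F'(2)[OF h this] obtain y' where y':
    "\<And>f. f \<in> F \<Longrightarrow> same_sign (poly (map_poly ?e1 (split_var v f)) (e (pvar v))) (poly (map_poly ?e2 (split_var v f)) y')"
    by (metis image_eqI)
  define x' where "x' = (\<chi> i. if i = v then y' else x $ i)"
  have keep: "keep_vars A (Poly_Mapping.single (Poly_Mapping.update v 0 \<alpha>) c) = Poly_Mapping.single (Poly_Mapping.update v 0 \<alpha>) c"
    if "f \<in> F" "\<alpha> \<in> Poly_Mapping.keys f" for f \<alpha> c
    using insert.prems(2)[OF that] by (auto simp: keep_vars_single keys_update)
  have mono: "monom_eval \<alpha> x' = monom_eval (Poly_Mapping.update v 0 \<alpha>) x * y' ^ Poly_Mapping.lookup \<alpha> v" for \<alpha>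
  proof -
    have "(\<Prod>i\<in>UNIV - {v}. (x' $ i) ^ Poly_Mapping.lookup \<alpha> i) = (\<Prod>i\<in>UNIV - {v}. (x $ i) ^ Poly_Mapping.lookup (Poly_Mapping.update v 0 \<alpha>) i)"
      by (rule prod.cong) (auto simp: x'_def lookup_update)
    then show ?thesis
      unfolding monom_eval_def by (simp add: prod.remove[of UNIV v] lookup_update x'_def)
  qed
  have "same_sign (e f) (peval f x')" if f: "f \<in> F" for f
  proof -
    have "e f = poly (map_poly ?e1 (split_var v f)) (e (pvar v))"
      unfolding poly_split_var[OF h(1)] hom_sum_monomials[OF e, of f]
    proof (rule sum.cong[OF refl])
      fix \<alpha> assume "\<alpha> \<in> Poly_Mapping.keys f"
      then show "e (Poly_Mapping.single \<alpha> (Poly_Mapping.lookup f \<alpha>)) =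
         e (keep_vars A (Poly_Mapping.single (Poly_Mapping.update v 0 \<alpha>) (Poly_Mapping.lookup f \<alpha>))) * e (pvar v) ^ Poly_Mapping.lookup \<alpha> v"
        unfolding keep[OF f \<open>\<alpha> \<in> _\<close>]
        by (subst single_split_var[of \<alpha> _ v]) (simp add: hom_mult[OF e] hom_power[OF e])
    qed
    moreover have "peval f x' = poly (map_poly ?e2 (split_var v f)) y'"
      unfolding poly_split_var[OF h(2)] peval_def[of f]
      by (rule sum.cong[OF refl]) (simp add: keep[OF f] peval_single mono)
    ultimately show ?thesis using y'[OF f] by simp
  qed
  then show ?case by blast
qed

corollary real_point_with_signs:
  fixes e :: "('n::finite) rpoly \<Rightarrow> 'k::real_closed_field"
  assumes "unital_hom e" "finite F"
  shows "\<exists>x. \<forall>f\<in>F. same_sign (e f) (peval f x)"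
  using real_point_with_signs_aux[OF assms(1) finite[of UNIV] assms(2)] by blast

text \<open>The tautological point of the critical cone, over the real closure of the fraction field
  of the residue ring: nonnegativity there is membership in the cone.\<close>

definition residue_point :: "('n::finite) rpoly \<Rightarrow> 'n residue fract real_closure" where
  "residue_point p = to_rc (Fract (residue_class p) 1)"

lemma to_rc_nonneg_iff: "0 \<le> to_rc x \<longleftrightarrow> 0 \<le> x"
proof
  assume *: "0 \<le> to_rc x"
  show "0 \<le> x"
  proof (rule ccontr)
    assume "\<not> 0 \<le> x"
    then have "0 \<le> to_rc (- x)" by (intro to_rc_nonneg) simp
    moreover have "to_rc (- x) + to_rc x = 0" unfolding to_rc_hom(2)[symmetric] by (simp, transfer, simp)
    ultimately have "to_rc x = 0" using * by (metis add.commute add_nonneg_eq_0_iff)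
    then have "to_rc x = to_rc 0" by (metis add_cancel_right_right to_rc_hom(2))
    then show False using \<open>\<not> 0 \<le> x\<close> by (simp add: to_rc_inj)
  qed
qed (rule to_rc_nonneg)

lemma residue_point_hom: "unital_hom residue_point"
  unfolding unital_hom_def residue_point_def
  by (simp add: to_rc_hom(1) flip: One_fract_def to_rc_hom(2,3) one_residue.abs_eq plus_residue.abs_eq times_residue.abs_eq)

lemma residue_point_nonneg: "0 \<le> residue_point p \<longleftrightarrow> p \<in> critical_cone"
proof -
  have "0 \<le> residue_point p \<longleftrightarrow> 0 \<le> residue_class p"
    unfolding residue_point_def to_rc_nonneg_iff by (simp add: Fraction_Field.zero_le_Fract_iff)
  also have "\<dots> \<longleftrightarrow> p \<in> critical_cone"
    unfolding zero_residue.abs_eq less_eq_residue.abs_eq by simp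
  finally show ?thesis .
qed

theorem Artin_Lang:
  assumes "prime_cone (P :: ('n::finite) rpoly set)" shows "sign_realizable P"
proof (rule critical_cone(2)[OF _ assms])
  show "sign_realizable (critical_cone :: 'n rpoly set)"
    unfolding sign_realizable_def
  proof (intro allI impI)
    fix F :: "'n rpoly set" assume "finite F"
    then obtain x where x: "\<And>f. f \<in> F \<Longrightarrow> same_sign (residue_point f) (peval f x)"
      using real_point_with_signs[OF residue_point_hom] by blast
    have "f \<in> critical_cone \<longleftrightarrow> 0 \<le> peval f x" if "f \<in> F" for f
      using x[OF that] unfolding residue_point_nonneg[symmetric] same_sign_def by auto
    then show "\<exists>x. \<forall>f\<in>F. f \<in> critical_cone \<longleftrightarrow> 0 \<le> peval f x" by blast
  qed
qed

section \<open>Preorderings and the real Nullstellensatz\<close>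

definition preordering :: "'r::comm_ring_1 set \<Rightarrow> bool" where
  "preordering T \<longleftrightarrow> (\<forall>x\<in>T. \<forall>y\<in>T. x + y \<in> T) \<and> (\<forall>x\<in>T. \<forall>y\<in>T. x * y \<in> T) \<and> (\<forall>x. x * x \<in> T)"

context
  fixes T :: "'r::comm_ring_1 set"
  assumes T: "preordering T"
begin

lemma po_add: "x \<in> T \<Longrightarrow> y \<in> T \<Longrightarrow> x + y \<in> T" and po_mult: "x \<in> T \<Longrightarrow> y \<in> T \<Longrightarrow> x * y \<in> T"
  and po_square: "x * x \<in> T"
  using T by (simp_all add: preordering_def)

lemma po_0: "0 \<in> T" and po_1: "1 \<in> T"
  using po_square[of 0] po_square[of 1] by simp_all

lemma po_square_power: "(p * p) ^ m \<in> T"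
  using po_square[of "p ^ m"] by (simp add: power_mult_distrib)

lemma po_adjoin: "preordering {a + x * b | a b. a \<in> T \<and> b \<in> T}"
  unfolding preordering_def
proof (intro conjI ballI allI)
  let ?T = "{a + x * b | a b. a \<in> T \<and> b \<in> T}"
  have TI: "y \<in> ?T" if "y = a + x * b" "a \<in> T" "b \<in> T" for y a b using that by blast
  show "y * y \<in> ?T" for y by (rule TI[of _ "y * y" 0]) (auto intro: po_square po_0)
  fix y z assume yz: "y \<in> ?T" "z \<in> ?T"
  then obtain a b c d where *: "y = a + x * b" "z = c + x * d" "a \<in> T" "b \<in> T" "c \<in> T" "d \<in> T"
    by blast
  show "y + z \<in> ?T" by (rule TI[of _ "a + c" "b + d"]) (use * in \<open>auto simp: algebra_simps intro: po_add\<close>)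
  have "y * z = (a * c + (x * x) * (b * d)) + x * (a * d + b * c)" unfolding * by (simp add: algebra_simps)
  then show "y * z \<in> ?T" by (rule TI) (use * po_square[of x] in \<open>auto intro!: po_add intro: po_mult\<close>)
qed

end

text \<open>A preordering \<open>M\<close> maximal among those missing all \<open>- (q ^ m)\<close>
  is a prime cone: adjoining an element outside \<open>M\<close> produces such a power, and
  multiplying the representations obtained from two failures of totality or primality would put
  another one into \<open>M\<close>. Avoiding all powers, and not only \<open>- 1\<close>, keeps
  \<open>p\<close> out of the support.\<close>

theorem prime_cone_extension:
  fixes T :: "'r::comm_ring_1 set"
  assumes "preordering T" "\<And>m. - ((p * p) ^ m) \<notin> T"
  shows "\<exists>P. prime_cone P \<and> T \<subseteq> P \<and> \<not> (p \<in> P \<and> - p \<in> P)"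
proof -
  define q where "q = p * p"
  let ?A = "{S. preordering S \<and> T \<subseteq> S \<and> (\<forall>m. - (q ^ m) \<notin> S)}"
  have "\<exists>M\<in>?A. \<forall>S\<in>?A. M \<subseteq> S \<longrightarrow> S = M"
  proof (rule subset_Zorn_nonempty)
    show "?A \<noteq> {}" using assms by (auto simp: q_def)
    fix C assume C: "C \<noteq> {}" "subset.chain ?A C"
    have dir: "\<exists>S\<in>C. x \<in> S \<and> y \<in> S" if "x \<in> \<Union>C" "y \<in> \<Union>C" for x y
      using that C(2) unfolding subset.chain_def by blast
    have po: "preordering S" if "S \<in> C" for S using C(2) that by (auto simp: subset.chain_def)
    have "preordering (\<Union>C)" unfolding preordering_def
    proof (intro conjI ballI allI)
      fix x y assume "x \<in> \<Union>C" "y \<in> \<Union>C"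
      then obtain S where S: "S \<in> C" "x \<in> S" "y \<in> S" using dir by blast
      show "x + y \<in> \<Union>C" using S po_add[OF po[OF S(1)] S(2,3)] by blast
      show "x * y \<in> \<Union>C" using S po_mult[OF po[OF S(1)] S(2,3)] by blast
    next
      fix x
      obtain S where S: "S \<in> C" using C(1) by blast
      show "x * x \<in> \<Union>C" using S po_square[OF po[OF S]] by blast
    qed
    moreover have "T \<subseteq> \<Union>C" using C unfolding subset.chain_def by blast
    moreover have "- (q ^ m) \<notin> \<Union>C" for m using C(2) unfolding subset.chain_def by blast
    ultimately show "\<Union>C \<in> ?A" by blast
  qed
  then obtain M where MA: "M \<in> ?A" and max: "\<forall>S\<in>?A. M \<subseteq> S \<longrightarrow> S = M" by (rule bexE)
  have M: "preordering M" and TM: "T \<subseteq> M" and nq: "\<And>m. - (q ^ m) \<notin> M" using MA by auto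
  have qM: "q ^ m \<in> M" for m unfolding q_def by (rule po_square_power[OF M])
  have ext: "\<exists>m a b. a \<in> M \<and> b \<in> M \<and> - (q ^ m) = a + x * b" if "x \<notin> M" for x
  proof (rule ccontr)
    assume no: "\<not> ?thesis"
    let ?T = "{a + x * b | a b. a \<in> M \<and> b \<in> M}"
    have sub: "M \<subseteq> ?T"
    proof
      fix a assume "a \<in> M"
      moreover have "a = a + x * 0" by simp
      ultimately show "a \<in> ?T" using po_0[OF M] by blast
    qed
    have "?T \<in> ?A" using po_adjoin[OF M, of x] order_trans[OF TM sub] no by blast
    then have "?T = M" using max sub by blast
    moreover have "x = 0 + x * 1" by simp
    then have "x \<in> ?T" using po_0[OF M] po_1[OF M] by blast
    ultimately show False using that by simp
  qed
  have tot: "x \<in> M \<or> - x \<in> M" for x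
  proof (rule ccontr)
    assume "\<not> ?thesis"
    then obtain m a b k c d where *: "a \<in> M" "b \<in> M" "- (q ^ m) = a + x * b"
      "c \<in> M" "d \<in> M" "- (q ^ k) = c + - x * d" using ext[of x] ext[of "- x"] by blast
    have 1: "x * b = - (q ^ m) - a" "- x * d = - (q ^ k) - c" using *(3,6) by (simp_all add: algebra_simps)
    have "(x * x) * (b * d) = - ((x * b) * (- x * d))" by (simp add: algebra_simps)
    also have "\<dots> = - (q ^ (m + k)) - (q ^ m * c + a * q ^ k + a * c)"
      unfolding 1 by (simp add: algebra_simps power_add)
    finally have "- (q ^ (m + k)) = (x * x) * (b * d) + (q ^ m * c + a * q ^ k + a * c)" by simp
    also have "\<dots> \<in> M" by (intro po_add[OF M] po_mult[OF M _ ] po_square[OF M] qM *)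
    finally show False using nq by blast
  qed
  have prime: "(x \<in> M \<and> - x \<in> M) \<or> (y \<in> M \<and> - y \<in> M)" if xy: "x * y \<in> M" "- (x * y) \<in> M" for x y
  proof (rule ccontr)
    assume "\<not> ?thesis"
    \<comment> \<open>Signs are adjusted so that both factors lie outside \<open>M\<close>. This
      does no harm to the product, since it lies in \<open>M\<close> with either sign.\<close>
    then obtain x' y' where x': "x' \<notin> M" "y' \<notin> M" and "x' = x \<or> x' = - x" "y' = y \<or> y' = - y" by blast
    then have xy': "- (x' * y') \<in> M" using xy by auto
    obtain m a b where 1: "a \<in> M" "b \<in> M" "- (q ^ m) = a + x' * b" using ext[OF x'(1)] by blast
    obtain k c d where 2: "c \<in> M" "d \<in> M" "- (q ^ k) = c + y' * d" using ext[OF x'(2)] by blast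
    have e: "x' * b = - (q ^ m) - a" "y' * d = - (q ^ k) - c" using 1 2 by (simp_all add: algebra_simps)
    have "- (x' * y') * (b * d) = - ((x' * b) * (y' * d))" by (simp add: algebra_simps)
    also have "\<dots> = - (q ^ (m + k)) - (q ^ m * c + a * q ^ k + a * c)"
      unfolding e by (simp add: algebra_simps power_add)
    finally have "- (q ^ (m + k)) = - (x' * y') * (b * d) + (q ^ m * c + a * q ^ k + a * c)" by simp
    also have "\<dots> \<in> M" by (intro po_add[OF M] po_mult[OF M] qM 1 2 xy')
    finally show False using nq by blast
  qed
  have "prime_cone M" unfolding prime_cone_def
    using po_add[OF M] po_mult[OF M] tot prime nq[of 0] by auto
  moreover have "\<not> (p \<in> M \<and> - p \<in> M)"
  proof
    assume "p \<in> M \<and> - p \<in> M"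
    then have "p * - p \<in> M" using po_mult[OF M] by blast
    then show False using nq[of 1] by (simp add: q_def)
  qed
  ultimately show ?thesis using TM by blast
qed

lemma sum_list_squares_mult:
  "\<exists>rs. sum_list (map (\<lambda>q. q * q) ps) * sum_list (map (\<lambda>q. q * q) qs) = sum_list (map (\<lambda>q. q * q) rs)"
  for ps qs :: "'r::comm_ring_1 list"
proof (induction ps)
  case Nil
  show ?case by (intro exI[of _ "[]"]) simp
next
  case (Cons p ps)
  then obtain rs where rs: "sum_list (map (\<lambda>q. q * q) ps) * sum_list (map (\<lambda>q. q * q) qs) = sum_list (map (\<lambda>q. q * q) rs)" by blast
  have "p * p * sum_list (map (\<lambda>q. q * q) qs) = sum_list (map (\<lambda>q. q * q) (map ((*) p) qs))"
    by (induction qs) (simp_all add: algebra_simps)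
  then show ?case using rs by (intro exI[of _ "map ((*) p) qs @ rs"]) (simp add: distrib_right)
qed

lemma sos_0: "0 \<in> sos"
  unfolding sos_def by (rule CollectI, rule exI[of _ "[]"]) simp

lemma sos_square: "q * q \<in> sos"
  unfolding sos_def by (rule CollectI, rule exI[of _ "[q]"]) simp

lemma sos_add: "p \<in> sos \<Longrightarrow> q \<in> sos \<Longrightarrow> p + q \<in> sos"
proof -
  assume "p \<in> sos" "q \<in> sos"
  then obtain ps qs where "p = sum_list (map (\<lambda>q. q * q) ps)" "q = sum_list (map (\<lambda>q. q * q) qs)"
    by (auto simp: sos_def)
  then have "p + q = sum_list (map (\<lambda>q. q * q) (ps @ qs))" by simp
  then show ?thesis unfolding sos_def by blast
qed

lemma sos_mult: "p \<in> sos \<Longrightarrow> q \<in> sos \<Longrightarrow> p * q \<in> sos"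
  using sum_list_squares_mult unfolding sos_def by (auto; metis)

lemma pidealI: "finite F \<Longrightarrow> F \<subseteq> B \<Longrightarrow> p = (\<Sum>b\<in>F. c b * b) \<Longrightarrow> p \<in> pideal B"
  unfolding pideal_def by blast

lemma pideal_0: "0 \<in> pideal B"
  unfolding pideal_def by (rule CollectI, rule exI[of _ "{}"]) simp

lemma pideal_generator: "b \<in> B \<Longrightarrow> c * b \<in> pideal B"
  unfolding pideal_def by (rule CollectI, rule exI[of _ "{b}"]) auto

lemma pideal_add: "p \<in> pideal B \<Longrightarrow> q \<in> pideal B \<Longrightarrow> p + q \<in> pideal B"
proof -
  assume "p \<in> pideal B" "q \<in> pideal B"
  then obtain F c G d where *: "finite F" "F \<subseteq> B" "p = (\<Sum>b\<in>F. c b * b)" "finite G" "G \<subseteq> B" "q = (\<Sum>b\<in>G. d b * b)"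
    unfolding pideal_def by blast
  have "p = (\<Sum>b\<in>F \<union> G. (if b \<in> F then c b else 0) * b)" "q = (\<Sum>b\<in>F \<union> G. (if b \<in> G then d b else 0) * b)"
    using * by (auto intro!: sum.mono_neutral_cong_left)
  then have "p + q = (\<Sum>b\<in>F \<union> G. ((if b \<in> F then c b else 0) + (if b \<in> G then d b else 0)) * b)"
    by (simp only: distrib_right sum.distrib)
  then show ?thesis by (rule pidealI[rotated 2]) (use * in auto)
qed

lemma pideal_mult: "p \<in> pideal B \<Longrightarrow> r * p \<in> pideal B"
proof -
  assume "p \<in> pideal B"
  then obtain F c where *: "finite F" "F \<subseteq> B" "p = (\<Sum>b\<in>F. c b * b)" unfolding pideal_def by blast
  then have "r * p = (\<Sum>b\<in>F. (r * c b) * b)" by (simp add: sum_distrib_left mult.assoc)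
  then show ?thesis by (rule pidealI[OF *(1,2)])
qed

text \<open>Without such an identity, sums of squares plus the ideal form a preordering that misses
  all \<open>- ((p * p) ^ m)\<close>. A prime cone above it contains \<open>b\<close> and
  \<open>- b\<close> for every \<open>b\<close> in \<open>B\<close>, but not both \<open>p\<close>
  and \<open>- p\<close>; a real point with these signs is a zero of \<open>B\<close> where
  \<open>p\<close> does not vanish.\<close>

theorem real_Nullstellensatz:
  fixes B :: "('n::finite) rpoly set"
  assumes fin: "finite B" and van: "\<And>x. (\<And>b. b \<in> B \<Longrightarrow> peval b x = 0) \<Longrightarrow> peval p x = 0"
  shows "\<exists>m s. s \<in> sos \<and> (p * p) ^ m + s \<in> pideal B"
proof (rule ccontr)
  assume no: "\<not> ?thesis"
  define T where "T = {s + i | s i. s \<in> sos \<and> i \<in> pideal B}"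
  have TI: "y \<in> T" if "y = s + i" "s \<in> sos" "i \<in> pideal B" for y s i using that unfolding T_def by blast
  have "preordering T" unfolding preordering_def
  proof (intro conjI ballI allI)
    show "y * y \<in> T" for y by (rule TI[of _ "y * y" 0]) (auto intro: sos_square pideal_0)
    fix y z assume "y \<in> T" "z \<in> T"
    then obtain s i t j where *: "y = s + i" "z = t + j" "s \<in> sos" "i \<in> pideal B" "t \<in> sos" "j \<in> pideal B"
      unfolding T_def by blast
    show "y + z \<in> T" by (rule TI[of _ "s + t" "i + j"]) (use * in \<open>auto intro: sos_add pideal_add\<close>)
    have "y * z = s * t + ((s * j + t * i) + i * j)" unfolding * by (simp add: algebra_simps)
    then show "y * z \<in> T" by (rule TI) (use * in \<open>auto intro!: sos_mult pideal_add pideal_mult\<close>)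
  qed
  moreover have "- ((p * p) ^ m) \<notin> T" for m
  proof
    assume "- ((p * p) ^ m) \<in> T"
    then obtain s i where si: "- ((p * p) ^ m) = s + i" "s \<in> sos" "i \<in> pideal B" unfolding T_def by blast
    then have "(p * p) ^ m = - (s + i)" by (metis minus_minus)
    then have "(p * p) ^ m + s = - 1 * i" by simp
    then show False using no si pideal_mult by metis
  qed
  ultimately obtain P where P: "prime_cone P" "T \<subseteq> P" "\<not> (p \<in> P \<and> - p \<in> P)"
    using prime_cone_extension by blast
  have "finite (B \<union> uminus ` B \<union> {p, - p})" using fin by simp
  from Artin_Lang[OF P(1), unfolded sign_realizable_def, rule_format, OF this]
  obtain x where "\<forall>f\<in>B \<union> uminus ` B \<union> {p, - p}. f \<in> P \<longleftrightarrow> 0 \<le> peval f x" by (rule exE)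
  then have x: "\<And>f. f \<in> B \<union> uminus ` B \<union> {p, - p} \<Longrightarrow> f \<in> P \<longleftrightarrow> 0 \<le> peval f x" by (rule bspec)
  have "peval b x = 0" if b: "b \<in> B" for b
  proof -
    have "1 * b \<in> pideal B" "(- 1) * b \<in> pideal B" by (rule pideal_generator[OF b])+
    then have "b \<in> T" "- b \<in> T" using sos_0 by (auto intro: TI[of _ 0])
    then have "0 \<le> peval b x" "0 \<le> peval (- b) x" using x[of b] x[of "- b"] b P(2) by auto
    then show ?thesis by (simp add: peval_uminus)
  qed
  then have "peval p x = 0" by (rule van)
  then show False using x[of p] x[of "- p"] P(3) by (simp add: peval_uminus)
qed

section \<open>Truncated moment functionals\<close>

lemma mdeg_eq: "mdeg \<alpha> = (\<Sum>i\<in>UNIV. Poly_Mapping.lookup \<alpha> i)" for \<alpha> :: "('n::finite) mono"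
  unfolding mdeg_def by (rule sum.mono_neutral_left) (auto simp: in_keys_iff)

lemma mdeg_add: "mdeg (\<alpha> + \<beta>) = mdeg \<alpha> + mdeg \<beta>" for \<alpha> :: "('n::finite) mono"
  by (simp add: mdeg_eq lookup_add sum.distrib)

lemma tdeg_le_iff: "tdeg p \<le> t \<longleftrightarrow> (\<forall>\<alpha>\<in>Poly_Mapping.keys p. mdeg \<alpha> \<le> t)"
  by (auto simp: tdeg_def)

lemma mdeg_le_tdeg: "\<alpha> \<in> Poly_Mapping.keys p \<Longrightarrow> mdeg \<alpha> \<le> tdeg p"
  using tdeg_le_iff[of p "tdeg p"] by simp

lemma tdeg_add_le: "tdeg p \<le> t \<Longrightarrow> tdeg q \<le> t \<Longrightarrow> tdeg (p + q) \<le> t"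
  unfolding tdeg_le_iff using Poly_Mapping.keys_add[of p q] by blast

lemma tdeg_uminus: "tdeg (- p) = tdeg p"
  by (simp add: tdeg_def)

lemma tdeg_diff_le: "tdeg p \<le> t \<Longrightarrow> tdeg q \<le> t \<Longrightarrow> tdeg (p - q) \<le> t"
  using tdeg_add_le[of p t "- q"] by (simp add: tdeg_uminus)

lemma tdeg_mult_le: "tdeg (p * q) \<le> tdeg p + tdeg q" for p :: "('n::finite) rpoly"
  unfolding tdeg_le_iff
proof
  fix \<alpha> assume "\<alpha> \<in> Poly_Mapping.keys (p * q)"
  then obtain a b where "\<alpha> = a + b" "a \<in> Poly_Mapping.keys p" "b \<in> Poly_Mapping.keys q"
    using keys_mult[of p q] by blast
  then show "mdeg \<alpha> \<le> tdeg p + tdeg q" using mdeg_le_tdeg[of a p] mdeg_le_tdeg[of b q] by (simp add: mdeg_add)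
qed

lemma tdeg_single_0: "tdeg (Poly_Mapping.single 0 c) = 0"
  using tdeg_le_iff[of "Poly_Mapping.single 0 c" 0] by (auto simp: mdeg_def split: if_splits)

lemma tdeg_power_le: "tdeg (p ^ n) \<le> n * tdeg p" for p :: "('n::finite) rpoly"
proof (induction n)
  case 0
  show ?case using tdeg_single_0[of 1] by simp
next
  case (Suc n)
  then show ?case using tdeg_mult_le[of p "p ^ n"] by simp
qed

lemma apply_fun_scale: "apply_fun y (Poly_Mapping.single 0 c * p) = c * apply_fun y p"
  by (induction p rule: poly_mapping_add_induct)
    (simp_all add: mult_single apply_fun_single apply_fun_add distrib_left)

lemma set_pm_family: "set (pm_family g h) = set g \<union> set h \<union> uminus ` set h"
  by (auto simp: pm_family_def)

lemma square_difference:
  fixes c :: "'n rpoly"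
  defines "u \<equiv> Poly_Mapping.single 0 (1/2) * (c + 1)" and "v \<equiv> Poly_Mapping.single 0 (1/2) * (c - 1)"
  shows "c = u * u - v * v"
proof -
  have half: "Poly_Mapping.single 0 (1/2) * x + Poly_Mapping.single 0 (1/2) * x = x" for x :: "'n rpoly"
    unfolding distrib_right[symmetric] single_add[symmetric] by simp
  have "u * u - v * v = (u + v) * (u - v)" by (simp add: algebra_simps)
  also have "u + v = c" unfolding u_def v_def using half[of c] by (simp add: algebra_simps)
  also have "u - v = 1" unfolding u_def v_def using half[of 1] by (simp add: algebra_simps)
  finally show ?thesis by simp
qed

context
  fixes t :: nat and G :: "('n::finite) rpoly list" and y :: "'n mono \<Rightarrow> real"
  assumes y: "y \<in> Lt1 t G"
begin

lemma Lt1_nonneg: "q \<in> qmod_t t G \<Longrightarrow> 0 \<le> apply_fun y q"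
  using y by (simp add: Lt1_def Lt_def)

lemma Lt1_one: "apply_fun y 1 = 1"
  using y by (simp add: Lt1_def)

lemma Lt1_sos: "s \<in> sos \<Longrightarrow> tdeg s \<le> t \<Longrightarrow> 0 \<le> apply_fun y s"
  by (rule Lt1_nonneg, unfold qmod_t_def, rule CollectI, rule exI[of _ s], rule exI[of _ "\<lambda>_. 0"])
    (simp add: sos_le_def polys_le_def sos_0)

lemma Lt1_square: "2 * tdeg p \<le> t \<Longrightarrow> 0 \<le> apply_fun y (p * p)"
  using tdeg_mult_le[of p p] by (intro Lt1_sos sos_square) simp

lemma Lt1_mult:
  assumes "q \<in> set G" "s \<in> sos" "tdeg s + tdeg q \<le> t"
  shows "0 \<le> apply_fun y (s * q)"
proof -
  obtain i where i: "i < length G" "q = G ! i" using assms(1) by (metis in_set_conv_nth)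
  have "s * q = 0 + (\<Sum>j<length G. (if j = i then s else 0) * G ! j)"
    using i by (simp add: if_distrib[of "\<lambda>x. x * _"] sum.delta cong: if_cong)
  then have "s * q \<in> qmod_t t G"
    unfolding qmod_t_def using assms i
    by (intro CollectI exI[of _ 0] exI[of _ "\<lambda>j. if j = i then s else 0"])
       (auto simp: sos_le_def polys_le_def sos_0 tdeg_def[of 0])
  then show ?thesis by (rule Lt1_nonneg)
qed

text \<open>With \<open>b\<close> and \<open>- b\<close> both constraints, \<open>b\<close> times a
  square has value zero, and any multiplier \<open>c\<close> is a difference of two squares. The
  roots of these squares have the degree of \<open>c\<close>, whence the factor 2 in the degree
  condition.\<close>

lemma Lt1_pm_zero:
  assumes "b \<in> set G" "- b \<in> set G" "2 * tdeg c + tdeg b \<le> t"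
  shows "apply_fun y (c * b) = 0"
proof -
  let ?h = "Poly_Mapping.single 0 (1/2) :: 'n rpoly"
  define u where "u = ?h * (c + 1)"
  define v where "v = ?h * (c - 1)"
  have c: "c = u * u - v * v" unfolding u_def v_def by (rule square_difference)
  have one: "tdeg (1 :: 'n rpoly) = 0" using tdeg_single_0[of 1] by simp
  have "tdeg (c + 1) \<le> tdeg c" "tdeg (c - 1) \<le> tdeg c"
    by (auto intro!: tdeg_add_le tdeg_diff_le simp: one)
  then have d: "tdeg u \<le> tdeg c" "tdeg v \<le> tdeg c"
    using tdeg_mult_le[of ?h "c + 1"] tdeg_mult_le[of ?h "c - 1"] by (auto simp: u_def v_def tdeg_single_0)
  have z: "apply_fun y (w * w * b) = 0" if "tdeg w \<le> tdeg c" for w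
  proof -
    have "tdeg (w * w) + tdeg b \<le> t" using tdeg_mult_le[of w w] that assms(3) by simp
    then have "0 \<le> apply_fun y (w * w * b)" "0 \<le> apply_fun y (w * w * - b)"
      using assms by (auto intro!: Lt1_mult[OF _ sos_square] simp: tdeg_uminus simp del: mult_minus_right)
    then show ?thesis by (simp add: apply_fun_uminus)
  qed
  have "c * b = u * u * b - v * v * b" by (subst c) (simp add: left_diff_distrib)
  then show ?thesis using z[OF d(1)] z[OF d(2)] by (simp add: apply_fun_diff)
qed

text \<open>Nonnegativity of the variance: the square of \<open>p\<close> minus its mean is
  expanded.\<close>

lemma Lt1_Cauchy_Schwarz:
  assumes "2 * tdeg p \<le> t"
  shows "(apply_fun y p)\<^sup>2 \<le> apply_fun y (p * p)"
proof -
  define c where "c = apply_fun y p"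
  let ?c = "Poly_Mapping.single 0 c :: 'n rpoly"
  have "tdeg (p - ?c) \<le> tdeg p" by (rule tdeg_diff_le) (auto simp: tdeg_single_0)
  then have "0 \<le> apply_fun y ((p - ?c) * (p - ?c))" using assms by (intro Lt1_square) simp
  also have "(p - ?c) * (p - ?c) = p * p - ?c * p - ?c * p + ?c * ?c * 1" by (simp add: algebra_simps)
  also have "apply_fun y \<dots> = apply_fun y (p * p) - c * c - c * c + c * c"
    unfolding apply_fun_add apply_fun_diff apply_fun_scale mult.assoc
    using Lt1_one by (simp add: apply_fun_scale c_def)
  finally show ?thesis by (simp add: c_def power2_eq_square)
qed

end

section \<open>From vanishing on the variety to atomic representations\<close>

text \<open>The bound on \<open>d\<close> depends on one chosen representation of \<open>p\<close>
  in the ideal and therefore serves all functionals at once.\<close>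

lemma eventually_vanish_on_ideal:
  fixes g h :: "('n::finite) rpoly list"
  assumes "p \<in> pideal (set h)"
  shows "\<forall>\<^sub>F d in sequentially. \<forall>y\<in>Lt1 (2 * d) (pm_family g h). apply_fun y p = 0"
proof -
  obtain F c where F: "finite F" "F \<subseteq> set h" "p = (\<Sum>b\<in>F. c b * b)"
    using assms unfolding pideal_def by blast
  have "\<forall>\<^sub>F d in sequentially. \<forall>b\<in>F. tdeg (c b) + tdeg b \<le> d"
    by (rule eventually_ball_finite[OF F(1)]) (simp add: eventually_ge_at_top)
  then show ?thesis
  proof eventually_elim
    case (elim d)
    show ?case
    proof
      fix y assume y: "y \<in> Lt1 (2 * d) (pm_family g h)"
      have "apply_fun y (c b * b) = 0" if "b \<in> F" for b
        by (rule Lt1_pm_zero[OF y]) (use F that elim in \<open>auto simp: set_pm_family\<close>)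
      then show "apply_fun y p = 0" by (simp add: F(3) apply_fun_sum)
    qed
  qed
qed

text \<open>In the certificate, an even power of \<open>p\<close> and a sum of squares have
  nonnegative values adding up to zero, so the power has value zero. Cauchy--Schwarz then halves the
  exponent repeatedly.\<close>

lemma eventually_vanish_on_variety:
  fixes g h :: "('n::finite) rpoly list"
  assumes "\<And>x. (\<And>b. b \<in> set h \<Longrightarrow> peval b x = 0) \<Longrightarrow> peval p x = 0"
  shows "\<forall>\<^sub>F d in sequentially. \<forall>y\<in>Lt1 (2 * d) (pm_family g h). apply_fun y p = 0"
proof -
  obtain m s where ms: "s \<in> sos" "(p * p) ^ m + s \<in> pideal (set h)"
    using real_Nullstellensatz[of "set h" p] assms by blast
  \<comment> \<open>Multiplying the certificate by \<open>p ^ k * p ^ k\<close> raises the exponent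
    from \<open>2 * m\<close> to the power of two \<open>2 ^ Suc m\<close>, so that repeated halving
    ends exactly at \<open>p\<close>.\<close>
  define k where "k = 2 ^ m - m"
  have "m \<le> 2 ^ m" using less_exp[of m] by (rule less_imp_le)
  then have mk: "m + k = 2 ^ m" by (simp add: k_def)
  define s' where "s' = p ^ k * p ^ k * s"
  have s': "s' \<in> sos" unfolding s'_def by (intro sos_mult sos_square ms)
  have "(p * p) ^ m * (p ^ k * p ^ k) = p ^ (m + m + (k + k))"
    by (simp only: power_mult_distrib power_add)
  also have "m + m + (k + k) = 2 ^ Suc m" using mk by simp
  finally have pe: "(p * p) ^ m * (p ^ k * p ^ k) = p ^ (2 ^ Suc m)" .
  have "p ^ (2 ^ Suc m) + s' = p ^ k * p ^ k * ((p * p) ^ m + s)"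
    unfolding pe[symmetric] s'_def by (simp add: algebra_simps)
  then have id: "p ^ (2 ^ Suc m) + s' \<in> pideal (set h)" using ms(2) pideal_mult by metis
  have "\<forall>\<^sub>F d in sequentially. tdeg s' \<le> d \<and> 2 ^ Suc m * tdeg p \<le> d"
    by (intro eventually_conj eventually_ge_at_top)
  with eventually_vanish_on_ideal[OF id, of g] show ?thesis
  proof eventually_elim
    case (elim d)
    show ?case
    proof
      fix y assume y: "y \<in> Lt1 (2 * d) (pm_family g h)"
      have sq: "p ^ (2 ^ Suc m) = p ^ (2 ^ m) * p ^ (2 ^ m)" by (simp add: mult_2 flip: power_add)
      have "apply_fun y (p ^ (2 ^ Suc m)) + apply_fun y s' = 0"
        using elim y by (simp add: apply_fun_add)
      moreover have "0 \<le> apply_fun y s'" using Lt1_sos[OF y s'] elim by simp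
      moreover have "tdeg (p ^ (2 ^ Suc m)) \<le> 2 * d" using tdeg_power_le[of p "2 ^ Suc m"] elim by linarith
      then have "0 \<le> apply_fun y (p ^ (2 ^ Suc m))" unfolding sq by (intro Lt1_sos[OF y] sos_square)
      ultimately have top: "apply_fun y (p ^ (2 ^ Suc m)) = 0" by simp
      have "apply_fun y (p ^ (2 ^ j)) = 0" if "j \<le> Suc m" for j
        using that
      proof (induction j rule: inc_induct)
        case base
        show ?case by (rule top)
      next
        case (step j)
        have "2 ^ j * tdeg p \<le> 2 ^ Suc m * tdeg p" using step by (intro mult_right_mono power_increasing) auto
        then have "2 * tdeg (p ^ (2 ^ j)) \<le> 2 * d" using tdeg_power_le[of p "2 ^ j"] elim by linarith
        from Lt1_Cauchy_Schwarz[OF y this] have "(apply_fun y (p ^ 2 ^ j))\<^sup>2 \<le> apply_fun y (p ^ 2 ^ Suc j)"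
          by (simp add: mult_2 flip: power_add)
        then show ?case using step by simp
      qed
      from this[of 0] show "apply_fun y p = 0" by simp
    qed
  qed
qed

lemma peval_prod: "peval (prod f A) x = (\<Prod>i\<in>A. peval (f i) x)"
  by (induction A rule: infinite_finite_induct) (auto simp: peval_1 peval_mult)

lemma peval_pvar: "peval (pvar i) x = x $ i"
proof -
  have "(\<Prod>j\<in>UNIV - {i}. (x $ j) ^ Poly_Mapping.lookup (Poly_Mapping.single i (1::nat)) j) = 1"
    by (rule prod.neutral) (auto simp: lookup_single)
  then show ?thesis
    by (simp add: pvar_def peval_single monom_eval_def prod.remove[of UNIV i])
qed

lemma interpolation_polynomials:
  fixes V :: "(real ^ ('n::finite)) set"
  assumes "finite V"
  shows "\<exists>e. \<forall>v\<in>V. \<forall>w\<in>V. peval (e v) w = (if w = v then 1 else 0)"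
proof -
  have "\<exists>l. peval l v = 1 \<and> peval l w = 0" if vw: "v \<noteq> w" for v w :: "real ^ 'n"
  proof -
    obtain i where i: "v $ i \<noteq> w $ i" using vw by (auto simp: vec_eq_iff)
    define l where "l = Poly_Mapping.single 0 (1 / (v $ i - w $ i)) * (pvar i - Poly_Mapping.single 0 (w $ i))"
    have "peval l v = 1" "peval l w = 0"
      using i by (simp_all add: l_def peval_mult peval_diff peval_single monom_eval_0 peval_pvar)
    then show ?thesis by blast
  qed
  then obtain l where l: "\<And>v w :: real ^ 'n. v \<noteq> w \<Longrightarrow> peval (l v w) v = 1 \<and> peval (l v w) w = 0" by metis
  define e where "e v = (\<Prod>w\<in>V - {v}. l v w)" for v
  have "peval (e v) w = (if w = v then 1 else 0)" if "v \<in> V" "w \<in> V" for v w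
  proof (cases "w = v")
    case True
    then show ?thesis by (auto simp: e_def peval_prod intro!: prod.neutral) (metis l)
  next
    case False
    then have "(\<Prod>u\<in>V - {v}. peval (l v u) w) = 0" using that l assms by (intro prod_zero) (auto intro!: bexI[of _ w])
    then show ?thesis using False by (simp add: e_def peval_prod)
  qed
  then show ?thesis by blast
qed

lemma finite_monos_le: "finite {\<alpha> :: ('n::finite) mono. mdeg \<alpha> \<le> k}"
proof -
  have "Poly_Mapping.lookup ` {\<alpha> :: 'n mono. mdeg \<alpha> \<le> k} \<subseteq> PiE UNIV (\<lambda>_. {..k})"
  proof -
    have "Poly_Mapping.lookup \<alpha> i \<le> k" if "mdeg \<alpha> \<le> k" for \<alpha> :: "'n mono" and i
      using member_le_sum[of i UNIV "Poly_Mapping.lookup \<alpha>"] that by (simp add: mdeg_eq)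
    then show ?thesis by (auto simp: PiE_def extensional_def)
  qed
  then have "finite (Poly_Mapping.lookup ` {\<alpha> :: 'n mono. mdeg \<alpha> \<le> k})"
    by (rule finite_subset) (auto intro: finite_PiE)
  then show ?thesis by (rule finite_imageD) (auto simp: inj_on_def lookup_inject)
qed

theorem eventually_atomic:
  fixes g h :: "('n::finite) rpoly list" and V :: "(real ^ 'n) set"
  assumes V: "V = {x. \<forall>b\<in>set h. peval b x = 0}" and finV: "finite V"
  shows "\<forall>\<^sub>F d in sequentially. \<forall>y\<in>Lt1 (2 * d) (pm_family g h).
    \<exists>w. (\<forall>v\<in>V. 0 \<le> w v) \<and> (\<Sum>v\<in>V. w v) = 1 \<and> (\<forall>v\<in>V. w v \<noteq> 0 \<longrightarrow> v \<in> semialg g) \<and>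
      (\<forall>\<alpha>. mdeg \<alpha> \<le> k \<longrightarrow> y \<alpha> = (\<Sum>v\<in>V. w v * monom_eval \<alpha> v))"
proof -
  obtain e where e: "\<And>v w. v \<in> V \<Longrightarrow> w \<in> V \<Longrightarrow> peval (e v) w = (if w = v then 1 else 0)"
    using interpolation_polynomials[OF finV] by blast
  \<comment> \<open>All three families vanish on \<open>V\<close>. \<open>R\<close> replaces a
    monomial by its interpolant; \<open>A\<close> turns the weight \<open>apply_fun y (e v)\<close>
    into the value of a square, hence makes it nonnegative; \<open>B\<close> identifies the weight
    times \<open>peval q v\<close> with the value of the square multiple of \<open>q\<close>, so a
    positive weight forces \<open>q\<close> to be nonnegative at \<open>v\<close>.\<close>
  define R where "R \<alpha> = Poly_Mapping.single \<alpha> 1 - (\<Sum>v\<in>V. Poly_Mapping.single 0 (monom_eval \<alpha> v) * e v)" for \<alpha>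
  define A where "A v = e v * e v - e v" for v
  define B where "B v q = e v * e v * q - Poly_Mapping.single 0 (peval q v) * e v" for v q
  have van: "\<forall>\<^sub>F d in sequentially. \<forall>y\<in>Lt1 (2 * d) (pm_family g h). apply_fun y p = 0"
    if "\<And>x. x \<in> V \<Longrightarrow> peval p x = 0" for p
    by (rule eventually_vanish_on_variety) (use that V in auto)
  have "\<forall>\<^sub>F d in sequentially. \<forall>\<alpha>\<in>{\<alpha>. mdeg \<alpha> \<le> k}. \<forall>y\<in>Lt1 (2 * d) (pm_family g h). apply_fun y (R \<alpha>) = 0"
  proof (rule eventually_ball_finite[OF finite_monos_le], rule ballI, rule van)
    fix \<alpha> x assume "x \<in> V"
    have "(\<Sum>v\<in>V. monom_eval \<alpha> v * peval (e v) x) = (\<Sum>v\<in>V. if v = x then monom_eval \<alpha> x else 0)"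
      by (rule sum.cong) (use e \<open>x \<in> V\<close> in auto)
    then show "peval (R \<alpha>) x = 0"
      using finV \<open>x \<in> V\<close> by (simp add: R_def peval_diff peval_single peval_sum peval_mult monom_eval_0 sum.delta)
  qed
  moreover have "\<forall>\<^sub>F d in sequentially. \<forall>v\<in>V. \<forall>y\<in>Lt1 (2 * d) (pm_family g h). apply_fun y (A v) = 0"
    by (rule eventually_ball_finite[OF finV], rule ballI, rule van) (use e in \<open>auto simp: A_def peval_diff peval_mult\<close>)
  moreover have "\<forall>\<^sub>F d in sequentially. \<forall>v\<in>V. \<forall>q\<in>set g. \<forall>y\<in>Lt1 (2 * d) (pm_family g h). apply_fun y (B v q) = 0"
    by (rule eventually_ball_finite[OF finV], rule ballI, rule eventually_ball_finite, simp, rule ballI, rule van)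
      (use e in \<open>auto simp: B_def peval_diff peval_mult peval_single monom_eval_0\<close>)
  moreover have "\<forall>\<^sub>F d in sequentially. \<forall>v\<in>V. tdeg (e v * e v) \<le> d \<and> (\<forall>q\<in>set g. tdeg (e v * e v) + tdeg q \<le> d)"
    by (intro eventually_ball_finite[OF finV] ballI eventually_conj eventually_ge_at_top
        eventually_ball_finite[of "set g"] finite_set)
  ultimately show ?thesis
  proof eventually_elim
    case (elim d)
    show ?case
    proof
      fix y assume y: "y \<in> Lt1 (2 * d) (pm_family g h)"
      define w where "w v = apply_fun y (e v)" for v
      have sq: "w v = apply_fun y (e v * e v)" if "v \<in> V" for v
        using elim(2) y that by (simp add: A_def apply_fun_diff w_def)
      have mom: "y \<alpha> = (\<Sum>v\<in>V. w v * monom_eval \<alpha> v)" if "mdeg \<alpha> \<le> k" for \<alpha>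
      proof -
        have "apply_fun y (R \<alpha>) = 0" using elim(1) y that by simp
        then have "y \<alpha> = (\<Sum>v\<in>V. monom_eval \<alpha> v * w v)"
          by (simp add: R_def apply_fun_diff apply_fun_single apply_fun_sum apply_fun_scale w_def)
        then show ?thesis by (simp add: mult.commute)
      qed
      have "y 0 = 1" using Lt1_one[OF y] apply_fun_single[of y 0 1] by simp
      then have "(\<Sum>v\<in>V. w v) = 1" using mom[of 0] by (simp add: mdeg_def monom_eval_0)
      moreover have pos: "0 \<le> w v" if "v \<in> V" for v
        unfolding sq[OF that] by (rule Lt1_sos[OF y sos_square]) (use elim that in force)
      moreover have "v \<in> semialg g" if v: "v \<in> V" "w v \<noteq> 0" for v
        unfolding semialg_def
      proof (intro CollectI ballI)
        fix q assume q: "q \<in> set g"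
        have "0 \<le> apply_fun y (e v * e v * q)"
          by (rule Lt1_mult[OF y _ sos_square]) (use elim v q in \<open>force simp: set_pm_family\<close>)+
        also have "apply_fun y (B v q) = 0" using elim(3) y v q by blast
        then have "apply_fun y (e v * e v * q) = peval q v * w v"
          by (simp add: B_def apply_fun_diff apply_fun_scale w_def)
        finally show "0 \<le> peval q v" using pos[OF v(1)] v(2) by (simp add: zero_le_mult_iff)
      qed
      ultimately show "\<exists>w. (\<forall>v\<in>V. 0 \<le> w v) \<and> (\<Sum>v\<in>V. w v) = 1 \<and> (\<forall>v\<in>V. w v \<noteq> 0 \<longrightarrow> v \<in> semialg g) \<and>
          (\<forall>\<alpha>. mdeg \<alpha> \<le> k \<longrightarrow> y \<alpha> = (\<Sum>v\<in>V. w v * monom_eval \<alpha> v))"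
        using mom by blast
    qed
  qed
qed

section \<open>Atomic measures and point evaluations\<close>

lemma continuous_monom_eval: "continuous_on UNIV (monom_eval \<alpha>)"
  unfolding monom_eval_def[abs_def] by (intro continuous_intros)

lemma atomic_meas1:
  fixes V :: "(real ^ ('n::finite)) set"
  assumes "finite V" "\<And>v. v \<in> V \<Longrightarrow> 0 \<le> w v" "(\<Sum>v\<in>V. w v) = 1" "\<And>v. v \<in> V \<Longrightarrow> w v \<noteq> 0 \<Longrightarrow> v \<in> T"
  shows "(\<lambda>\<alpha>. \<Sum>v\<in>V. w v * monom_eval \<alpha> v) \<in> meas1 T"
proof -
  define f where "f v = (if v \<in> V then w v else 0)" for v
  define p where "p = embed_pmf f"
  have "(\<integral>\<^sup>+x. ennreal (f x) \<partial>count_space UNIV) = (\<Sum>x\<in>V. ennreal (f x))"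
    by (rule nn_integral_count_space') (use assms in \<open>auto simp: f_def split: if_splits\<close>)
  also have "\<dots> = ennreal (\<Sum>x\<in>V. f x)" using assms by (intro sum_ennreal) (auto simp: f_def)
  also have "(\<Sum>x\<in>V. f x) = 1" using assms(3) by (simp add: f_def)
  finally have pmf: "pmf p x = f x" for x
    unfolding p_def using assms by (intro pmf_embed_pmf) (auto simp: f_def)
  have supp: "set_pmf p \<subseteq> V" by (auto simp: set_pmf_iff pmf f_def split: if_splits)
  \<comment> \<open>\<open>measure_pmf\<close> carries the discrete sigma-algebra; its image measure
    lives on the Borel sets, as \<open>meas1\<close> demands.\<close>
  define \<mu> where "\<mu> = distr (measure_pmf p) borel (\<lambda>x. x)"
  have meas: "(\<lambda>x. x) \<in> measurable (measure_pmf p) (borel :: (real ^ 'n) measure)"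
    by (simp add: measurable_pmf_measure1)
  have bm: "monom_eval \<alpha> \<in> borel_measurable borel" for \<alpha> :: "'n mono"
    by (rule borel_measurable_continuous_onI) (rule continuous_monom_eval)
  have "prob_space \<mu>" unfolding \<mu>_def by (rule prob_space.prob_space_distr[OF prob_space_measure_pmf meas])
  moreover have "sets \<mu> = sets borel" by (simp add: \<mu>_def)
  moreover have "AE x in \<mu>. x \<in> T"
  proof -
    \<comment> \<open>\<open>T\<close> may be any set, whereas the finite set
      \<open>V \<inter> T\<close> is closed and hence Borel; the almost-everywhere statement is
      transferred for it.\<close>
    define U where "U = V \<inter> T"
    have U: "U \<in> sets borel" unfolding U_def using assms(1) by (intro borel_closed finite_imp_closed) simp
    have "AE x in measure_pmf p. x \<in> U"
      using assms(4) by (auto simp: AE_measure_pmf_iff U_def set_pmf_iff pmf f_def split: if_splits)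
    then have "AE x in \<mu>. x \<in> U" unfolding \<mu>_def by (subst AE_distr_iff[OF meas]) (simp_all add: U)
    then show ?thesis by (rule AE_mp) (auto simp: U_def)
  qed
  moreover have "integrable \<mu> (monom_eval \<alpha>)" for \<alpha>
    unfolding \<mu>_def integrable_distr_eq[OF meas bm]
    by (rule integrable_measure_pmf_finite) (use supp assms(1) finite_subset in blast)
  moreover have "integral\<^sup>L \<mu> (monom_eval \<alpha>) = (\<Sum>v\<in>V. w v * monom_eval \<alpha> v)" for \<alpha>
  proof -
    have "integral\<^sup>L \<mu> (monom_eval \<alpha>) = (\<Sum>v\<in>V. pmf p v *\<^sub>R monom_eval \<alpha> v)"
      unfolding \<mu>_def integral_distr[OF meas bm]
      by (rule integral_measure_pmf[OF assms(1)]) (use supp in auto)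
    then show ?thesis by (simp add: pmf f_def)
  qed
  then have "(\<lambda>\<alpha>. \<Sum>v\<in>V. w v * monom_eval \<alpha> v) = (\<lambda>\<alpha>. integral\<^sup>L \<mu> (monom_eval \<alpha>))" by simp
  ultimately show ?thesis unfolding meas1_def by blast
qed

text \<open>Feasible points give feasible functionals, the source of the upper bound on the
  relaxation value. The cut-off matches the convention that functionals are zero on monomials of
  degree above \<open>t\<close>.\<close>

lemma point_functional:
  fixes x :: "real ^ ('n::finite)" and t :: nat
  defines "y \<equiv> \<lambda>\<alpha>. if mdeg \<alpha> \<le> t then monom_eval \<alpha> x else 0"
  assumes "x \<in> semialg G"
  shows "y \<in> Lt1 t G" and "tdeg p \<le> t \<Longrightarrow> apply_fun y p = peval p x"
proof -
  show ev: "apply_fun y p = peval p x" if "tdeg p \<le> t" for p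
    unfolding apply_fun_def peval_def using that by (intro sum.cong) (auto simp: y_def tdeg_le_iff)
  have sos: "0 \<le> peval s x" if s: "s \<in> sos" for s :: "'n rpoly"
  proof -
    obtain qs where "s = sum_list (map (\<lambda>q. q * q) qs)" using s by (auto simp: sos_def)
    moreover have "0 \<le> peval (sum_list (map (\<lambda>q. q * q) qs)) x"
      by (induction qs) (auto simp: peval_add peval_mult peval_0)
    ultimately show ?thesis by simp
  qed
  have "0 \<le> apply_fun y q" if q: "q \<in> qmod_t t G" for q
  proof -
    obtain s0 s where *: "q = s0 + (\<Sum>i<length G. s i * G ! i)" "s0 \<in> sos" "tdeg s0 \<le> t"
      "\<And>i. i < length G \<Longrightarrow> s i \<in> sos \<and> (s i = 0 \<or> tdeg (s i) + tdeg (G ! i) \<le> t)"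
      using q by (auto simp: qmod_t_def sos_le_def polys_le_def)
    have t: "tdeg (s i * G ! i) \<le> t" if "i < length G" for i
      using *(4)[OF that] tdeg_mult_le[of "s i" "G ! i"] by (auto simp: tdeg_def[of 0])
    have "apply_fun y q = peval s0 x + (\<Sum>i<length G. peval (s i) x * peval (G ! i) x)"
      by (simp add: *(1) apply_fun_add apply_fun_sum ev[OF *(3)] ev[OF t] peval_mult)
    also have "\<dots> \<ge> 0" using assms(2) * sos by (intro add_nonneg_nonneg sum_nonneg mult_nonneg_nonneg) (auto simp: semialg_def)
    finally show ?thesis .
  qed
  moreover have "tdeg (1 :: 'n rpoly) = 0" using tdeg_single_0[of 1] by simp
  then have "apply_fun y 1 = 1" using ev[of 1] by (simp add: peval_1)
  ultimately show "y \<in> Lt1 t G" by (auto simp: Lt1_def Lt_def functionals_def y_def)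
qed

section \<open>Minimisers lie on the polar variety\<close>

text \<open>Subtraction of exponents is truncated: if variable \<open>i\<close> does not occur, the
  monomial is left unchanged, but its factor \<open>Poly_Mapping.lookup \<alpha> i\<close> is
  zero.\<close>

lemma monom_eval_has_derivative:
  fixes x :: "real ^ ('n::finite)"
  shows "(monom_eval \<alpha> has_derivative
    (\<lambda>v. \<Sum>i\<in>UNIV. real (Poly_Mapping.lookup \<alpha> i) * monom_eval (\<alpha> - Poly_Mapping.single i 1) x * v $ i)) (at x)"
proof -
  let ?k = "Poly_Mapping.lookup \<alpha>"
  have "((\<lambda>y. y $ i ^ ?k i) has_derivative (\<lambda>v. of_nat (?k i) * v $ i * x $ i ^ (?k i - 1))) (at x)" for i
    by (rule has_derivative_power) (rule bounded_linear_imp_has_derivative[OF bounded_linear_vec_nth])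
  then have "((\<lambda>y. \<Prod>i\<in>UNIV. y $ i ^ ?k i) has_derivative
    (\<lambda>v. \<Sum>i\<in>UNIV. (of_nat (?k i) * v $ i * x $ i ^ (?k i - 1)) * (\<Prod>j\<in>UNIV - {i}. x $ j ^ ?k j))) (at x)"
    by (rule has_derivative_prod)
  moreover have "(of_nat (?k i) * v * x $ i ^ (?k i - 1)) * (\<Prod>j\<in>UNIV - {i}. x $ j ^ ?k j) =
      real (?k i) * monom_eval (\<alpha> - Poly_Mapping.single i 1) x * v" for i and v :: real
  proof -
    have "(\<Prod>j\<in>UNIV - {i}. x $ j ^ Poly_Mapping.lookup (\<alpha> - Poly_Mapping.single i 1) j) = (\<Prod>j\<in>UNIV - {i}. x $ j ^ ?k j)"
      by (rule prod.cong) (auto simp: minus_poly_mapping.rep_eq lookup_single)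
    then show ?thesis
      by (simp add: monom_eval_def prod.remove[of UNIV i] minus_poly_mapping.rep_eq)
  qed
  ultimately show ?thesis by (simp only: monom_eval_def[of \<alpha>, abs_def])
qed

lemma peval_pderiv_var:
  "peval (pderiv_var i p) x =
    (\<Sum>\<alpha>\<in>Poly_Mapping.keys p. Poly_Mapping.lookup p \<alpha> * (real (Poly_Mapping.lookup \<alpha> i) * monom_eval (\<alpha> - Poly_Mapping.single i 1) x))"
  by (simp add: pderiv_var_def peval_sum peval_single mult.assoc)

lemma peval_has_derivative:
  fixes x :: "real ^ ('n::finite)"
  shows "(peval p has_derivative (\<lambda>v. \<Sum>i\<in>UNIV. peval (pderiv_var i p) x * v $ i)) (at x)"
proof -
  have "((\<lambda>x. \<Sum>\<alpha>\<in>Poly_Mapping.keys p. Poly_Mapping.lookup p \<alpha> * monom_eval \<alpha> x) has_derivative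
    (\<lambda>v. \<Sum>\<alpha>\<in>Poly_Mapping.keys p. Poly_Mapping.lookup p \<alpha> *
       (\<Sum>i\<in>UNIV. real (Poly_Mapping.lookup \<alpha> i) * monom_eval (\<alpha> - Poly_Mapping.single i 1) x * v $ i))) (at x)"
    by (intro has_derivative_sum has_derivative_mult_right monom_eval_has_derivative)
  moreover have "(\<Sum>\<alpha>\<in>Poly_Mapping.keys p. Poly_Mapping.lookup p \<alpha> *
       (\<Sum>i\<in>UNIV. real (Poly_Mapping.lookup \<alpha> i) * monom_eval (\<alpha> - Poly_Mapping.single i 1) x * v $ i)) =
     (\<Sum>i\<in>UNIV. peval (pderiv_var i p) x * v $ i)" for v :: "real ^ 'n"
    unfolding peval_pderiv_var sum_distrib_right sum_distrib_left
    by (subst sum.swap) (simp add: mult.assoc)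
  ultimately show ?thesis unfolding peval_def[abs_def] by simp
qed

lemma continuous_on_peval: "continuous_on UNIV (peval p)"
  by (rule has_derivative_continuous_on) (rule has_derivative_at_withinI[OF peval_has_derivative])

section \<open>Determinants and prescribed values near a point\<close>

text \<open>The determinant by Leibniz' formula, over an index set instead of an index type, because
  the size of a minor is the length of a list.\<close>

definition leibniz_sum :: "'i set \<Rightarrow> ('i \<Rightarrow> 'i \<Rightarrow> real) \<Rightarrow> real" where
  "leibniz_sum S M = (\<Sum>\<pi> | \<pi> permutes S. of_int (sign \<pi>) * (\<Prod>i\<in>S. M i (\<pi> i)))"

text \<open>Composing each permutation with the transposition of the equal columns flips the sign
  and keeps the product, so the sum equals its own negative.\<close>

lemma leibniz_sum_equal_columns:
  assumes fin: "finite S" and ab: "a \<in> S" "b \<in> S" "a \<noteq> b" and eq: "\<And>i. i \<in> S \<Longrightarrow> M i a = M i b"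
  shows "leibniz_sum S M = 0"
proof -
  let ?t = "Transposition.transpose a b"
  have t: "?t permutes S" using ab by (intro permutes_swap_id)
  have "leibniz_sum S M = (\<Sum>\<pi> | \<pi> permutes S. of_int (sign (?t \<circ> \<pi>)) * (\<Prod>i\<in>S. M i ((?t \<circ> \<pi>) i)))"
    unfolding leibniz_sum_def by (rule setum_permutations_compose_left[OF t])
  also have "\<dots> = (\<Sum>\<pi> | \<pi> permutes S. - (of_int (sign \<pi>) * (\<Prod>i\<in>S. M i (\<pi> i))))"
  proof (rule sum.cong[OF refl])
    fix \<pi> assume "\<pi> \<in> {\<pi>. \<pi> permutes S}"
    then have \<pi>: "\<pi> permutes S" by simp
    have "sign (?t \<circ> \<pi>) = - sign \<pi>"
      using \<pi> t fin ab by (subst sign_compose) (auto simp: sign_swap_id permutes_imp_permutation)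
    moreover have "(\<Prod>i\<in>S. M i ((?t \<circ> \<pi>) i)) = (\<Prod>i\<in>S. M i (\<pi> i))"
      by (rule prod.cong) (use eq in \<open>auto simp: Transposition.transpose_def\<close>)
    ultimately show "of_int (sign (?t \<circ> \<pi>)) * (\<Prod>i\<in>S. M i ((?t \<circ> \<pi>) i)) = - (of_int (sign \<pi>) * (\<Prod>i\<in>S. M i (\<pi> i)))"
      by simp
  qed
  also have "\<dots> = - leibniz_sum S M" by (simp add: leibniz_sum_def sum_negf)
  finally show ?thesis by simp
qed

text \<open>Cramer's rule. Let \<open>C k\<close> be \<open>M\<close> with column \<open>l\<close>
  replaced by column \<open>k\<close>. Weighted by \<open>u k\<close>, the determinants of the
  \<open>C k\<close> sum to zero, since column \<open>l\<close> becomes \<open>M\<close> applied to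
  \<open>u\<close>; all except \<open>k = l\<close> have two equal columns.\<close>

lemma leibniz_sum_kernel:
  assumes fin: "finite S" and ker: "\<And>i. i \<in> S \<Longrightarrow> (\<Sum>k\<in>S. M i k * u k) = 0"
    and nz: "leibniz_sum S M \<noteq> 0" and l: "l \<in> S"
  shows "u l = 0"
proof -
  define C where "C k = (\<lambda>i j. if j = l then M i k else M i j)" for k
  have z: "(\<Sum>k\<in>S. u k * (\<Prod>i\<in>S. C k i (\<pi> i))) = 0" if \<pi>: "\<pi> permutes S" for \<pi>
  proof -
    obtain r where r: "r \<in> S" "\<pi> r = l" using permutes_image[OF \<pi>] l by force
    have inj: "\<pi> i \<noteq> l" if "i \<in> S - {r}" for i using that r permutes_inj[OF \<pi>] by (auto simp: inj_def)
    have "(\<Prod>i\<in>S. C k i (\<pi> i)) = M r k * (\<Prod>i\<in>S - {r}. M i (\<pi> i))" for k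
    proof -
      have "(\<Prod>i\<in>S - {r}. C k i (\<pi> i)) = (\<Prod>i\<in>S - {r}. M i (\<pi> i))"
        by (rule prod.cong) (use inj in \<open>auto simp: C_def\<close>)
      then show ?thesis using fin r by (simp add: prod.remove[of S r] C_def)
    qed
    then have "(\<Sum>k\<in>S. u k * (\<Prod>i\<in>S. C k i (\<pi> i))) = (\<Sum>k\<in>S. M r k * u k) * (\<Prod>i\<in>S - {r}. M i (\<pi> i))"
      by (simp add: sum_distrib_right mult_ac)
    then show ?thesis using ker[OF r(1)] by simp
  qed
  have "(\<Sum>k\<in>S. u k * leibniz_sum S (C k)) =
     (\<Sum>\<pi> | \<pi> permutes S. of_int (sign \<pi>) * (\<Sum>k\<in>S. u k * (\<Prod>i\<in>S. C k i (\<pi> i))))"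
    unfolding leibniz_sum_def sum_distrib_left by (subst sum.swap) (simp add: mult_ac)
  also have "\<dots> = 0" using z by (intro sum.neutral) auto
  finally have 0: "(\<Sum>k\<in>S. u k * leibniz_sum S (C k)) = 0" .
  have "leibniz_sum S (C k) = 0" if "k \<in> S - {l}" for k
    by (rule leibniz_sum_equal_columns[OF fin, of l k]) (use that l in \<open>auto simp: C_def\<close>)
  then have "(\<Sum>k\<in>S. u k * leibniz_sum S (C k)) = u l * leibniz_sum S (C l)"
    using fin l by (simp add: sum.remove[of S l])
  moreover have "C l = M" by (auto simp: C_def fun_eq_iff)
  ultimately show ?thesis using 0 nz by simp
qed

lemma peval_of_int: "peval (of_int z) x = of_int z"
  using peval_single[of 0 "of_int z" x] by (simp add: monom_eval_0)

lemma peval_jac_minor: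
  "peval (jac_minor ps c) x = leibniz_sum {..<length ps} (\<lambda>i k. peval (pderiv_var (c k) (ps ! i)) x)"
  by (simp add: jac_minor_def leibniz_sum_def peval_sum peval_mult peval_prod peval_of_int)

text \<open>A nonvanishing minor makes the listed polynomials, completed by the remaining coordinates,
  a local submersion, so that their values can be prescribed freely near \<open>x\<close>.\<close>

lemma nonvanishing_minor_open:
  fixes x :: "real ^ ('n::finite)"
  assumes inj: "inj_on c {..<length ps}" and nz: "peval (jac_minor ps c) x \<noteq> 0"
    and U: "open U" "x \<in> U" and l: "l < length ps"
  shows "\<exists>\<epsilon>>0. \<exists>z\<in>U. peval (ps ! l) z = peval (ps ! l) x - \<epsilon> \<and>
    (\<forall>i<length ps. i \<noteq> l \<longrightarrow> peval (ps ! i) z = peval (ps ! i) x)"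
proof -
  let ?m = "length ps"
  define d where "d = the_inv_into {..<?m} c"
  have d: "d (c i) = i" if "i < ?m" for i using the_inv_into_f_f[OF inj] that by (simp add: d_def)
  define F where "F z = (\<chi> j. if j \<in> c ` {..<?m} then peval (ps ! d j) z else z $ j)" for z :: "real ^ 'n"
  define L where "L v = (\<chi> j. if j \<in> c ` {..<?m} then (\<Sum>i\<in>UNIV. peval (pderiv_var i (ps ! d j)) x * v $ i) else v $ j)" for v :: "real ^ 'n"
  have der: "(F has_derivative L) (at x)"
  proof (rule has_derivative_componentwise_within[THEN iffD2], rule ballI)
    fix b :: "real ^ 'n" assume "b \<in> Basis"
    then obtain j where b: "b = axis j 1" by (auto simp: Basis_vec_def)
    show "((\<lambda>z. F z \<bullet> b) has_derivative (\<lambda>v. L v \<bullet> b)) (at x)"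
    proof (cases "j \<in> c ` {..<?m}")
      case True
      then have "(\<lambda>z. F z \<bullet> b) = peval (ps ! d j)"
        "(\<lambda>v. L v \<bullet> b) = (\<lambda>v. \<Sum>i\<in>UNIV. peval (pderiv_var i (ps ! d j)) x * v $ i)"
        by (auto simp: b F_def L_def inner_axis)
      then show ?thesis using peval_has_derivative[of "ps ! d j" x] by simp
    next
      case False
      then have "(\<lambda>z. F z \<bullet> b) = (\<lambda>z. z $ j)" "(\<lambda>v. L v \<bullet> b) = (\<lambda>z. z $ j)"
        by (auto simp: b F_def L_def inner_axis)
      then show ?thesis using bounded_linear_imp_has_derivative[OF bounded_linear_vec_nth] by simp
    qed
  qed
  have lin: "linear L" using has_derivative_linear[OF der] .
  have "v = 0" if Lv: "L v = 0" for v
  proof -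
    have out: "v $ j = 0" if "j \<notin> c ` {..<?m}" for j
    proof -
      have "L v $ j = 0" using Lv by simp
      then show ?thesis using that by (simp add: L_def)
    qed
    have "(\<Sum>k\<in>{..<?m}. peval (pderiv_var (c k) (ps ! i)) x * v $ c k) = 0" if i: "i \<in> {..<?m}" for i
    proof -
      have "(\<Sum>j\<in>UNIV. peval (pderiv_var j (ps ! i)) x * v $ j) = L v $ c i"
        using i d by (simp add: L_def)
      then have "(\<Sum>j\<in>UNIV. peval (pderiv_var j (ps ! i)) x * v $ j) = 0" using Lv by simp
      moreover have "(\<Sum>j\<in>UNIV. peval (pderiv_var j (ps ! i)) x * v $ j) =
         (\<Sum>j\<in>c ` {..<?m}. peval (pderiv_var j (ps ! i)) x * v $ j)"
        by (rule sum.mono_neutral_right) (use out in auto)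
      ultimately show ?thesis by (simp add: sum.reindex[OF inj])
    qed
    then have "v $ c k = 0" if "k \<in> {..<?m}" for k
      by (rule leibniz_sum_kernel[where u = "\<lambda>k. v $ c k" and M = "\<lambda>i k. peval (pderiv_var (c k) (ps ! i)) x", OF finite_lessThan])
         (use nz that in \<open>auto simp: peval_jac_minor\<close>)
    then show "v = 0" using out by (force simp: vec_eq_iff)
  qed
  then have "inj L" using linear_injective_0[OF lin] by blast
  then have "surj L" using linear_injective_imp_surjective[OF lin] by simp
  then obtain g where g: "linear g" "L \<circ> g = id" using linear_surjective_right_inverse[OF lin] by blast
  have contF: "continuous_on UNIV F"
    unfolding F_def
  proof (rule continuous_on_vec_lambda)
    fix j
    show "continuous_on UNIV (\<lambda>z. if j \<in> c ` {..<?m} then peval (ps ! d j) z else z $ j)"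
    proof (cases "j \<in> c ` {..<?m}")
      case True
      then show ?thesis using continuous_on_peval[of "ps ! d j"] by simp
    next
      case False
      then show ?thesis by (simp only: if_False) (intro continuous_intros)
    qed
  qed
  \<comment> \<open>This open mapping theorem uses the derivative at the single point
    \<open>x\<close> only, together with continuity.\<close>
  have "F x \<in> interior (F ` U)"
    by (rule sussmann_open_mapping[OF open_UNIV contF UNIV_I der linear_conv_bounded_linear[THEN iffD1, OF g(1)] g(2)])
      (use U in \<open>auto simp: interior_open\<close>)
  then obtain r where r: "r > 0" "ball (F x) r \<subseteq> F ` U" unfolding mem_interior by blast
  \<comment> \<open>The target differs from \<open>F x\<close> only in the component carrying
    \<open>ps ! l\<close>; half the radius keeps it inside the ball.\<close>
  define w where "w = F x - (r / 2) *\<^sub>R axis (c l) 1"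
  have "w \<in> ball (F x) r" using r(1) by (simp add: w_def dist_norm)
  then obtain z where z: "z \<in> U" "F z = w" using r(2) by blast
  have comp: "F y $ c i = peval (ps ! i) y" if "i < ?m" for y i using that d by (simp add: F_def)
  have "peval (ps ! i) z = peval (ps ! i) x - (if i = l then r / 2 else 0)" if "i < ?m" for i
  proof -
    have "c i = c l \<longleftrightarrow> i = l" using inj that l by (auto simp: inj_on_def)
    then show ?thesis
      using comp[OF that, of z] comp[OF that, of x] z(2) by (auto simp: w_def axis_def)
  qed
  then show ?thesis using z(1) r(1) l by (intro exI[of _ "r / 2"] conjI bexI[of _ z]) auto
qed

section \<open>The polar variety and its minimisers\<close>

lemma real_variety_pideal: "real_variety (pideal B) = {x. \<forall>b\<in>B. peval b x = 0}"
proof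
  show "real_variety (pideal B) \<subseteq> {x. \<forall>b\<in>B. peval b x = 0}"
    using pideal_generator[of _ B 1] by (auto simp: real_variety_def)
  show "{x. \<forall>b\<in>B. peval b x = 0} \<subseteq> real_variety (pideal B)"
    by (auto simp: real_variety_def pideal_def peval_sum peval_mult subset_iff intro!: sum.neutral)
qed

lemma real_variety_ideal_sum: "real_variety (ideal_sum I K) = real_variety I \<inter> real_variety K"
  unfolding ideal_sum_def real_variety_pideal by (auto simp: real_variety_def)

text \<open>Each product of the ideal product contains a factor for the active set \<open>A\<close>,
  and that factor vanishes at \<open>x\<close>: the active \<open>g\<close> vanish by definition,
  the minors by the openness argument.\<close>

lemma minimizer_in_polar_variety:
  fixes x :: "real ^ ('n::finite)"
  assumes x: "x \<in> semialg (pm_family g h)"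
    and min: "\<And>z. z \<in> semialg (pm_family g h) \<Longrightarrow> peval f x \<le> peval f z"
  shows "x \<in> real_variety (polar_ideal f g h)"
proof -
  have hz: "z \<in> semialg (pm_family g h) \<longleftrightarrow> (\<forall>q\<in>set g. 0 \<le> peval q z) \<and> (\<forall>b\<in>set h. peval b z = 0)" for z
    unfolding semialg_def set_pm_family ball_Un by (auto simp: peval_uminus intro!: order_antisym)
  define A where "A = {a. a < length g \<and> peval (g ! a) x = 0}"
  have finA: "finite A" by (simp add: A_def)
  define ps where "ps = f # h @ map (\<lambda>a. g ! a) (sorted_list_of_set A)"
  \<comment> \<open>If \<open>ps\<close> is longer than the number of variables, there is no
    injective \<open>c\<close> and the claim is vacuous, in accordance with the zero ideal of
    minors.\<close>
  have minors: "peval (jac_minor ps c) x = 0" if inj: "inj_on c {..<length ps}" for c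
  proof (rule ccontr)
    assume nz: "peval (jac_minor ps c) x \<noteq> 0"
    \<comment> \<open>On \<open>U\<close> the inactive constraints stay positive. The values of
      \<open>h\<close> and of the active constraints are held fixed while \<open>f\<close> is
      lowered, so the new point is feasible.\<close>
    define U where "U = (\<Inter>a\<in>{..<length g} - A. {z. 0 < peval (g ! a) z})"
    have "open U" unfolding U_def
      by (intro open_INT ballI open_Collect_less continuous_on_const continuous_on_peval) auto
    moreover have "0 < peval (g ! a) x" if "a \<in> {..<length g} - A" for a
    proof -
      have "0 \<le> peval (g ! a) x" using x that nth_mem[of a g] unfolding hz by blast
      then show ?thesis using that by (auto simp: A_def)
    qed
    then have "x \<in> U" by (simp add: U_def)
    ultimately obtain \<epsilon> z where z: "\<epsilon> > 0" "z \<in> U" "peval f z = peval f x - \<epsilon>"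
      "\<And>i. i < length ps \<Longrightarrow> i \<noteq> 0 \<Longrightarrow> peval (ps ! i) z = peval (ps ! i) x"
      using nonvanishing_minor_open[OF inj nz, of U 0] by (auto simp: ps_def)
    have same: "peval q z = peval q x" if q: "q \<in> set (h @ map (\<lambda>a. g ! a) (sorted_list_of_set A))" for q
    proof -
      obtain i where "i < length (h @ map (\<lambda>a. g ! a) (sorted_list_of_set A))"
          "(h @ map (\<lambda>a. g ! a) (sorted_list_of_set A)) ! i = q"
        using q unfolding in_set_conv_nth by blast
      then show ?thesis using z(4)[of "Suc i"] by (simp add: ps_def)
    qed
    have "0 \<le> peval q z" if q: "q \<in> set g" for q
    proof -
      obtain a where a: "a < length g" "q = g ! a" using q by (metis in_set_conv_nth)
      show ?thesis
      proof (cases "a \<in> A")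
        case True
        then show ?thesis using same[of q] a finA by (auto simp: A_def)
      next
        case False
        then have "z \<in> {z. 0 < peval (g ! a) z}" using z(2) a unfolding U_def by blast
        then show ?thesis using a by simp
      qed
    qed
    moreover have "peval b z = 0" if "b \<in> set h" for b using same[of b] that x by (simp add: hz)
    ultimately have "z \<in> semialg (pm_family g h)" by (simp add: hz)
    then show False using min[of z] z(1,3) by simp
  qed
  have h: "x \<in> real_variety (pideal (set h))" using x by (simp add: real_variety_pideal hz)
  have fac: "x \<in> real_variety (ideal_sum (pideal ((\<lambda>a. g ! a) ` A)) (maximal_minors_ideal ps))"
    unfolding real_variety_ideal_sum maximal_minors_ideal_def real_variety_pideal
    using minors by (auto simp: A_def)
  have "x \<in> real_variety (ideal_prod (Pow {..<length g}) (\<lambda>A. ideal_sum (pideal ((\<lambda>a. g ! a) ` A))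
               (maximal_minors_ideal (f # h @ map (\<lambda>a. g ! a) (sorted_list_of_set A)))))"
    unfolding ideal_prod_def real_variety_pideal
  proof clarify
    fix p assume p: "\<forall>A\<in>Pow {..<length g}. p A \<in> ideal_sum (pideal ((\<lambda>a. g ! a) ` A))
               (maximal_minors_ideal (f # h @ map (\<lambda>a. g ! a) (sorted_list_of_set A)))"
    have A: "A \<in> Pow {..<length g}" by (auto simp: A_def)
    have "peval (p A) x = 0" using p[rule_format, OF A] fac by (simp add: real_variety_def ps_def)
    then show "peval (\<Prod>A\<in>Pow {..<length g}. p A) x = 0"
      unfolding peval_prod using A by (intro prod_zero) auto
  qed
  with h show ?thesis unfolding polar_ideal_def real_variety_ideal_sum by blast
qed

section \<open>Exactness of the relaxation\<close>

lemma meas1_mono: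
  assumes "T \<subseteq> T'" shows "meas1 T \<subseteq> meas1 T'"
proof
  fix m assume "m \<in> meas1 T"
  then obtain \<mu> where \<mu>: "m = (\<lambda>\<alpha>. integral\<^sup>L \<mu> (monom_eval \<alpha>))" "prob_space \<mu>" "sets \<mu> = sets borel"
    "AE x in \<mu>. x \<in> T" "\<forall>\<alpha>. integrable \<mu> (monom_eval \<alpha>)"
    unfolding meas1_def by (elim CollectE exE conjE)
  have "AE x in \<mu>. x \<in> T'" using \<mu>(4) by eventually_elim (use assms in blast)
  with \<mu> show "m \<in> meas1 T'" unfolding meas1_def by (intro CollectI exI[of _ \<mu>] conjI)
qed

theorem mainTheorem9:
  fixes f :: "('n::finite) rpoly"
    and g h h' :: "'n rpoly list"
    and fstar :: real
  assumes attained: "\<exists>x0\<in>semialg (pm_family g h). peval f x0 = fstar"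
    and minimum: "\<forall>x\<in>semialg (pm_family g h). fstar \<le> peval f x"
    and gens: "pideal (set h') = polar_ideal f g h"
    and fin: "finite (real_variety (polar_ideal f g h))"
  shows "(\<exists>d0. \<forall>d\<ge>d0. fmom f g h' d = ereal fstar)
    \<and> (\<exists>k0. \<forall>k\<ge>k0. \<exists>dk. \<forall>d\<ge>dk. \<forall>y\<in>Lt1 (2 * d) (pm_family g h').
          apply_fun y f = fstar \<longrightarrow>
          restrict_fun k y \<in> restrict_fun k ` meas1 (semialg (pm_family g h) \<inter> real_variety (polar_ideal f g h))
          \<and> restrict_fun k ` meas1 (semialg (pm_family g h) \<inter> real_variety (polar_ideal f g h))
              \<subseteq> restrict_fun k ` meas1 (semialg (pm_family g h)))"
proof -
  define V where "V = real_variety (polar_ideal f g h)"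
  have V: "V = {x. \<forall>b\<in>set h'. peval b x = 0}" unfolding V_def gens[symmetric] by (rule real_variety_pideal)
  \<comment> \<open>The polar ideal contains \<open>h\<close>, so points of \<open>V\<close> satisfy
    the equations; they lie in \<open>S\<close> once the inequalities \<open>g\<close> hold, which
    \<open>eventually_atomic\<close> guarantees for points of nonzero weight.\<close>
  have "V \<subseteq> real_variety (pideal (set h))" unfolding V_def polar_ideal_def real_variety_ideal_sum by blast
  then have Vh: "peval b v = 0" if "v \<in> V" "b \<in> set h" for v b using that by (auto simp: real_variety_pideal)
  have VS: "v \<in> semialg (pm_family g h)" if "v \<in> V" "v \<in> semialg g" for v
    using that Vh by (auto simp: semialg_def set_pm_family peval_uminus)
  have finV: "finite V" using fin by (simp add: V_def)
  note atomic = eventually_atomic[OF V finV, where g = g]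
  obtain x0 where x0: "x0 \<in> semialg (pm_family g h)" "peval f x0 = fstar" using attained by blast
  \<comment> \<open>The minimiser satisfies the additional equations \<open>h'\<close>, so
    strengthening the constraints does not raise the minimum, and evaluation at \<open>x0\<close>
    remains feasible at every order.\<close>
  have "x0 \<in> V" unfolding V_def by (rule minimizer_in_polar_variety) (use x0 minimum in auto)
  then have x0': "x0 \<in> semialg (pm_family g h')"
    using x0(1) V by (auto simp: semialg_def set_pm_family peval_uminus)
  \<comment> \<open>\<open>tdeg f \<le> d\<close> puts \<open>f\<close> within reach of the
    truncated evaluation at \<open>x0\<close>, while \<open>atomic\<close> at level
    \<open>tdeg f\<close> represents all moments that enter \<open>apply_fun y f\<close>.\<close>
  have "\<forall>\<^sub>F d in sequentially. tdeg f \<le> d" by (rule eventually_ge_at_top)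
  with atomic[of "tdeg f"] have "\<forall>\<^sub>F d in sequentially. fmom f g h' d = ereal fstar"
  proof eventually_elim
    case (elim d)
    show ?case unfolding fmom_def
    proof (rule antisym)
      define y where "y = (\<lambda>\<alpha>. if mdeg \<alpha> \<le> 2 * d then monom_eval \<alpha> x0 else 0)"
      have "y \<in> Lt1 (2 * d) (pm_family g h')" unfolding y_def by (rule point_functional(1)[OF x0'])
      moreover have "apply_fun y f = fstar"
        unfolding y_def x0(2)[symmetric] by (rule point_functional(2)[OF x0']) (use elim in simp)
      ultimately show "Inf ((\<lambda>y. ereal (apply_fun y f)) ` Lt1 (2 * d) (pm_family g h')) \<le> ereal fstar"
        by (intro INF_lower2) auto
    next
      show "ereal fstar \<le> Inf ((\<lambda>y. ereal (apply_fun y f)) ` Lt1 (2 * d) (pm_family g h'))"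
      proof (rule INF_greatest)
        fix y assume y: "y \<in> Lt1 (2 * d) (pm_family g h')"
        obtain w where w: "\<And>v. v \<in> V \<Longrightarrow> 0 \<le> w v" "(\<Sum>v\<in>V. w v) = 1"
          "\<And>v. v \<in> V \<Longrightarrow> w v \<noteq> 0 \<Longrightarrow> v \<in> semialg g"
          "\<And>\<alpha>. mdeg \<alpha> \<le> tdeg f \<Longrightarrow> y \<alpha> = (\<Sum>v\<in>V. w v * monom_eval \<alpha> v)"
          using bspec[OF elim(1) y] by blast
        have "apply_fun y f = (\<Sum>\<alpha>\<in>Poly_Mapping.keys f. \<Sum>v\<in>V. w v * (Poly_Mapping.lookup f \<alpha> * monom_eval \<alpha> v))"
          unfolding apply_fun_def
          by (rule sum.cong[OF refl]) (simp add: w(4)[OF mdeg_le_tdeg] sum_distrib_left mult_ac)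
        also have "\<dots> = (\<Sum>v\<in>V. w v * peval f v)"
          unfolding peval_def sum_distrib_left by (rule sum.swap)
        also have "\<dots> \<ge> (\<Sum>v\<in>V. w v * fstar)"
        proof (rule sum_mono)
          fix v assume v: "v \<in> V"
          show "w v * fstar \<le> w v * peval f v"
          proof (cases "w v = 0")
            case False
            then have "fstar \<le> peval f v" using w(3)[OF v] VS[OF v] minimum by blast
            then show ?thesis using w(1)[OF v] by (rule mult_left_mono)
          qed simp
        qed
        finally show "ereal fstar \<le> ereal (apply_fun y f)"
          using w(2) by (simp flip: sum_distrib_right)
      qed
    qed
  qed
  then have part1: "\<exists>d0. \<forall>d\<ge>d0. fmom f g h' d = ereal fstar" by (simp only: eventually_sequentially)
  have part2: "\<exists>dk. \<forall>d\<ge>dk. \<forall>y\<in>Lt1 (2 * d) (pm_family g h').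
      restrict_fun k y \<in> restrict_fun k ` meas1 (semialg (pm_family g h) \<inter> V)" for k
  proof -
    have "\<forall>\<^sub>F d in sequentially. \<forall>y\<in>Lt1 (2 * d) (pm_family g h').
        restrict_fun k y \<in> restrict_fun k ` meas1 (semialg (pm_family g h) \<inter> V)"
      using atomic[of k]
    proof eventually_elim
      case (elim d)
      show ?case
      proof
        fix y assume y: "y \<in> Lt1 (2 * d) (pm_family g h')"
        obtain w where w: "\<And>v. v \<in> V \<Longrightarrow> 0 \<le> w v" "(\<Sum>v\<in>V. w v) = 1"
          "\<And>v. v \<in> V \<Longrightarrow> w v \<noteq> 0 \<Longrightarrow> v \<in> semialg g"
          "\<And>\<alpha>. mdeg \<alpha> \<le> k \<Longrightarrow> y \<alpha> = (\<Sum>v\<in>V. w v * monom_eval \<alpha> v)"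
          using bspec[OF elim y] by blast
        have "(\<lambda>\<alpha>. \<Sum>v\<in>V. w v * monom_eval \<alpha> v) \<in> meas1 (semialg (pm_family g h) \<inter> V)"
          by (rule atomic_meas1[OF finV]) (use w VS in auto)
        moreover have "restrict_fun k y = restrict_fun k (\<lambda>\<alpha>. \<Sum>v\<in>V. w v * monom_eval \<alpha> v)"
          using w(4) by (auto simp: restrict_fun_def)
        ultimately show "restrict_fun k y \<in> restrict_fun k ` meas1 (semialg (pm_family g h) \<inter> V)" by blast
      qed
    qed
    then show ?thesis by (simp only: eventually_sequentially)
  qed
  have "meas1 (semialg (pm_family g h) \<inter> V) \<subseteq> meas1 (semialg (pm_family g h))"
    by (rule meas1_mono) simp
  then have sub: "restrict_fun k ` meas1 (semialg (pm_family g h) \<inter> V) \<subseteq> restrict_fun k ` meas1 (semialg (pm_family g h))" for k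
    by (rule image_mono)
  show ?thesis using part1 part2 sub unfolding V_def by meson
qed

end
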